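(* Let $x \ge 2$ be a real number and let $q$ and $a$ be positive, coprime integers. Then the (improper) integral below satisfies $$\int_2^{\infty} t^{-2} E(t;q,a)\, dt = g(q,a) + \phi(q)^{-1}\log\log 2,$$ and $$\sum_{\substack{p \le x \\ p \equiv a \bmod q}} p^{-1} = \phi(q)^{-1}\log\log x + g(q,a) + x^{-1}E(x;q,a) - \int_x^{\infty} t^{-2}E(t;q,a)\, dt.$$
   Context: Here $p$ always denotes a prime, $\nu$ a positive integer, $\phi$ is Euler's totient function, $\gamma$ is the Euler-Mascheroni constant. Let $\mathrm{li}(t) = \int_2^t \frac{du}{\log u}$, $\pi(t;q,a) = \#\{p \le t : p \equiv a \bmod q\}$, and $E(t;q,a) = \pi(t;q,a) - \phi(q)^{-1}\mathrm{li}(t)$. For Dirichlet characters $\chi$ modulo $q$ ($\chi_0$ being the principal one), $L(s,\chi)$ is the Dirichlet $L$-function. Powers and logarithms of $L$-functions are branches (in $s$) that are positive, respectively real for real $\chi$, normalised by the Euler product for $s>1$ (so $\log L(s,\chi)\to 0$ as $s \to+\infty$), continued to $s=1$. Let $\mathcal{L}(q,a)$ be the positive real number with $$\mathcal{L}(q,a)^{\phi(q)} = \frac{\phi(q)}{q}\prod_{\chi \ne \chi_0} L(1,\chi)^{\bar{\chi}(a)},$$ the product being over the non-principal Dirichlet characters modulo $q$, and let $$g(q,a) = \phi(q)^{-1}\gamma + \log \mathcal{L}(q,a) - \sum_{\substack{p,\ \nu \ge 2 \\ p^{\nu} \equiv a \bmod q}} \frac{1}{\nu p^{\nu}}.$$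 *)

theory Defs
  imports "HOL-Analysis.Analysis" "HOL-Number_Theory.Number_Theory"
begin

definition primes_pi :: "real \<Rightarrow> nat \<Rightarrow> nat \<Rightarrow> nat" where
  "primes_pi t q a = card {p :: nat. prime p \<and> real p \<le> t \<and> [p = a] (mod q)}"

definition li :: "real \<Rightarrow> real" where
  "li t = integral {2..t} (\<lambda>u. 1 / ln u)"

definition prime_error :: "real \<Rightarrow> nat \<Rightarrow> nat \<Rightarrow> real" where
  "prime_error t q a = real (primes_pi t q a) - li t / real (totient q)"

definition dirichlet_character :: "nat \<Rightarrow> (nat \<Rightarrow> complex) \<Rightarrow> bool" where
  "dirichlet_character q \<psi> \<longleftrightarrow>
     (\<forall>n. \<psi> (n + q) = \<psi> n) \<and>
     (\<forall>m n. \<psi> (m * n) = \<psi> m * \<psi> n) \<and>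
     (\<forall>n. \<psi> n \<noteq> 0 \<longleftrightarrow> coprime n q)"

definition principal_character :: "nat \<Rightarrow> nat \<Rightarrow> complex" where
  "principal_character q n = (if coprime n q then 1 else 0)"

definition nonprincipal_characters :: "nat \<Rightarrow> (nat \<Rightarrow> complex) set" where
  "nonprincipal_characters q = {\<psi>. dirichlet_character q \<psi> \<and> \<psi> \<noteq> principal_character q}"

text \<open>
  For non-principal \<open>\<psi>\<close> the series, summed in the natural order, converges whenever
  \<open>Re s > 0\<close> and therefore agrees there with the analytic continuation of the sum
  over \<open>Re s > 1\<close>.  Below, it is used only for non-principal \<open>\<psi>\<close> and real \<open>s \<ge> 1\<close>.
\<close>

definition dirichlet_L :: "complex \<Rightarrow> (nat \<Rightarrow> complex) \<Rightarrow> complex" where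
  "dirichlet_L s \<psi> = (\<Sum>n. \<psi> (Suc n) / of_nat (Suc n) powr s)"

text \<open>
  A branch of \<open>log L(s, \<psi>)\<close> along the real half-line \<open>s \<ge> 1\<close>.  It is normalised at
  infinity: the logarithm of the Euler product,
  \<open>\<Sum>\<^sub>p \<Sum>\<^sub>\<nu> \<psi>(p\<^sup>\<nu>) / (\<nu> p\<^sup>\<nu>\<^sup>s)\<close> for \<open>s > 1\<close>, tends to 0 as \<open>s\<close> tends to infinity,
  and two continuous logarithms differ by a constant multiple of \<open>2 \<pi> \<i>\<close>.  In
  particular the value at 1 need not be the principal logarithm \<open>Ln\<close> of \<open>L(1, \<psi>)\<close>.
\<close>

definition log_L_branch :: "(nat \<Rightarrow> complex) \<Rightarrow> (real \<Rightarrow> complex) \<Rightarrow> bool" where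
  "log_L_branch \<psi> f \<longleftrightarrow>
     continuous_on {1..} f \<and>
     (\<forall>s\<ge>1. exp (f s) = dirichlet_L (of_real s) \<psi>) \<and>
     (f \<longlongrightarrow> 0) at_top"

definition log_L :: "real \<Rightarrow> (nat \<Rightarrow> complex) \<Rightarrow> complex" where
  "log_L s \<psi> = (THE z. \<exists>f. log_L_branch \<psi> f \<and> f s = z)"

definition L_power :: "real \<Rightarrow> (nat \<Rightarrow> complex) \<Rightarrow> complex \<Rightarrow> complex" where
  "L_power s \<psi> w = exp (w * log_L s \<psi>)"

definition cal_L :: "nat \<Rightarrow> nat \<Rightarrow> real" where
  "cal_L q a = (THE r. r > 0 \<and>
     complex_of_real (r ^ totient q) =
       of_nat (totient q) / of_nat q *
         (\<Prod>\<psi>\<in>nonprincipal_characters q. L_power 1 \<psi> (cnj (\<psi> a))))"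

definition g :: "nat \<Rightarrow> nat \<Rightarrow> real" where
  "g q a = euler_mascheroni / real (totient q) + ln (cal_L q a) -
     (\<Sum>\<^sub>\<infinity>(p, \<nu>)\<in>{(p :: nat, \<nu> :: nat). prime p \<and> \<nu> \<ge> 2 \<and> [p ^ \<nu> = a] (mod q)}.
        1 / (real \<nu> * real p ^ \<nu>))"

end

theory Submission
  imports Defs "HOL-Complex_Analysis.Complex_Analysis" "HOL-Real_Asymp.Real_Asymp"
begin

text \<open>
  Let \<open>S(x)\<close> be the sum of \<open>1/p\<close> over the primes \<open>p \<le> x\<close> with \<open>p \<equiv> a\<close> modulo \<open>q\<close>, and let
  \<open>\<phi> = \<phi>(q)\<close>.  Partial summation evaluates the integral of \<open>E(t)/t\<^sup>2\<close> over \<open>[2, x]\<close> as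
  \<open>S(x) - (log log x)/\<phi> + (log log 2)/\<phi> - E(x)/x\<close>
  (\<open>prime_error_has_integral\<close>).  Hence both claims follow once it is known that
  \<open>S(x) - (log log x)/\<phi>\<close> tends to \<open>g(q, a)\<close>, which is Mertens' theorem for progressions with
  its constant, and that \<open>E(x)/x\<close> tends to 0.  The second fact is a consequence of the first,
  because \<open>S(x) - S(x/2) \<rightarrow> 0\<close> bounds the proportion of the primes in question in \<open>(x/2, x]\<close>.
  The gauge integral over a half-line is by definition a limit of integrals over bounded
  intervals, so convergence of these integrals is all that has to be shown.

  Mertens' theorem is obtained from the behaviour of L-series at real \<open>s\<close> to the right of 1
  by a Tauberian theorem.  Orthogonality of characters expresses \<open>\<phi>\<close> times the sum of
  \<open>1/(\<nu> p\<^sup>\<nu>\<^sup>s)\<close> over \<open>p\<^sup>\<nu> \<equiv> a\<close> through the logarithms of the Euler products of the \<open>L(s, \<chi>)\<close>.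
  When \<open>s\<close> decreases to 1, the principal character contributes \<open>log(\<phi>/q) - log(s - 1)\<close>, since
  its L-series has residue \<open>\<phi>/q\<close>; the others converge to the value at 1 of the branch of
  \<open>log L\<close>, since \<open>L(1, \<chi>) \<noteq> 0\<close>.  So the sum of \<open>p\<^sup>-\<^sup>s\<close> over \<open>p \<equiv> a\<close>, increased by
  \<open>log(s - 1)/\<phi>\<close>, tends to \<open>log \<L>(q, a)\<close> minus the contribution of the \<open>\<nu> \<ge> 2\<close>.

  The theorem \<open>Karamata_Tauberian_harmonic\<close> passes from this Abelian limit to partial sums.
  It compares the masses \<open>1/p\<close> at \<open>log p\<close> with the masses \<open>1/(\<phi> k)\<close> at the positive integers
  \<open>k\<close>.  The transform of the latter, \<open>-log(1 - e\<^sup>-\<^sup>\<delta>)/\<phi>\<close>, has the same singularity as that of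
  the primes, and their partial sums are \<open>1/\<phi>\<close> times harmonic numbers at \<open>log x\<close>; this is
  where \<open>(log log x + \<gamma>)/\<phi>\<close> comes from.

  The nonvanishing of \<open>L(1, \<chi>)\<close> has the two usual cases.  For nonreal \<open>\<chi>\<close> a zero would
  occur for the conjugate character as well, and two zeros against one pole would contradict
  the bound \<open>\<Prod> |L(s, \<chi>)| \<ge> 1\<close>.  For real \<open>\<chi>\<close> the Lambert series \<open>\<Sum> \<chi>(n) x\<^sup>n/(1 - x\<^sup>n)\<close>
  is unbounded as \<open>x \<rightarrow> 1\<close>, because its power series coefficients are nonnegative and at
  least 1 at squares, whereas \<open>L(1, \<chi>) = 0\<close> would force it to be bounded.
\<close>

section \<open>Infinite sums\<close>

lemma summable_on_norm_comparison:
  fixes f :: "'a \<Rightarrow> 'b :: banach" and g :: "'a \<Rightarrow> real"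
  assumes "g summable_on A" "\<And>x. x \<in> A \<Longrightarrow> norm (f x) \<le> g x"
  shows "f summable_on A"
  using abs_summable_summable[OF Infinite_Sum.abs_summable_on_comparison_test'[OF assms]] .

lemma summable_infsum_diff:
  fixes f h :: "'a \<Rightarrow> 'b :: {topological_ab_group_add, t2_space}"
  assumes "f summable_on A" "h summable_on A"
  shows "(\<lambda>x. f x - h x) summable_on A" "infsum (\<lambda>x. f x - h x) A = infsum f A - infsum h A"
proof -
  have "((\<lambda>x. f x + - h x) has_sum (infsum f A + - infsum h A)) A"
    by (intro has_sum_add) (use assms in \<open>auto simp: has_sum_uminus\<close>)
  thus "(\<lambda>x. f x - h x) summable_on A" "infsum (\<lambda>x. f x - h x) A = infsum f A - infsum h A"
    by (auto simp: has_sum_iff)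
qed

lemma has_sum_finite_sum:
  fixes f :: "'a \<Rightarrow> 'b \<Rightarrow> 'c :: {topological_comm_monoid_add, t2_space}"
  assumes "\<And>i. i \<in> A \<Longrightarrow> (f i has_sum s i) X"
  shows "((\<lambda>x. \<Sum>i\<in>A. f i x) has_sum (\<Sum>i\<in>A. s i)) X"
  using assms by (induction A rule: infinite_finite_induct) (auto intro!: has_sum_add)

text \<open>
  Domination makes the unordered sums converge uniformly on a set that belongs to \<open>F\<close>, so
  the two limits may be interchanged.
\<close>
lemma infsum_dominated_convergence:
  fixes f :: "'i \<Rightarrow> 'a \<Rightarrow> 'b :: banach"
  assumes "F \<noteq> bot" and lim: "\<And>i. i \<in> I \<Longrightarrow> ((\<lambda>x. f i x) \<longlongrightarrow> l i) F"
    and bound: "eventually (\<lambda>x. \<forall>i\<in>I. norm (f i x) \<le> M i) F" and M: "M summable_on I"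
  shows "((\<lambda>x. \<Sum>\<^sub>\<infinity>i\<in>I. f i x) \<longlongrightarrow> (\<Sum>\<^sub>\<infinity>i\<in>I. l i)) F"
proof (rule swap_uniform_limit')
  show "uniform_limit {x. \<forall>i\<in>I. norm (f i x) \<le> M i} (\<lambda>X x. \<Sum>i\<in>X. f i x)
          (\<lambda>x. \<Sum>\<^sub>\<infinity>i\<in>I. f i x) (finite_subsets_at_top I)"
    using M by (intro Weierstrass_m_test_general[of I _ f M]) auto
  show "eventually (\<lambda>X. ((\<lambda>x. \<Sum>i\<in>X. f i x) \<longlongrightarrow> (\<Sum>i\<in>X. l i)) F) (finite_subsets_at_top I)"
    by (rule eventually_finite_subsets_at_top_weakI) (auto intro!: tendsto_sum lim)
  have "norm (l i) \<le> M i" if "i \<in> I" for i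
  proof (rule tendsto_upperbound[OF tendsto_norm[OF lim[OF that]]])
    show "eventually (\<lambda>x. norm (f i x) \<le> M i) F" using bound by eventually_elim (use that in auto)
  qed fact
  hence "l summable_on I"
    using abs_summable_summable[OF Infinite_Sum.abs_summable_on_comparison_test'[OF M]] by blast
  thus "((\<lambda>X. \<Sum>i\<in>X. l i) \<longlongrightarrow> (\<Sum>\<^sub>\<infinity>i\<in>I. l i)) (finite_subsets_at_top I)"
    by (rule infsum_tendsto)
  show "eventually (\<lambda>x. x \<in> {x. \<forall>i\<in>I. norm (f i x) \<le> M i}) F" using bound by simp
qed simp

lemma has_sum_of_real_eq:
  fixes z :: complex
  assumes "((\<lambda>x. of_real (f x)) has_sum z) A"
  shows "z = of_real (infsum f A)"
proof -
  have "(f has_sum Re z) A" "((\<lambda>x. 0) has_sum Im z) A"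
    using has_sum_Re[OF assms] has_sum_Im[OF assms] by simp_all
  hence "Re z = infsum f A" "Im z = 0" using infsumI[of f] has_sum_unique[OF _ has_sum_0_simp] by auto
  thus ?thesis by (simp add: complex_eq_iff)
qed

section \<open>A Tauberian theorem of Karamata type\<close>

text \<open>
  The step function differs from the identity by \<open>x (1 - x)\<close> times a function that is
  continuous except for a jump at \<open>1/2\<close>.  Steep ramps to the left and to the right of the
  jump enclose this quotient between continuous functions whose integrals differ little, and
  Weierstrass approximation replaces those by polynomials.  The factor \<open>x\<close> makes the enclosing
  polynomials vanish at 0, as is needed for series of values at \<open>e\<^sup>-\<^sup>\<delta>\<^sup>k\<close>; the factor \<open>1 - x\<close>
  compensates the weights \<open>1/k\<close> of the harmonic series.
\<close>
lemma polynomial_sandwich_of_step: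
  fixes e :: real
  assumes "e > 0"
  obtains p1 p2 :: "real \<Rightarrow> real" where
    "real_polynomial_function p1" "real_polynomial_function p2"
    "\<And>x. x \<in> {0..1} \<Longrightarrow> x + x * (1 - x) * p1 x \<le> (if x \<ge> 1/2 then 1 else 0)"
    "\<And>x. x \<in> {0..1} \<Longrightarrow> (if x \<ge> 1/2 then 1 else 0) \<le> x + x * (1 - x) * p2 x"
    "integral {0..1} (\<lambda>x. p2 x - p1 x) \<le> e"
proof -
  \<comment> \<open>The two approximation errors add at most \<open>4 n\<close> to the integral of the gap, and the ramps, of
    height at most 4 on an interval of length \<open>2 n\<close>, add at most \<open>8 n\<close>.\<close>
  define n :: real where "n = e / 12"
  have n: "n > 0" using assms by (simp add: n_def)
  \<comment> \<open>\<open>A\<close> and \<open>B\<close> continuously extend the two branches of the quotient (step - identity) / (x (1 - x)).\<close>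
  define A where "A = (\<lambda>x::real. - 1 / (1 - min x (1/2)))"
  define B where "B = (\<lambda>x::real. 1 / max x (1/2))"
  \<comment> \<open>Continuous ramps from 0 to 1 of width \<open>n\<close>, after and before the jump.\<close>
  define r1 where "r1 = (\<lambda>x::real. max 0 (min 1 ((x - 1/2) / n)))"
  define r2 where "r2 = (\<lambda>x::real. max 0 (min 1 ((x - 1/2 + n) / n)))"
  define h1 where "h1 = (\<lambda>x. A x + (B x - A x) * r1 x)"
  define h2 where "h2 = (\<lambda>x. A x + (B x - A x) * r2 x)"
  have cA: "continuous_on S A" for S
    unfolding A_def by (intro continuous_intros) (auto simp: min_def)
  have cB: "continuous_on S B" for S
    unfolding B_def by (intro continuous_intros) (auto simp: max_def)
  have cr: "continuous_on S r1" "continuous_on S r2" for S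
    unfolding r1_def r2_def using n by (intro continuous_intros; simp)+
  have ch: "continuous_on S h1" "continuous_on S h2" for S
    unfolding h1_def h2_def by (intro continuous_intros cA cB cr)+
  obtain p1 where p1: "real_polynomial_function p1" "\<And>x. x \<in> {0..1} \<Longrightarrow> \<bar>(h1 x - n) - p1 x\<bar> < n"
  proof (rule Stone_Weierstrass_real_polynomial_function[of "{0..1::real}" "\<lambda>x. h1 x - n" n])
    show "continuous_on {0..1} (\<lambda>x. h1 x - n)" by (intro continuous_intros ch)
  qed (use n in auto)
  obtain p2 where p2: "real_polynomial_function p2" "\<And>x. x \<in> {0..1} \<Longrightarrow> \<bar>(h2 x + n) - p2 x\<bar> < n"
  proof (rule Stone_Weierstrass_real_polynomial_function[of "{0..1::real}" "\<lambda>x. h2 x + n" n])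
    show "continuous_on {0..1} (\<lambda>x. h2 x + n)" by (intro continuous_intros ch)
  qed (use n in auto)
  have AB: "-2 \<le> A x" "A x \<le> 0" "0 \<le> B x" "B x \<le> 2" for x
    by (auto simp: A_def B_def min_def max_def field_simps)
  have r: "0 \<le> r1 x" "r1 x \<le> 1" "0 \<le> r2 x" "r2 x \<le> 1" for x
    by (auto simp: r1_def r2_def)
  have r1': "r1 x = 0" if "x < 1/2" for x
    using that n by (auto simp: r1_def divide_simps)
  have r2': "r2 x = 1" if "x \<ge> 1/2" for x
    using that n by (auto simp: r2_def divide_simps)
  have h1: "h1 x \<le> A x" if "x < 1/2" for x using that by (simp add: h1_def r1')
  have h1': "h1 x \<le> B x" for x
  proof -
    have "(B x - A x) * r1 x \<le> (B x - A x) * 1"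
      by (rule mult_left_mono) (use r AB[of x] in auto)
    thus ?thesis by (simp add: h1_def)
  qed
  have h2: "A x \<le> h2 x" for x
    using AB[of x] r[of x] by (simp add: h2_def)
  have h2': "B x \<le> h2 x" if "x \<ge> 1/2" for x using that by (simp add: h2_def r2')
  have P1: "p1 x \<le> h1 x" "h1 x - 2 * n \<le> p1 x" if "x \<in> {0..1}" for x
    using p1(2)[OF that] by linarith+
  have P2: "h2 x \<le> p2 x" "p2 x \<le> h2 x + 2 * n" if "x \<in> {0..1}" for x
    using p2(2)[OF that] by linarith+
  have r12: "r1 x \<le> r2 x" for x
  proof -
    have "(x - 1/2) / n \<le> (x - 1/2 + n) / n" using n by (intro divide_right_mono) auto
    thus ?thesis unfolding r1_def r2_def by linarith
  qed
  show thesis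
  proof (rule that[OF p1(1) p2(1)])
    fix x :: real assume x: "x \<in> {0..1}"
    have lo: "x + x * (1 - x) * A x = 0" if "x < 1/2"
      using that x by (simp add: A_def field_simps)
    have hi: "x + x * (1 - x) * B x = 1" if "x \<ge> 1/2"
      using that x by (simp add: B_def field_simps)
    have xx: "x * (1 - x) \<ge> 0" using x by simp
    have m: "u \<le> v \<Longrightarrow> x + x * (1 - x) * u \<le> x + x * (1 - x) * v" for u v
      using mult_left_mono[OF _ xx] by auto
    show "x + x * (1 - x) * p1 x \<le> (if x \<ge> 1/2 then 1 else 0)"
      using m[of "p1 x" "A x"] m[of "p1 x" "B x"] lo hi P1(1)[OF x] h1[of x] h1'[of x]
      by (cases "x \<ge> 1/2") force+
    show "(if x \<ge> 1/2 then 1 else 0) \<le> x + x * (1 - x) * p2 x"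
      using m[of "A x" "p2 x"] m[of "B x" "p2 x"] lo hi P2(1)[OF x] h2[of x] h2'[of x]
      by (cases "x \<ge> 1/2") force+
  next
    have cp: "continuous_on {0..1} p1" "continuous_on {0..1} p2"
      using p1(1) p2(1) by (metis continuous_on_polymonial_function real_polynomial_function_eq)+
    have bnd: "p2 x - p1 x \<le> 4 * n + 4 * indicat_real {1/2 - n .. 1/2 + n} x" if "x \<in> {0..1}" for x
    proof -
      have "(B x - A x) * (r2 x - r1 x) \<le> 4 * (r2 x - r1 x)"
        using AB[of x] r12[of x] by (intro mult_right_mono) auto
      moreover have "r2 x - r1 x \<le> indicat_real {1/2 - n .. 1/2 + n} x"
      proof (cases "x \<in> {1/2 - n .. 1/2 + n}")
        case True thus ?thesis using r[of x] by simp
      next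
        case False
        then consider "x < 1/2 - n" | "x > 1/2 + n" by fastforce
        thus ?thesis
        proof cases
          case 1
          hence "r2 x = 0" using n by (auto simp: r2_def divide_simps)
          thus ?thesis using r[of x] by (simp add: indicator_def)
        next
          case 2
          hence "r1 x = 1" using n by (auto simp: r1_def divide_simps)
          thus ?thesis using r[of x] by (simp add: indicator_def)
        qed
      qed
      moreover have "h2 x - h1 x = (B x - A x) * (r2 x - r1 x)"
        by (simp add: h1_def h2_def algebra_simps)
      ultimately have "h2 x - h1 x \<le> 4 * indicat_real {1/2 - n .. 1/2 + n} x" by simp
      thus ?thesis using P1(2)[OF that] P2(2)[OF that] by linarith
    qed
    have I1: "((\<lambda>x::real. 1::real) has_integral (2 * n)) {1/2 - n .. 1/2 + n}"
      using has_integral_const_real[of "1::real" "1/2 - n" "1/2 + n"] n by simp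
    have int_ind: "indicat_real {1/2 - n .. 1/2 + n} integrable_on {0..1}"
      and le_ind: "integral {0..1} (indicat_real {1/2 - n .. 1/2 + n}) \<le> 2 * n"
    proof -
      have U: "(indicat_real {1/2 - n .. 1/2 + n} has_integral 2 * n) UNIV"
        using has_integral_restrict_UNIV[of "{1/2 - n .. 1/2 + n}" "\<lambda>x. 1::real" "2*n"] I1
        unfolding indicator_def of_bool_def by simp
      hence i: "indicat_real {1/2 - n .. 1/2 + n} integrable_on UNIV" by blast
      show *: "indicat_real {1/2 - n .. 1/2 + n} integrable_on {0..1}"
        using integrable_on_subcbox[OF i, of 0 1] by simp
      show "integral {0..1} (indicat_real {1/2 - n .. 1/2 + n}) \<le> 2 * n"
        using integral_subset_le[OF _ * i] U by (simp add: integral_unique)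
    qed
    have "integral {0..1} (\<lambda>x. p2 x - p1 x) \<le> integral {0..1} (\<lambda>x. 4 * n + 4 * indicat_real {1/2 - n .. 1/2 + n} x)"
      by (intro integral_le bnd integrable_continuous_real continuous_intros cp integrable_add
            integrable_on_mult_right int_ind) auto
    also have "\<dots> = 4 * n + 4 * integral {0..1} (indicat_real {1/2 - n .. 1/2 + n})"
      by (subst integral_add) (auto intro!: integrable_on_mult_right int_ind simp: integral_mult_right)
    also have "\<dots> \<le> e" using le_ind by (simp add: n_def)
    finally show "integral {0..1} (\<lambda>x. p2 x - p1 x) \<le> e" .
  qed
qed

text \<open>
  For a monomial the sum is geometric, and \<open>(1 - e\<^sup>-\<^sup>\<delta>) / (1 - e\<^sup>-\<^sup>\<delta>\<^sup>m)\<close> tends to \<open>1/m\<close>.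
  In other words these are Riemann sums along a geometric partition of the unit interval.
\<close>
lemma Abel_weighted_sum_tendsto_integral:
  fixes q :: "real \<Rightarrow> real"
  assumes "real_polynomial_function q"
  shows "\<And>d::real. d > 0 \<Longrightarrow> (\<lambda>k::nat. exp (-d * k) * q (exp (-d * k))) summable_on {1..}"
    and "((\<lambda>d::real. (1 - exp (-d)) * (\<Sum>\<^sub>\<infinity>k::nat\<in>{1..}. exp (-d * k) * q (exp (-d * k))))
            \<longlongrightarrow> integral {0..1} q) (at_right 0)"
proof -
  obtain a n where q: "q = (\<lambda>x. \<Sum>i\<le>n. a i * x ^ i)"
    using assms real_polynomial_function_iff_sum by auto
  have hs: "((\<lambda>k::nat. exp (-d * k) * q (exp (-d * k))) has_sum
     (\<Sum>i\<le>n. a i * (exp (-d * Suc i) / (1 - exp (-d * Suc i))))) {1..}" if d: "d > 0" for d :: real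
  proof -
    have "((\<lambda>k::nat. \<Sum>i\<le>n. a i * exp (-d * Suc i) ^ k) has_sum
     (\<Sum>i\<le>n. a i * (exp (-d * Suc i) / (1 - exp (-d * Suc i))))) {1..}"
      by (intro has_sum_finite_sum has_sum_cmult_right has_sum_geometric_from_1)
         (use d in \<open>auto simp: mult_less_0_iff\<close>)
    moreover have "(\<Sum>i\<le>n. a i * exp (-d * Suc i) ^ k) = exp (-d * k) * q (exp (-d * k))" for k :: nat
    proof -
      have "exp (-d * Suc i) ^ k = exp (-d * k) * exp (-d * k) ^ i" for i
      proof -
        have "exp (-d * Suc i) ^ k = exp (k * (-d * Suc i))" by (simp only: exp_of_nat_mult)
        also have "k * (-d * Suc i) = (-d * k) + i * (-d * k)" by (simp add: algebra_simps)
        also have "exp \<dots> = exp (-d * k) * exp (-d * k) ^ i" by (simp only: exp_add exp_of_nat_mult)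
        finally show ?thesis .
      qed
      thus ?thesis by (simp only: q sum_distrib_left mult.left_commute)
    qed
    ultimately show ?thesis by simp
  qed
  show "\<And>d::real. d > 0 \<Longrightarrow> (\<lambda>k::nat. exp (-d * k) * q (exp (-d * k))) summable_on {1..}"
    using hs by (auto simp: summable_on_def)
  have i: "integral {0..1} q = (\<Sum>i\<le>n. a i * (1 / Suc i))"
  proof (rule integral_unique)
    have "((\<lambda>x. x ^ i) has_integral (1 / Suc i)) {0..1::real}" for i
    proof -
      have "((\<lambda>x::real. x ^ i) has_integral (1 ^ Suc i / Suc i - 0 ^ Suc i / Suc i)) {0..1}"
      proof (rule fundamental_theorem_of_calculus)
        fix x :: real
        have "((\<lambda>x. x ^ Suc i / Suc i) has_real_derivative x ^ i) (at x within {0..1})"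
          by (rule derivative_eq_intros refl | simp)+
        thus "((\<lambda>x. x ^ Suc i / Suc i) has_vector_derivative x ^ i) (at x within {0..1})"
          by (simp add: has_real_derivative_iff_has_vector_derivative)
      qed simp
      thus ?thesis by simp
    qed
    thus "(q has_integral (\<Sum>i\<le>n. a i * (1 / Suc i))) {0..1}"
      unfolding q by (intro has_integral_sum has_integral_mult_right) auto
  qed
  have "((\<lambda>d::real. \<Sum>i\<le>n. a i * ((1 - exp (-d)) * (exp (-d * Suc i) / (1 - exp (-d * Suc i)))))
     \<longlongrightarrow> (\<Sum>i\<le>n. a i * (1 / Suc i))) (at_right 0)"
  proof (intro tendsto_sum tendsto_mult tendsto_const)
    fix i :: nat
    define c where "c = real (Suc i)"
    have "c > 0" by (simp add: c_def)
    hence "((\<lambda>d::real. (1 - exp (-d)) * (exp (-d * c) / (1 - exp (-d * c)))) \<longlongrightarrow> 1 / c) (at_right 0)"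
      by real_asymp (simp add: field_simps)
    thus "((\<lambda>d::real. (1 - exp (-d)) * (exp (-d * Suc i) / (1 - exp (-d * Suc i)))) \<longlongrightarrow> 1 / Suc i) (at_right 0)"
      by (simp add: c_def)
  qed
  also have "?this \<longleftrightarrow> ((\<lambda>d. (1 - exp (-d)) * (\<Sum>\<^sub>\<infinity>k::nat\<in>{1..}. exp (-d * k) * q (exp (-d * k))))
            \<longlongrightarrow> integral {0..1} q) (at_right 0)"
    unfolding i
  proof (rule filterlim_cong[OF refl refl], rule eventually_at_rightI[of 0 1])
    fix d :: real assume "d \<in> {0<..<1}"
    hence "d > 0" by simp
    from infsumI[OF hs[OF this]] show
     "(\<Sum>i\<le>n. a i * ((1 - exp (-d)) * (exp (-d * Suc i) / (1 - exp (-d * Suc i))))) =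
      (1 - exp (-d)) * (\<Sum>\<^sub>\<infinity>k::nat\<in>{1..}. exp (-d * k) * q (exp (-d * k)))"
      by (simp add: sum_distrib_left mult_ac)
  qed auto
  finally show "((\<lambda>d::real. (1 - exp (-d)) * (\<Sum>\<^sub>\<infinity>k::nat\<in>{1..}. exp (-d * k) * q (exp (-d * k))))
            \<longlongrightarrow> integral {0..1} q) (at_right 0)" .
qed

lemma has_sum_log_series:
  fixes z :: real
  assumes "0 \<le> z" "z < 1"
  shows "((\<lambda>k::nat. z ^ k / k) has_sum - ln (1 - z)) {1..}"
proof -
  have "(\<lambda>k. - ((- (- z)) ^ k) / k) sums ln (1 + - z)"
    using ln_series'[of "-z"] assms by simp
  hence "(\<lambda>k. z ^ k / k) sums - ln (1 - z)" using sums_minus by fastforce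
  hence "((\<lambda>k::nat. z ^ k / k) has_sum - ln (1 - z)) UNIV"
    using assms by (intro sums_nonneg_imp_has_sum) auto
  thus ?thesis
    by (rule has_sum_cong_neutral[THEN iffD1, rotated -1]) auto
qed

text \<open>
  Karamata's method.  For a function \<open>\<phi>\<close> on the unit interval consider
  \<open>T(\<phi>, \<delta>) = \<Sum> w\<^sub>i \<phi>(e\<^sup>-\<^sup>\<delta>\<^sup>\<lambda>) - C \<Sum> \<phi>(e\<^sup>-\<^sup>\<delta>\<^sup>k)/k\<close>, where \<open>\<lambda>\<close> stands for \<open>lam i\<close>.
  The hypothesis describes \<open>\<phi>(x) = x\<close>; rescaling \<open>\<delta>\<close> gives the powers of \<open>x\<close> and hence every
  polynomial \<open>\<phi>\<close> with \<open>\<phi>(0) = 0\<close>, with limit \<open>s \<phi>(1)\<close>.  The conclusion is the same limit for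
  the indicator of \<open>[1/2, 1]\<close>, at \<open>\<delta> = (ln 2)/y\<close>.  Since the \<open>w\<^sub>i\<close> are nonnegative, replacing
  the indicator by an enclosing polynomial costs only the difference of the harmonic parts,
  and by \<open>Abel_weighted_sum_tendsto_integral\<close> the limit of this difference is at most \<open>C\<close> times
  the integral of \<open>p\<^sub>2 - p\<^sub>1\<close>, where \<open>x + x (1 - x) p\<^sub>i(x)\<close> are the enclosing polynomials.
\<close>
theorem Karamata_Tauberian_harmonic:
  fixes w lam :: "'i \<Rightarrow> real" and C s :: real
  assumes w: "\<And>i. i \<in> I \<Longrightarrow> w i \<ge> 0" and lam: "\<And>i. i \<in> I \<Longrightarrow> lam i > 0" and C: "C \<ge> 0"
    and summ: "\<And>d. d > 0 \<Longrightarrow> (\<lambda>i. w i * exp (-d * lam i)) summable_on I"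
    and lim: "((\<lambda>d. (\<Sum>\<^sub>\<infinity>i\<in>I. w i * exp (-d * lam i)) + C * ln (1 - exp (-d))) \<longlongrightarrow> s) (at_right 0)"
  shows "((\<lambda>y. (\<Sum>\<^sub>\<infinity>i\<in>{i\<in>I. lam i \<le> y}. w i) - C * harm (nat \<lfloor>y\<rfloor>)) \<longlongrightarrow> s) at_top"
proof -
  define W where "W = (\<lambda>\<phi> d::real. \<Sum>\<^sub>\<infinity>i\<in>I. w i * \<phi> (exp (-d * lam i)))"
  define K where "K = (\<lambda>\<phi> d::real. \<Sum>\<^sub>\<infinity>k::nat\<in>{1..}. \<phi> (exp (-d * k)) / k)"
  define f where "f = (\<lambda>x::real. if x \<ge> 1/2 then 1 else 0 :: real)"
  have K1: "((\<lambda>k::nat. exp (-d * k) / k) has_sum - ln (1 - exp (-d))) {1..}" if "d > 0" for d :: real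
    using has_sum_log_series[of "exp (-d)"] that by (simp add: mult_ac flip: exp_of_nat_mult)
  have sW: "(\<lambda>i. w i * \<phi> (exp (-d * lam i))) summable_on I"
    if d: "d > 0" and M: "\<And>x. x \<in> {0..1} \<Longrightarrow> \<bar>\<phi> x\<bar> \<le> M * x" for d :: real and \<phi> M
  proof (rule summable_on_norm_comparison)
    show "(\<lambda>i. M * (w i * exp (-d * lam i))) summable_on I"
      by (intro summable_on_cmult_right summ d)
    fix i assume i: "i \<in> I"
    have "\<bar>\<phi> (exp (-d * lam i))\<bar> \<le> M * exp (-d * lam i)"
      using M[of "exp (-d * lam i)"] d lam[OF i] by (simp add: mult_le_0_iff)
    from mult_left_mono[OF this w[OF i]]
    show "norm (w i * \<phi> (exp (-d * lam i))) \<le> M * (w i * exp (-d * lam i))"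
      using w[OF i] by (simp add: abs_mult mult_ac)
  qed
  have sK: "(\<lambda>k::nat. \<phi> (exp (-d * k)) / k) summable_on {1..}"
    if d: "d > 0" and M: "\<And>x. x \<in> {0..1} \<Longrightarrow> \<bar>\<phi> x\<bar> \<le> M * x" for d :: real and \<phi> M
  proof (rule summable_on_norm_comparison)
    show "(\<lambda>k::nat. M * (exp (-d * k) / k)) summable_on {1..}"
      using K1[OF d] by (intro summable_on_cmult_right) (auto simp: summable_on_def)
    fix k :: nat assume "k \<in> {1..}"
    thus "norm (\<phi> (exp (-d * k)) / k) \<le> M * (exp (-d * k) / k)"
      using M[of "exp (-d * k)"] d by (simp add: divide_right_mono)
  qed
  have mono: "W \<phi> d - C * K \<phi> d - (W \<psi> d - C * K \<psi> d) \<le>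
                C * ((1 - exp (-d)) * (\<Sum>\<^sub>\<infinity>k::nat\<in>{1..}. exp (-d * k) * q (exp (-d * k))))"
    if d: "d > 0" and q: "real_polynomial_function q"
      and le: "\<And>x. x \<in> {0..1} \<Longrightarrow> \<phi> x \<le> \<psi> x"
      and gap: "\<And>x. x \<in> {0..1} \<Longrightarrow> \<psi> x - \<phi> x \<le> x * (1 - x) * q x"
      and M: "\<And>x. x \<in> {0..1} \<Longrightarrow> \<bar>\<phi> x\<bar> \<le> M * x"  "\<And>x. x \<in> {0..1} \<Longrightarrow> \<bar>\<psi> x\<bar> \<le> M * x"
    for d :: real and \<phi> \<psi> M q
  proof -
    have "W \<phi> d \<le> W \<psi> d" unfolding W_def
      by (intro infsum_mono sW[where M = M] mult_left_mono w le M d) (use lam d in \<open>auto simp: mult_le_0_iff intro: less_imp_le\<close>)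
    moreover have "K \<psi> d - K \<phi> d \<le> (1 - exp (-d)) * (\<Sum>\<^sub>\<infinity>k::nat\<in>{1..}. exp (-d * k) * q (exp (-d * k)))"
    proof -
      have "K \<psi> d - K \<phi> d = (\<Sum>\<^sub>\<infinity>k::nat\<in>{1..}. \<psi> (exp (-d * k)) / k - \<phi> (exp (-d * k)) / k)"
        unfolding K_def using sK[where M = M, OF d M(1)] sK[where M = M, OF d M(2)]
        by (simp add: summable_infsum_diff(2))
      also have "\<dots> \<le> (\<Sum>\<^sub>\<infinity>k::nat\<in>{1..}. (1 - exp (-d)) * (exp (-d * k) * q (exp (-d * k))))"
      proof (rule infsum_mono)
        show "(\<lambda>k::nat. \<psi> (exp (-d * k)) / k - \<phi> (exp (-d * k)) / k) summable_on {1..}"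
          by (intro summable_infsum_diff(1) sK[where M = M] d M)
        show "(\<lambda>k::nat. (1 - exp (-d)) * (exp (-d * k) * q (exp (-d * k)))) summable_on {1..}"
          by (intro summable_on_cmult_right Abel_weighted_sum_tendsto_integral(1) q d)
        fix k :: nat assume k: "k \<in> {1..}"
        define x where "x = exp (-d * k)"
        have x: "x \<in> {0..1}" using d k by (simp add: x_def)
        have "x = exp (-d) ^ k" by (simp add: x_def mult_ac flip: exp_of_nat_mult)
        \<comment> \<open>This cancels the weight \<open>1/k\<close> against the factor \<open>1 - x\<close> of the gap.\<close>
        hence *: "(1 - x) / k \<le> 1 - exp (-d)"
          using Bernoulli_inequality[of "exp (-d) - 1" k] k by (simp add: field_simps)
        have nn: "x * (1 - x) * q x \<ge> 0" using le[OF x] gap[OF x] by linarith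
        have "x * q x \<ge> 0"
        proof (cases "x = 1")
          case False
          with x have "1 - x > 0" by simp
          moreover have "0 \<le> (1 - x) * (x * q x)" using nn by (simp only: mult_ac)
          ultimately show ?thesis using zero_le_mult_iff[of "1 - x" "x * q x"] by linarith
        next
          case True
          hence "d * real k = 0" by (simp add: x_def)
          with d k show ?thesis by simp
        qed
        from mult_left_mono[OF * this] have "x * (1 - x) * q x / k \<le> (1 - exp (-d)) * (x * q x)"
          by (simp add: mult_ac)
        moreover have "(\<psi> x - \<phi> x) / k \<le> x * (1 - x) * q x / k"
          by (intro divide_right_mono gap x) auto
        ultimately show "\<psi> (exp (-d * k)) / k - \<phi> (exp (-d * k)) / k \<le> (1 - exp (-d)) * (exp (-d * k) * q (exp (-d * k)))"
          unfolding x_def by (simp add: diff_divide_distrib)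
      qed
      also have "\<dots> = (1 - exp (-d)) * (\<Sum>\<^sub>\<infinity>k::nat\<in>{1..}. exp (-d * k) * q (exp (-d * k)))"
        by (rule infsum_cmult_right')
      finally show ?thesis .
    qed
    ultimately show ?thesis using mult_left_mono[OF _ C] by (smt (verit) right_diff_distrib')
  qed
  \<comment> \<open>A bound by a multiple of \<open>x\<close> makes the transforms of these polynomials converge.\<close>
  have bound: "\<exists>M. \<forall>x\<in>{0..1}. \<bar>x + x * (1 - x) * p x\<bar> \<le> M * x" if p: "real_polynomial_function p" for p
  proof -
    have "continuous_on {0..1} (\<lambda>x. 1 + (1 - x) * p x)"
      using p by (intro continuous_intros) (metis continuous_on_polymonial_function real_polynomial_function_eq)
    hence "bounded ((\<lambda>x. 1 + (1 - x) * p x) ` {0..1})"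
      using compact_Icc compact_continuous_image compact_imp_bounded by blast
    then obtain M where M: "\<And>x. x \<in> {0..1} \<Longrightarrow> \<bar>1 + (1 - x) * p x\<bar> \<le> M"
      unfolding bounded_iff by (metis (no_types, lifting) image_eqI real_norm_def)
    have "\<bar>x + x * (1 - x) * p x\<bar> \<le> M * x" if x: "x \<in> {0..1}" for x
    proof -
      have "x + x * (1 - x) * p x = x * (1 + (1 - x) * p x)" by (simp add: algebra_simps)
      also have "\<bar>\<dots>\<bar> \<le> x * M" using M[OF x] x by (simp add: abs_mult mult_left_mono)
      finally show ?thesis by (simp add: mult.commute)
    qed
    thus ?thesis by blast
  qed
  have poly: "((\<lambda>d. W (\<lambda>x. x + x * (1 - x) * p x) d - C * K (\<lambda>x. x + x * (1 - x) * p x) d) \<longlongrightarrow> s) (at_right 0)"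
    if p: "real_polynomial_function p" for p
  proof -
    have "real_polynomial_function (\<lambda>x. 1 + (1 - x) * p x)"
      by (rule real_polynomial_function.intros real_polynomial_function_diff p bounded_linear_ident)+
    then obtain c n where c: "(\<lambda>x. 1 + (1 - x) * p x) = (\<lambda>x. \<Sum>i\<le>n. c i * x ^ i)"
      using real_polynomial_function_iff_sum by auto
    have c1: "(\<Sum>i\<le>n. c i) = 1" using fun_cong[OF c, of 1] by simp
    have P: "x + x * (1 - x) * p x = (\<Sum>i\<le>n. c i * x ^ Suc i)" for x
    proof -
      have "x + x * (1 - x) * p x = x * (1 + (1 - x) * p x)" by (simp add: algebra_simps)
      also have "\<dots> = (\<Sum>i\<le>n. c i * x ^ Suc i)"
        unfolding fun_cong[OF c] by (simp add: sum_distrib_left mult_ac)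
      finally show ?thesis .
    qed
    define F where "F = (\<lambda>d. (\<Sum>\<^sub>\<infinity>i\<in>I. w i * exp (-d * lam i)) + C * ln (1 - exp (-d)))"
    have pow: "exp (-d * y) ^ Suc i = exp (-(real (Suc i) * d) * y)" for d y :: real and i
    proof -
      have "exp (-d * y) ^ Suc i = exp (real (Suc i) * (-d * y))" by (simp only: exp_of_nat_mult)
      thus ?thesis by (simp only: minus_mult_left[symmetric] mult_minus_right mult.assoc)
    qed
    \<comment> \<open>The monomial of degree \<open>i + 1\<close> at \<open>\<delta>\<close> is the identity function at \<open>(i + 1) \<delta>\<close>.\<close>
    have eq: "W (\<lambda>x. x + x * (1 - x) * p x) d - C * K (\<lambda>x. x + x * (1 - x) * p x) d
                = (\<Sum>i\<le>n. c i * F (real (Suc i) * d))" if d: "d > 0" for d :: real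
    proof -
      have d': "real (Suc i) * d > 0" for i using d by simp
      have "((\<lambda>j. \<Sum>i\<le>n. c i * (w j * exp (-(real (Suc i) * d) * lam j))) has_sum
             (\<Sum>i\<le>n. c i * (\<Sum>\<^sub>\<infinity>j\<in>I. w j * exp (-(real (Suc i) * d) * lam j)))) I"
        by (intro has_sum_finite_sum has_sum_cmult_right has_sum_infsum summ d')
      also have "(\<lambda>j. \<Sum>i\<le>n. c i * (w j * exp (-(real (Suc i) * d) * lam j)))
                   = (\<lambda>j. w j * (\<Sum>i\<le>n. c i * exp (-d * lam j) ^ Suc i))"
        unfolding pow by (simp add: sum_distrib_left mult_ac)
      finally have 1: "W (\<lambda>x. x + x * (1 - x) * p x) d =
             (\<Sum>i\<le>n. c i * (\<Sum>\<^sub>\<infinity>j\<in>I. w j * exp (-(real (Suc i) * d) * lam j)))"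
        unfolding W_def P by (rule infsumI)
      have "((\<lambda>k::nat. \<Sum>i\<le>n. c i * (exp (-(real (Suc i) * d) * k) / k)) has_sum
             (\<Sum>i\<le>n. c i * (- ln (1 - exp (- (real (Suc i) * d)))))) {1..}"
        by (intro has_sum_finite_sum has_sum_cmult_right K1 d')
      also have "(\<lambda>k::nat. \<Sum>i\<le>n. c i * (exp (-(real (Suc i) * d) * k) / k))
                   = (\<lambda>k. (\<Sum>i\<le>n. c i * exp (-d * k) ^ Suc i) / k)"
        unfolding pow by (simp add: sum_divide_distrib mult_ac)
      finally have 2: "K (\<lambda>x. x + x * (1 - x) * p x) d =
             (\<Sum>i\<le>n. c i * (- ln (1 - exp (- (real (Suc i) * d)))))"
        unfolding K_def P by (rule infsumI)
      show ?thesis unfolding 1 2 F_def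
        by (simp add: sum_distrib_left sum.distrib[symmetric] sum_negf algebra_simps)
    qed
    have "((\<lambda>d::real. \<Sum>i\<le>n. c i * F (Suc i * d)) \<longlongrightarrow> (\<Sum>i\<le>n. c i * s)) (at_right 0)"
    proof (intro tendsto_intros)
      fix i
      have "filterlim (\<lambda>d::real. real (Suc i) * d) (at_right 0) (at_right 0)"
      proof -
        define m where "m = real (Suc i)"
        have "m > 0" by (simp add: m_def)
        hence "filterlim (\<lambda>d. m * d) (at_right 0) (at_right 0)" by real_asymp
        thus ?thesis by (simp add: m_def)
      qed
      from filterlim_compose[OF lim[folded F_def] this]
      show "((\<lambda>d::real. F (real (Suc i) * d)) \<longlongrightarrow> s) (at_right 0)" .
    qed
    also have "(\<Sum>i\<le>n. c i * s) = s" using c1 by (simp flip: sum_distrib_right)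
    also have "((\<lambda>d::real. \<Sum>i\<le>n. c i * F (Suc i * d)) \<longlongrightarrow> s) (at_right 0) \<longleftrightarrow> ?thesis"
      by (rule filterlim_cong[OF refl refl], rule eventually_at_rightI[of 0 1]) (simp_all add: eq)
    finally show ?thesis .
  qed
  have main: "((\<lambda>d. W f d - C * K f d) \<longlongrightarrow> s) (at_right 0)"
  proof (rule tendstoI)
    fix e :: real assume e: "e > 0"
    define e' where "e' = e / (2 * (C + 1))"
    have e': "e' > 0" "C * e' < e / 2" using e C by (auto simp: e'_def field_simps)
    obtain p1 p2 where p: "real_polynomial_function p1" "real_polynomial_function p2"
      "\<And>x. x \<in> {0..1} \<Longrightarrow> x + x * (1 - x) * p1 x \<le> f x"
      "\<And>x. x \<in> {0..1} \<Longrightarrow> f x \<le> x + x * (1 - x) * p2 x"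
      "integral {0..1} (\<lambda>x. p2 x - p1 x) \<le> e'"
      by (rule polynomial_sandwich_of_step[OF e'(1)]) (simp add: f_def)
    define q where "q = (\<lambda>x. p2 x - p1 x)"
    have q: "real_polynomial_function q" unfolding q_def by (intro real_polynomial_function_diff p)
    define P1 where "P1 = (\<lambda>x. x + x * (1 - x) * p1 x)"
    define P2 where "P2 = (\<lambda>x. x + x * (1 - x) * p2 x)"
    obtain M1 M2 where M1: "\<And>x. x \<in> {0..1} \<Longrightarrow> \<bar>P1 x\<bar> \<le> M1 * x"
      and M2: "\<And>x. x \<in> {0..1} \<Longrightarrow> \<bar>P2 x\<bar> \<le> M2 * x"
      using bound[OF p(1)] bound[OF p(2)] unfolding P1_def P2_def by blast
    define M where "M = max 2 (max M1 M2)"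
    have "M1 * x \<le> M * x" "M2 * x \<le> M * x" "2 * x \<le> M * x" if "x \<in> {0..1}" for x
      using that by (intro mult_right_mono; simp add: M_def)+
    moreover have "\<bar>f x\<bar> \<le> 2 * x" if "x \<in> {0..1}" for x
      using that by (simp add: f_def)
    ultimately have M: "\<bar>P1 x\<bar> \<le> M * x" "\<bar>P2 x\<bar> \<le> M * x" "\<bar>f x\<bar> \<le> M * x" if "x \<in> {0..1}" for x
      using M1 M2 that by (blast intro: order_trans)+
    have gap: "P2 x - P1 x = x * (1 - x) * q x" for x by (simp add: P1_def P2_def q_def algebra_simps)
    define Q where "Q = (\<lambda>d. (1 - exp (-d)) * (\<Sum>\<^sub>\<infinity>k::nat\<in>{1..}. exp (-d * k) * q (exp (-d * k))))"
    have up: "W f d - C * K f d - (W P2 d - C * K P2 d) \<le> C * Q d" if "d > 0" for d :: real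
      unfolding Q_def
    proof (rule mono[where M = M])
      fix x :: real assume x: "x \<in> {0..1}"
      show "P2 x - f x \<le> x * (1 - x) * q x" using p(3)[OF x] gap[of x] unfolding P1_def by linarith
    qed (use that q M p(4) in \<open>auto simp: P2_def\<close>)
    have lo: "W P1 d - C * K P1 d - (W f d - C * K f d) \<le> C * Q d" if "d > 0" for d :: real
      unfolding Q_def
    proof (rule mono[where M = M])
      fix x :: real assume x: "x \<in> {0..1}"
      show "f x - P1 x \<le> x * (1 - x) * q x" using p(4)[OF x] gap[of x] unfolding P2_def by linarith
    qed (use that q M p(3) in \<open>auto simp: P1_def\<close>)
    have "((\<lambda>d. C * Q d) \<longlongrightarrow> C * integral {0..1} q) (at_right 0)"
      unfolding Q_def by (intro tendsto_intros Abel_weighted_sum_tendsto_integral q)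
    moreover have "C * integral {0..1} q < e / 2"
      using mult_left_mono[OF p(5) C] e' unfolding q_def by linarith
    ultimately have "eventually (\<lambda>d. C * Q d < e / 2) (at_right 0)"
      using order_tendstoD(2) by blast
    moreover have "eventually (\<lambda>d. dist (W P1 d - C * K P1 d) s < e / 2) (at_right 0)"
      using tendstoD[OF poly[OF p(1)], of "e/2"] e unfolding P1_def by simp
    moreover have "eventually (\<lambda>d. dist (W P2 d - C * K P2 d) s < e / 2) (at_right 0)"
      using tendstoD[OF poly[OF p(2)], of "e/2"] e unfolding P2_def by simp
    moreover have "eventually (\<lambda>d::real. d > 0) (at_right 0)"
      by (simp add: eventually_at_right_less)
    ultimately show "eventually (\<lambda>d. dist (W f d - C * K f d) s < e) (at_right 0)"
    proof eventually_elim
      case (elim d)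
      show ?case using elim(1-3) up[OF elim(4)] lo[OF elim(4)]
        unfolding dist_real_def by linarith
    qed
  qed
  have "filterlim (\<lambda>y::real. ln 2 / y) (at_right 0) at_top" by real_asymp
  from filterlim_compose[OF main this]
  have "((\<lambda>y. W f (ln 2 / y) - C * K f (ln 2 / y)) \<longlongrightarrow> s) at_top" .
  moreover have "eventually (\<lambda>y. W f (ln 2 / y) - C * K f (ln 2 / y) =
      (\<Sum>\<^sub>\<infinity>i\<in>{i\<in>I. lam i \<le> y}. w i) - C * harm (nat \<lfloor>y\<rfloor>)) at_top"
    using eventually_gt_at_top[of 0]
  proof eventually_elim
    case (elim y)
    have iff: "exp (- (ln 2 / y) * t) \<ge> 1/2 \<longleftrightarrow> t \<le> y" for t
    proof -
      have "exp (- (ln 2 / y) * t) \<ge> 1/2 \<longleftrightarrow> exp (- (ln 2 / y) * t) \<ge> exp (- ln 2)"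
        by (simp add: exp_minus)
      also have "\<dots> \<longleftrightarrow> t \<le> y" using elim by (simp add: field_simps)
      finally show ?thesis .
    qed
    have "W f (ln 2 / y) = (\<Sum>\<^sub>\<infinity>i\<in>{i\<in>I. lam i \<le> y}. w i)"
      unfolding W_def f_def iff by (rule infsum_cong_neutral) auto
    moreover have "K f (ln 2 / y) = (\<Sum>\<^sub>\<infinity>k::nat\<in>{1..nat \<lfloor>y\<rfloor>}. 1 / k)"
      unfolding K_def f_def iff using elim
      by (intro infsum_cong_neutral) (auto simp: le_nat_iff le_floor_iff)
    ultimately show ?case by (simp add: harm_def inverse_eq_divide)
  qed
  ultimately show ?thesis using tendsto_cong by fast
qed

section \<open>Orthogonality of Dirichlet characters\<close>

lemma dirichlet_character_mod:
  assumes "dirichlet_character q \<psi>"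
  shows "\<psi> (n mod q) = \<psi> n"
proof -
  have "\<psi> (m + k * q) = \<psi> m" for m k
  proof (induction k)
    case (Suc k)
    have "\<psi> (m + Suc k * q) = \<psi> ((m + k * q) + q)" by (simp add: algebra_simps)
    also have "\<dots> = \<psi> (m + k * q)" using assms unfolding dirichlet_character_def by blast
    finally show ?case using Suc.IH by simp
  qed simp
  from this[of "n mod q" "n div q"] show ?thesis by (simp add: mult.commute)
qed

lemma dirichlet_character_cong:
  assumes "dirichlet_character q \<psi>" "[m = n] (mod q)"
  shows "\<psi> m = \<psi> n"
  using dirichlet_character_mod[OF assms(1)] assms(2) unfolding cong_def by metis

lemma dirichlet_character_mult: "dirichlet_character q \<psi> \<Longrightarrow> \<psi> (m * n) = \<psi> m * \<psi> n"
  and dirichlet_character_nonzero_iff: "dirichlet_character q \<psi> \<Longrightarrow> \<psi> n \<noteq> 0 \<longleftrightarrow> coprime n q"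
  by (auto simp: dirichlet_character_def)

lemma dirichlet_character_1: "dirichlet_character q \<psi> \<Longrightarrow> \<psi> (Suc 0) = 1"
proof -
  assume d: "dirichlet_character q \<psi>"
  have "\<psi> (Suc 0) * \<psi> (Suc 0) = \<psi> (Suc 0)" using dirichlet_character_mult[OF d, of "Suc 0" "Suc 0"] by simp
  moreover have "\<psi> (Suc 0) \<noteq> 0" using dirichlet_character_nonzero_iff[OF d] by simp
  ultimately show ?thesis by simp
qed

lemma dirichlet_character_power: "dirichlet_character q \<psi> \<Longrightarrow> \<psi> (n ^ k) = \<psi> n ^ k"
  by (induction k) (auto simp: dirichlet_character_1 dirichlet_character_mult)

lemma dirichlet_character_root_of_unity:
  assumes "dirichlet_character q \<psi>" "coprime n q"
  shows "\<psi> n ^ totient q = 1"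
  using dirichlet_character_cong[OF assms(1) euler_theorem[OF assms(2)]]
        dirichlet_character_power[OF assms(1)] dirichlet_character_1[OF assms(1)] by simp

lemma norm_dirichlet_character:
  assumes "dirichlet_character q \<psi>" "q > 0"
  shows "norm (\<psi> n) = (if coprime n q then 1 else 0)"
proof (cases "coprime n q")
  case True
  have "norm (\<psi> n) ^ totient q = 1"
    using dirichlet_character_root_of_unity[OF assms(1) True] by (metis norm_one norm_power)
  hence "norm (\<psi> n) = 1"
    using power_eq_1_iff[of "norm (\<psi> n)" "totient q"] assms(2) by simp
  thus ?thesis using True by simp
qed (use dirichlet_character_nonzero_iff[OF assms(1)] in auto)

lemma norm_dirichlet_character_le_1:
  "dirichlet_character q \<psi> \<Longrightarrow> q > 0 \<Longrightarrow> norm (\<psi> n) \<le> 1"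
  by (simp add: norm_dirichlet_character)

lemma dirichlet_character_principal: "dirichlet_character q (principal_character q)"
proof -
  have "coprime (n + q) q \<longleftrightarrow> coprime n q" for n
    unfolding coprime_iff_gcd_eq_1 by simp
  thus ?thesis by (simp add: dirichlet_character_def principal_character_def)
qed

lemma dirichlet_character_times:
  assumes "dirichlet_character q \<psi>" "dirichlet_character q \<psi>'"
  shows "dirichlet_character q (\<lambda>n. \<psi> n * \<psi>' n)"
  using assms by (simp add: dirichlet_character_def)

lemma dirichlet_character_cnj:
  assumes "dirichlet_character q \<psi>"
  shows "dirichlet_character q (\<lambda>n. cnj (\<psi> n))"
  using assms by (simp add: dirichlet_character_def)

lemma finite_dirichlet_characters:
  assumes "q > 0"
  shows "finite {\<psi>. dirichlet_character q \<psi>}"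
proof (rule finite_imageD[where f = "\<lambda>\<psi>. restrict \<psi> {..<q}"])
  have "(\<lambda>\<psi>. restrict \<psi> {..<q}) ` {\<psi>. dirichlet_character q \<psi>} \<subseteq>
          PiE {..<q} (\<lambda>_. insert 0 {z :: complex. z ^ totient q = 1})"
  proof (intro image_subsetI restrict_PiE_iff[THEN iffD2] ballI)
    fix \<psi> n assume "\<psi> \<in> {\<psi>. dirichlet_character q \<psi>}"
    hence d: "dirichlet_character q \<psi>" by simp
    show "\<psi> n \<in> insert 0 {z. z ^ totient q = 1}"
      using dirichlet_character_root_of_unity[OF d, of n] dirichlet_character_nonzero_iff[OF d, of n] by auto
  qed
  moreover have "finite (insert 0 {z :: complex. z ^ totient q = 1})"
    using assms by (intro finite.insertI finite_roots_unity) (auto simp: Suc_le_eq)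
  ultimately show "finite ((\<lambda>\<psi>. restrict \<psi> {..<q}) ` {\<psi>. dirichlet_character q \<psi>})"
    by (meson finite_PiE finite_lessThan finite_subset)
  show "inj_on (\<lambda>\<psi>. restrict \<psi> {..<q}) {\<psi>. dirichlet_character q \<psi>}"
  proof (rule inj_onI, rule ext)
    fix \<psi> \<psi>' n
    assume "\<psi> \<in> {\<psi>. dirichlet_character q \<psi>}" "\<psi>' \<in> {\<psi>. dirichlet_character q \<psi>}"
      and eq: "restrict \<psi> {..<q} = restrict \<psi>' {..<q}"
    moreover have "\<psi> (n mod q) = \<psi>' (n mod q)"
      using fun_cong[OF eq, of "n mod q"] assms by simp
    ultimately show "\<psi> n = \<psi>' n" by (simp add: dirichlet_character_mod)
  qed
qed

lemma geometric_sum_root_of_unity: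
  fixes z :: complex
  assumes "z ^ m = 1" "z \<noteq> 1"
  shows "(\<Sum>j<m. z ^ j) = 0"
  using assms geometric_sum[of z m] by simp

lemma coprime_imp_power_cong_1:
  fixes u q :: nat
  assumes "coprime u q" "q > 0"
  obtains m where "m > 0" "[u ^ m = 1] (mod q)"
  using euler_theorem[OF assms(1)] assms(2) that[of "totient q"] by simp

text \<open>
  Translation by \<open>h\<close> acts on the functions in question with order dividing \<open>m\<close>, so every function
  is the sum of its projections to the eigenspaces of the \<open>m\<close>-th roots of unity.  One of the
  projections of a nonzero function is nonzero.  Being an explicit combination of
  translates, it keeps every linear property that is invariant under translation.
\<close>
lemma translation_eigenvector_split:
  fixes F :: "nat \<Rightarrow> complex"
  assumes m: "m > 0" and per: "\<And>n. F (h ^ m * n) = F n" and F: "F k \<noteq> 0"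
  obtains c G where "\<And>n. G (h * n) = c * G n" "\<exists>k. G k \<noteq> 0"
    "G = (\<lambda>n. \<Sum>j<m. inverse c ^ j * F (h ^ j * n))"
proof -
  define w where "w = (\<lambda>i. cis (2 * pi * real i / real m))"
  have w: "w i ^ m = 1" for i
  proof -
    have "w i ^ m = cis (real m * (2 * pi * real i / real m))" by (simp only: w_def Complex.DeMoivre)
    also have "real m * (2 * pi * real i / real m) = 2 * pi * real i" using m by simp
    finally have "w i ^ m = cis (2 * pi * real i)" .
    thus ?thesis using cis_multiple_2pi[of "real i"] by simp
  qed
  define G where "G = (\<lambda>i n. \<Sum>j<m. inverse (w i) ^ j * F (h ^ j * n))"
  have w0: "w i \<noteq> 0" for i by (simp add: w_def)
  have eig: "G i (h * n) = w i * G i n" for i n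
  proof -
    define t where "t = (\<lambda>j. inverse (w i) ^ j * F (h ^ j * n))"
    have "G i (h * n) = (\<Sum>j<m. w i * t (Suc j))"
      unfolding G_def t_def using w0[of i] by (intro sum.cong refl) (simp add: mult_ac)
    also have "\<dots> = w i * (\<Sum>j<m. t (Suc j))" by (simp add: sum_distrib_left)
    also have "(\<Sum>j<m. t (Suc j)) = (\<Sum>j<m. t j) + t m - t 0"
      using sum.lessThan_Suc_shift[of t m] by (simp add: algebra_simps)
    also have "t m = t 0" using per[of n] w[of i] by (simp add: t_def power_inverse)
    finally show ?thesis by (simp add: G_def t_def)
  qed
  have "\<exists>i. G i k \<noteq> 0"
  proof (rule ccontr)
    assume "\<not> ?thesis"
    hence "(\<Sum>i<m. G i k) = 0" by simp
    also have "(\<Sum>i<m. G i k) = (\<Sum>j<m. (\<Sum>i<m. inverse (w i) ^ j) * F (h ^ j * k))"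
      unfolding G_def by (subst sum.swap) (simp add: sum_distrib_right)
    also have "\<dots> = (\<Sum>j<m. (if j = 0 then of_nat m * F k else 0))"
    proof (intro sum.cong refl)
      fix j assume j: "j \<in> {..<m}"
      define z where "z = cis (- 2 * pi * real j / real m)"
      have "inverse (w i) ^ j = z ^ i" for i
        unfolding w_def z_def cis_inverse Complex.DeMoivre by (rule arg_cong[of _ _ cis]) simp
      moreover have "z ^ m = 1"
        unfolding z_def Complex.DeMoivre using m cis_multiple_2pi[of "- real j"] by simp
      moreover have "z \<noteq> 1" if "j \<noteq> 0"
      proof
        assume "z = 1"
        hence "cos (- 2 * pi * real j / real m) = 1" by (simp add: z_def complex_eq_iff)
        then obtain l :: int where l: "- 2 * pi * real j / real m = real_of_int l * 2 * pi"
          unfolding cos_one_2pi_int by blast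
        have "pi * real j = pi * (real_of_int (- l) * real m)" using l m by (simp add: field_simps)
        hence "real j = real_of_int (- l) * real m" by (subst (asm) mult_cancel_left) simp
        hence l': "int j = - l * int m" by (metis of_int_eq_iff of_int_mult of_int_of_nat_eq)
        hence "int m dvd int j" by simp
        thus False using j that by (auto dest: dvd_imp_le)
      qed
      ultimately show "(\<Sum>i<m. inverse (w i) ^ j) * F (h ^ j * k) = (if j = 0 then of_nat m * F k else 0)"
        using geometric_sum_root_of_unity[of z m] by auto
    qed
    also have "\<dots> = of_nat m * F k" using m by simp
    finally show False using m F by simp
  qed
  then obtain i where "G i k \<noteq> 0" by blast
  thus thesis using that[of "G i" "w i"] eig by (auto simp: G_def)
qed

text \<open>
  A character is a simultaneous eigenvector of all translations.  The starting point is the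
  difference of the indicators of the classes of 1 and of the inverse of \<open>u\<close>; its translates
  by the powers of \<open>u\<close> add up to 0.  Passing to eigenvectors of one translation after the other
  preserves this relation, and it excludes the eigenvalue 1 for \<open>u\<close>.
\<close>
lemma exists_dirichlet_character_ne_1:
  assumes q: "q > 0" and u: "coprime u q" "\<not> [u = 1] (mod q)"
  obtains \<psi> where "dirichlet_character q \<psi>" "\<psi> u \<noteq> 1"
proof -
  obtain m where m: "m > 0" "[u ^ m = 1] (mod q)" using coprime_imp_power_cong_1[OF u(1) q] .
  \<comment> \<open>What survives the passage to eigenvectors; the last condition excludes the eigenvalue 1 of \<open>u\<close>.\<close>
  define good where "good = (\<lambda>F :: nat \<Rightarrow> complex.
     (\<forall>k l. [k = l] (mod q) \<longrightarrow> F k = F l) \<and> (\<forall>n. \<not> coprime n q \<longrightarrow> F n = 0) \<and>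
     (\<exists>k. F k \<noteq> 0) \<and> (\<forall>n. (\<Sum>j<m. F (u ^ j * n)) = 0))"
  have ext: "\<exists>F. good F \<and> (\<forall>h\<in>A. \<exists>c. \<forall>n. F (h * n) = c * F n)"
    if "finite A" "\<And>h. h \<in> A \<Longrightarrow> coprime h q" for A
    using that
  proof (induction A rule: finite_induct)
    case empty
    define F :: "nat \<Rightarrow> complex" where
      "F = (\<lambda>n. (if [n = 1] (mod q) then 1 else 0) - (if [u * n = 1] (mod q) then 1 else 0))"
    have "F k = F l" if "[k = l] (mod q)" for k l
    proof -
      have "[k = 1] (mod q) \<longleftrightarrow> [l = 1] (mod q)" "[u * k = 1] (mod q) \<longleftrightarrow> [u * l = 1] (mod q)"
        using that cong_scalar_left[OF that, of u] by (metis cong_sym cong_trans)+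
      thus ?thesis by (simp add: F_def)
    qed
    moreover have "F n = 0" if "\<not> coprime n q" for n
    proof -
      have "\<not> [n = 1] (mod q)" "\<not> [u * n = 1] (mod q)"
        using that cong_imp_coprime[of 1 n q] cong_imp_coprime[of 1 "u * n" q]
        by (auto simp: cong_sym_eq)
      thus ?thesis by (simp add: F_def)
    qed
    moreover have "F 1 \<noteq> 0" using u by (simp add: F_def)
    moreover have "(\<Sum>j<m. F (u ^ j * n)) = 0" for n
    proof -
      define t :: "nat \<Rightarrow> complex" where "t = (\<lambda>j. if [u ^ j * n = 1] (mod q) then 1 else 0)"
      have "(\<Sum>j<m. F (u ^ j * n)) = (\<Sum>j<m. t j - t (Suc j))"
        by (simp add: F_def t_def mult_ac)
      also have "\<dots> = t 0 - t m" by (rule sum_lessThan_telescope')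
      also have "[u ^ m * n = 1] (mod q) \<longleftrightarrow> [n = 1] (mod q)"
        using cong_scalar_right[OF m(2), of n] by (metis cong_sym cong_trans mult_1)
      hence "t m = t 0" by (simp add: t_def)
      finally show ?thesis by simp
    qed
    ultimately show ?case unfolding good_def by blast
  next
    case (insert h A)
    then obtain F where F: "good F" "\<forall>h\<in>A. \<exists>c. \<forall>n. F (h * n) = c * F n" by auto
    have h: "coprime h q" using insert.prems by simp
    obtain r where r: "r > 0" "[h ^ r = 1] (mod q)" using coprime_imp_power_cong_1[OF h q] .
    obtain k where k: "F k \<noteq> 0" using F(1) by (auto simp: good_def)
    have hr: "F (h ^ r * n) = F n" for n
      using F(1) cong_scalar_right[OF r(2), of n] by (simp add: good_def)
    obtain c G where G: "\<And>n. G (h * n) = c * G n" "\<exists>k. G k \<noteq> 0"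
      "G = (\<lambda>n. \<Sum>j<r. inverse c ^ j * F (h ^ j * n))"
      by (rule translation_eigenvector_split[of r F h k, OF r(1) hr k]) (rule that; assumption)
    have "G k = G l" if "[k = l] (mod q)" for k l
      using F(1) cong_scalar_left[OF that] unfolding G(3) good_def by (intro sum.cong) auto
    moreover have "G n = 0" if "\<not> coprime n q" for n
      using F(1) that unfolding G(3) good_def by simp
    moreover have "(\<Sum>j<m. G (u ^ j * n)) = 0" for n
    proof -
      have "(\<Sum>j<m. G (u ^ j * n)) = (\<Sum>i<r. inverse c ^ i * (\<Sum>j<m. F (u ^ j * (h ^ i * n))))"
        unfolding G(3) by (subst sum.swap) (simp add: sum_distrib_left mult_ac)
      also have "\<dots> = 0" using F(1) by (simp add: good_def)
      finally show ?thesis .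
    qed
    ultimately have "good G" using G(2) unfolding good_def by blast
    moreover have "\<exists>c. \<forall>n. G (h' * n) = c * G n" if h': "h' \<in> insert h A" for h'
    proof (cases "h' = h")
      case False
      then obtain d where d: "\<And>n. F (h' * n) = d * F n" using F(2) h' by blast
      have "F (h ^ j * (h' * n)) = d * F (h ^ j * n)" for j n
        using d[of "h ^ j * n"] by (simp add: mult_ac)
      hence "G (h' * n) = d * G n" for n
        unfolding G(3) by (simp add: sum_distrib_left mult.left_commute)
      thus ?thesis by blast
    qed (use G(1) in blast)
    ultimately show ?case by blast
  qed
  have "\<exists>F. good F \<and> (\<forall>h\<in>{h. h < q \<and> coprime h q}. \<exists>c. \<forall>n. F (h * n) = c * F n)"
    by (rule ext) simp_all
  then obtain F
    where F: "good F" and eig0: "\<forall>h\<in>{h. h < q \<and> coprime h q}. \<exists>c. \<forall>n. F (h * n) = c * F n"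
    by (elim exE conjE)
  have eig: "\<exists>c. \<forall>n. F (h * n) = c * F n" if "h < q" "coprime h q" for h
    using bspec[OF eig0, of h] that by blast
  have per: "F k = F l" if "[k = l] (mod q)" for k l using F that unfolding good_def by blast
  have nc: "F n = 0" if "\<not> coprime n q" for n using F that unfolding good_def by blast
  have eig': "\<exists>c. \<forall>n. F (h * n) = c * F n" if h: "coprime h q" for h
  proof -
    have "coprime (h mod q) q" using h q by (simp add: coprime_mod_left_iff)
    then obtain c where "\<And>n. F (h mod q * n) = c * F n" using eig[of "h mod q"] q by auto
    moreover have "F (h * n) = F (h mod q * n)" for n
      by (rule per) (simp add: cong_def mod_mult_left_eq)
    ultimately show ?thesis by metis
  qed
  have F1: "F 1 \<noteq> 0"
  proof
    assume 0: "F 1 = 0"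
    obtain k where k: "F k \<noteq> 0" using F by (auto simp: good_def)
    then obtain c where "F (k * 1) = c * F 1" using nc eig' by metis
    thus False using 0 k by simp
  qed
  have mult: "F (h * n) = F h / F 1 * F n" for h n
  proof (cases "coprime h q")
    case True
    then obtain c where c: "\<And>n. F (h * n) = c * F n" using eig' by blast
    from c[of 1] c[of n] show ?thesis using F1 by simp
  next
    case False
    thus ?thesis using nc[of h] nc[of "h * n"] by simp
  qed
  define \<psi> where "\<psi> = (\<lambda>n. F n / F 1)"
  have nz: "F n \<noteq> 0" if n: "coprime n q" for n
  proof -
    obtain b where "[n * b = 1] (mod q)" using cong_solve_coprime_nat[OF n] by auto
    from per[OF this] show ?thesis using mult[of n b] F1 by auto
  qed
  have "dirichlet_character q \<psi>"
    unfolding dirichlet_character_def \<psi>_def using F1 nz nc per[of "_ + q"]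
    by (auto simp: mult cong_def)
  moreover have "\<psi> u \<noteq> 1"
  proof
    assume "\<psi> u = 1"
    hence "F (u * n) = F n" for n using mult[of u n] by (simp add: \<psi>_def)
    hence "F (u ^ j) = F 1" for j by (induction j) simp_all
    moreover have "(\<Sum>j<m. F (u ^ j * 1)) = 0" using F unfolding good_def by blast
    ultimately show False using F1 m by simp
  qed
  ultimately show thesis by (rule that)
qed

text \<open>
  Some \<open>u\<close> coprime to \<open>q\<close> has \<open>\<psi> u \<noteq> 1\<close>, and multiplication by \<open>u\<close> permutes the residues.
\<close>
lemma sum_dirichlet_character:
  assumes q: "q > 0" and d: "dirichlet_character q \<psi>" and "\<psi> \<noteq> principal_character q"
  shows "(\<Sum>n<q. \<psi> n) = 0"
proof -
  obtain u where u: "coprime u q" "\<psi> u \<noteq> 1"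
    using assms dirichlet_character_nonzero_iff[OF d] by (auto simp: principal_character_def fun_eq_iff split: if_splits)
  have inj: "inj_on (\<lambda>n. u * n mod q) {..<q}"
  proof (rule inj_onI)
    fix k l assume *: "k \<in> {..<q}" "l \<in> {..<q}" "u * k mod q = u * l mod q"
    hence "[u * k = u * l] (mod q)" by (simp add: cong_def)
    hence "[k = l] (mod q)" using cong_mult_lcancel_nat[of u q k l] u by (simp add: coprime_commute)
    with * show "k = l" by (simp add: cong_def)
  qed
  have "(\<lambda>n. u * n mod q) ` {..<q} = {..<q}"
    using inj by (intro endo_inj_surj) (use q in auto)
  hence bij: "bij_betw (\<lambda>n. u * n mod q) {..<q} {..<q}" using inj by (simp add: bij_betw_def)
  have "(\<Sum>n<q. \<psi> n) = (\<Sum>n<q. \<psi> (u * n mod q))"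
    by (rule sum.reindex_bij_betw[OF bij, symmetric])
  also have "\<dots> = \<psi> u * (\<Sum>n<q. \<psi> n)"
    by (simp add: dirichlet_character_mod[OF d] dirichlet_character_mult[OF d] sum_distrib_left)
  finally show ?thesis using u by (simp add: algebra_simps)
qed

text \<open>
  Multiplication by a character that is not 1 at \<open>n\<close> permutes the characters and multiplies
  the sum by a number different from 1.
\<close>
lemma sum_over_dirichlet_characters_eq_0:
  assumes q: "q > 0" and n: "\<not> [n = 1] (mod q)"
  shows "(\<Sum>\<psi> | dirichlet_character q \<psi>. \<psi> n) = 0"
proof (cases "coprime n q")
  case True
  then obtain \<psi> where d: "dirichlet_character q \<psi>" "\<psi> n \<noteq> 1"
    using exists_dirichlet_character_ne_1[OF q _ n] by blast
  define D where "D = {\<psi>. dirichlet_character q \<psi>}"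
  have fin: "finite D" unfolding D_def by (rule finite_dirichlet_characters[OF q])
  have inj: "inj_on (\<lambda>\<eta> n. \<psi> n * \<eta> n) D"
  proof (rule inj_onI, rule ext)
    fix \<eta> \<eta>' k assume *: "\<eta> \<in> D" "\<eta>' \<in> D" "(\<lambda>n. \<psi> n * \<eta> n) = (\<lambda>n. \<psi> n * \<eta>' n)"
    show "\<eta> k = \<eta>' k"
    proof (cases "coprime k q")
      case True
      thus ?thesis using fun_cong[OF *(3), of k] dirichlet_character_nonzero_iff[OF d(1), of k] by simp
    next
      case False
      thus ?thesis using * dirichlet_character_nonzero_iff[of q \<eta> k] dirichlet_character_nonzero_iff[of q \<eta>' k]
        by (auto simp: D_def)
    qed
  qed
  have "(\<lambda>\<eta> n. \<psi> n * \<eta> n) ` D = D"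
    using inj d fin by (intro endo_inj_surj) (auto simp: D_def intro: dirichlet_character_times)
  hence bij: "bij_betw (\<lambda>\<eta> n. \<psi> n * \<eta> n) D D" using inj by (simp add: bij_betw_def)
  have "(\<Sum>\<eta>\<in>D. \<eta> n) = (\<Sum>\<eta>\<in>D. \<psi> n * \<eta> n)"
    by (rule sum.reindex_bij_betw[OF bij, symmetric])
  also have "\<dots> = \<psi> n * (\<Sum>\<eta>\<in>D. \<eta> n)" by (simp add: sum_distrib_left)
  finally show ?thesis using d by (simp add: algebra_simps D_def)
next
  case False
  thus ?thesis using dirichlet_character_nonzero_iff by (intro sum.neutral) blast
qed

lemma card_coprime_residues:
  assumes "q > 0"
  shows "card {n. n < q \<and> coprime n q} = totient q"
proof (cases "q = 1")
  case True
  hence "{n. n < q \<and> coprime n q} = {0}" by auto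
  thus ?thesis using True by simp
next
  case False
  hence "{n. n < q \<and> coprime n q} = totatives q"
    using assms by (auto simp: totatives_def intro: Nat.gr0I order_le_neq_trans)
  thus ?thesis by (simp add: totient_def)
qed

text \<open>
  The sum of all values of all characters over a period, evaluated in the two possible orders:
  summing over characters first leaves only the residue class of 1, summing over residues
  first leaves only the principal character.
\<close>
lemma card_dirichlet_characters:
  assumes q: "q > 0"
  shows "card {\<psi>. dirichlet_character q \<psi>} = totient q"
proof -
  define D where "D = {\<psi>. dirichlet_character q \<psi>}"
  have fin: "finite D" unfolding D_def by (rule finite_dirichlet_characters[OF q])
  have "(\<Sum>n<q. \<Sum>\<psi>\<in>D. \<psi> n) = (\<Sum>n<q. if n = 1 mod q then of_nat (card D) else 0)"
  proof (intro sum.cong refl)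
    fix n assume n: "n \<in> {..<q}"
    show "(\<Sum>\<psi>\<in>D. \<psi> n) = (if n = 1 mod q then of_nat (card D) else 0)"
    proof (cases "n = 1 mod q")
      case True
      hence "\<psi> n = 1" if "\<psi> \<in> D" for \<psi>
        using that dirichlet_character_mod[of q \<psi> 1] dirichlet_character_1[of q \<psi>] by (simp add: D_def)
      hence "(\<Sum>\<psi>\<in>D. \<psi> n) = (\<Sum>\<psi>\<in>D. 1)" by (intro sum.cong refl)
      thus ?thesis using True by simp
    next
      case False
      thus ?thesis using sum_over_dirichlet_characters_eq_0[OF q, of n] n by (simp add: D_def cong_def)
    qed
  qed
  also have "\<dots> = of_nat (card D)" using q by simp
  finally have "of_nat (card D) = (\<Sum>\<psi>\<in>D. \<Sum>n<q. \<psi> n)" by (subst sum.swap) simp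
  also have "\<dots> = (\<Sum>\<psi>\<in>D. if \<psi> = principal_character q then \<Sum>n<q. \<psi> n else 0)"
    using sum_dirichlet_character[OF q] by (intro sum.cong) (auto simp: D_def)
  also have "\<dots> = (\<Sum>n<q. principal_character q n)"
    using fin dirichlet_character_principal by (simp add: D_def)
  also have "\<dots> = of_nat (card {n. n < q \<and> coprime n q})"
    by (simp add: principal_character_def sum.If_cases lessThan_def Collect_conj_eq[symmetric])
  finally show ?thesis using card_coprime_residues[OF q] unfolding D_def by (simp only: of_nat_eq_iff)
qed

lemma dirichlet_character_orthogonality:
  assumes q: "q > 0" and a: "coprime a q"
  shows "(\<Sum>\<psi> | dirichlet_character q \<psi>. cnj (\<psi> a) * \<psi> n) = (if [n = a] (mod q) then of_nat (totient q) else 0)"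
proof -
  obtain b where b: "[a * b = 1] (mod q)" using cong_solve_coprime_nat[OF a] by auto
  have "cnj (\<psi> a) = \<psi> b" if d: "dirichlet_character q \<psi>" for \<psi>
  proof -
    have ab: "\<psi> a * \<psi> b = 1"
      using dirichlet_character_cong[OF d b] dirichlet_character_mult[OF d, of a b] dirichlet_character_1[OF d] by simp
    have "cnj (\<psi> a) * \<psi> a = 1"
      using norm_dirichlet_character[OF d q, of a] a complex_norm_square[of "\<psi> a"] by (simp add: mult.commute)
    hence "cnj (\<psi> a) * (\<psi> a * \<psi> b) = \<psi> b" by (simp add: mult.assoc[symmetric])
    thus ?thesis using ab by simp
  qed
  hence eq: "(\<Sum>\<psi> | dirichlet_character q \<psi>. cnj (\<psi> a) * \<psi> n) = (\<Sum>\<psi> | dirichlet_character q \<psi>. \<psi> (b * n))"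
    by (intro sum.cong refl) (simp add: dirichlet_character_mult)
  have iff: "[b * n = 1] (mod q) \<longleftrightarrow> [n = a] (mod q)"
  proof
    assume "[b * n = 1] (mod q)"
    from cong_scalar_left[OF this, of a] cong_scalar_right[OF b, of n]
    have "[n = a * b * n] (mod q)" "[a * b * n = a] (mod q)" by (simp_all add: mult.assoc cong_sym_eq)
    thus "[n = a] (mod q)" by (rule cong_trans)
  next
    assume "[n = a] (mod q)"
    from cong_scalar_left[OF this, of b] have "[b * n = a * b] (mod q)" by (simp only: mult.commute)
    thus "[b * n = 1] (mod q)" using b by (rule cong_trans)
  qed
  show ?thesis
  proof (cases "[n = a] (mod q)")
    case True
    with iff have "\<psi> (b * n) = 1" if "dirichlet_character q \<psi>" for \<psi>
      using dirichlet_character_cong[OF that, of "b * n" 1] dirichlet_character_1[OF that] by simp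
    hence "(\<Sum>\<psi> | dirichlet_character q \<psi>. \<psi> (b * n)) = (\<Sum>\<psi> | dirichlet_character q \<psi>. 1)"
      by (intro sum.cong refl) blast
    thus ?thesis using True eq card_dirichlet_characters[OF q] by simp
  next
    case False
    thus ?thesis using eq iff sum_over_dirichlet_characters_eq_0[OF q, of "b * n"] by simp
  qed
qed

section \<open>Dirichlet series with bounded partial sums\<close>

text \<open>
  The mean value inequality on the segment from \<open>m\<close> to \<open>m + 1\<close>.
\<close>
lemma norm_powr_minus_diff_le:
  fixes s :: complex and m :: nat
  assumes m: "m > 0" and s: "Re s > 0"
  shows "norm (of_nat m powr - s - of_nat (Suc m) powr - s) \<le> norm s * real m powr (- Re s - 1)"
proof -
  define S where "S = closed_segment (of_nat m :: complex) (of_nat (Suc m))"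
  have S: "\<exists>u\<ge>real m. z = of_real u" if "z \<in> S" for z
  proof -
    from that have "z \<in> closed_segment (of_real (real m)) (of_real (real (Suc m)) :: complex)"
      by (simp add: S_def)
    hence "z \<in> of_real ` closed_segment (real m) (real (Suc m))"
      using closed_segment_of_real by blast
    thus ?thesis by (auto simp: closed_segment_eq_real_ivl)
  qed
  have "norm (of_nat m powr - s - of_nat (Suc m) powr - s) \<le>
          (norm s * real m powr (- Re s - 1)) * norm (of_nat m - of_nat (Suc m) :: complex)"
  proof (rule field_differentiable_bound[of S "\<lambda>z. z powr - s" "\<lambda>z. - s * z powr (- s - 1)"])
    fix z assume "z \<in> S"
    then obtain u where u: "u \<ge> real m" "z = of_real u" using S by blast
    have u0: "u > 0" using u m by linarith
    hence "z \<notin> \<real>\<^sub>\<le>\<^sub>0" using u by (simp add: complex_nonpos_Reals_iff)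
    thus "((\<lambda>z. z powr - s) has_field_derivative - s * z powr (- s - 1)) (at z within S)"
      by (rule has_field_derivative_at_within[OF has_field_derivative_powr])
    have "norm (- s * z powr (- s - 1)) = norm s * u powr (- Re s - 1)"
      using u u0 by (simp add: norm_mult norm_powr_real_powr)
    also have "\<dots> \<le> norm s * real m powr (- Re s - 1)"
      using u s m by (intro mult_left_mono powr_mono2') auto
    finally show "norm (- s * z powr (- s - 1)) \<le> norm s * real m powr (- Re s - 1)" .
  qed (auto simp: S_def)
  thus ?thesis by simp
qed

text \<open>
  Summation by parts turns the series into one with terms of size \<open>O(|s| n\<^sup>-\<^sup>\<sigma>\<^sup>-\<^sup>1)\<close>, where
  \<open>\<sigma> = Re s\<close>, which converges absolutely and locally uniformly on the half-plane.
\<close>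
lemma dirichlet_series_bounded_partial_sums:
  fixes c :: "nat \<Rightarrow> complex"
  assumes B: "\<And>n. norm (\<Sum>k<n. c (Suc k)) \<le> B"
  shows dirichlet_L_sums: "\<And>s. Re s > 0 \<Longrightarrow> (\<lambda>n. c (Suc n) / of_nat (Suc n) powr s) sums dirichlet_L s c"
    and dirichlet_L_holomorphic: "(\<lambda>s. dirichlet_L s c) holomorphic_on {s. Re s > 0}"
proof -
  define D where "D = (\<lambda>n. \<Sum>k<n. c (Suc k))"
  have B0: "B \<ge> 0" using B[of 0] by simp
  define b where "b = (\<lambda>n s. of_nat (Suc n) powr - s :: complex)"
  define T where "T = (\<lambda>s. \<Sum>n. D (Suc n) * (b n s - b (Suc n) s))"
  have term_bound: "norm (D (Suc n) * (b n s - b (Suc n) s)) \<le> B * R * real (Suc n) powr (- r - 1)"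
    if "Re s \<ge> r" "r > 0" "norm s \<le> R" for n s r R
  proof -
    have "norm (b n s - b (Suc n) s) \<le> norm s * real (Suc n) powr (- Re s - 1)"
      unfolding b_def using that by (intro norm_powr_minus_diff_le) auto
    also have "\<dots> \<le> R * real (Suc n) powr (- r - 1)"
      using that by (intro mult_mono powr_mono) (auto intro: order_trans[of 0 "norm s"])
    finally show ?thesis
      unfolding norm_mult mult.assoc using B[of "Suc n"] B0 by (intro mult_mono) (auto simp: D_def)
  qed
  have summ: "summable (\<lambda>n. B * R * real (Suc n) powr (- r - 1))" if "r > 0" for r R
  proof (intro summable_mult)
    have "summable (\<lambda>n. real n powr (- r - 1))" using that by (simp add: summable_real_powr_iff)
    thus "summable (\<lambda>n. real (Suc n) powr (- r - 1))" by (subst summable_Suc_iff)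
  qed
  have unif: "uniform_limit {s. Re s \<ge> r \<and> norm s \<le> R}
                (\<lambda>N s. \<Sum>n<N. D (Suc n) * (b n s - b (Suc n) s)) T sequentially" if "r > 0" for r R
    unfolding T_def by (rule Weierstrass_m_test[OF _ summ[OF that]]) (use term_bound that in auto)
  have sums: "(\<lambda>n. c (Suc n) / of_nat (Suc n) powr s) sums T s" if s: "Re s > 0" for s
  proof -
    have parts: "(\<Sum>n<N. c (Suc n) / of_nat (Suc n) powr s) =
                   (\<Sum>n<N. D (Suc n) * (b n s - b (Suc n) s)) + D N * b N s" for N
    proof (induction N)
      case (Suc N)
      have "c (Suc N) / of_nat (Suc N) powr s = (D (Suc N) - D N) * b N s"
        by (simp add: D_def b_def powr_minus divide_inverse)
      thus ?case using Suc.IH by (simp add: algebra_simps)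
    qed (simp add: D_def)
    have "(\<lambda>N. \<Sum>n<N. D (Suc n) * (b n s - b (Suc n) s)) \<longlonglongrightarrow> T s"
      using tendsto_uniform_limitI[OF unif[OF s, of "norm s"], of s] by simp
    moreover have "(\<lambda>N. D N * b N s) \<longlonglongrightarrow> 0"
    proof (rule Lim_null_comparison)
      show "eventually (\<lambda>N. norm (D N * b N s) \<le> B * real (Suc N) powr - Re s) sequentially"
      proof (rule always_eventually, rule allI)
        fix N
        have "norm (b N s) = real (Suc N) powr - Re s"
          unfolding b_def by (subst norm_powr_real_powr) auto
        thus "norm (D N * b N s) \<le> B * real (Suc N) powr - Re s"
          using B[of N] by (simp add: norm_mult D_def mult_right_mono)
      qed
      have "(\<lambda>N. real N powr - Re s) \<longlonglongrightarrow> 0" using s by real_asymp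
      hence "(\<lambda>N. real (Suc N) powr - Re s) \<longlonglongrightarrow> 0" by (rule LIMSEQ_Suc)
      thus "(\<lambda>N. B * real (Suc N) powr - Re s) \<longlonglongrightarrow> 0" by (rule tendsto_mult_right_zero)
    qed
    ultimately show ?thesis
      unfolding sums_def parts using tendsto_add by force
  qed
  have eq: "dirichlet_L s c = T s" if s: "Re s > 0" for s
    using sums[OF s] by (simp add: dirichlet_L_def sums_iff)
  show "(\<lambda>n. c (Suc n) / of_nat (Suc n) powr s) sums dirichlet_L s c" if s: "Re s > 0" for s
    using sums[OF s] eq[OF s] by simp
  have "T holomorphic_on {s. Re s > 0}"
  proof (rule holomorphic_uniform_sequence)
    show "open {s. Re s > 0}" by (rule open_halfspace_Re_gt)
    show "(\<lambda>s. \<Sum>n<N. D (Suc n) * (b n s - b (Suc n) s)) holomorphic_on {s. Re s > 0}" for N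
      unfolding b_def by (intro holomorphic_intros) (auto simp: complex_nonpos_Reals_iff)
    fix s assume "s \<in> {s. Re s > 0}"
    hence s: "Re s > 0" by simp
    define r where "r = Re s / 2"
    have r: "r > 0" using s by (simp add: r_def)
    have sub: "cball s r \<subseteq> {z. Re z \<ge> r \<and> norm z \<le> norm s + r}"
    proof
      fix z assume "z \<in> cball s r"
      hence z: "norm (s - z) \<le> r" by (simp add: dist_norm)
      have "Re (s - z) \<le> r" using complex_Re_le_cmod[of "s - z"] z by linarith
      moreover have "norm z \<le> norm s + norm (s - z)"
        using norm_triangle_ineq4[of s "s - z"] by simp
      ultimately show "z \<in> {z. Re z \<ge> r \<and> norm z \<le> norm s + r}" using z by (simp add: r_def)
    qed
    show "\<exists>d>0. cball s d \<subseteq> {s. Re s > 0} \<and>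
            uniform_limit (cball s d) (\<lambda>N s. \<Sum>n<N. D (Suc n) * (b n s - b (Suc n) s)) T sequentially"
      using r sub uniform_limit_on_subset[OF unif[OF r, of "norm s + r"] sub] by (intro exI[of _ r]) force
  qed
  thus "(\<lambda>s. dirichlet_L s c) holomorphic_on {s. Re s > 0}"
    by (rule holomorphic_transform) (simp add: eq)
qed

lemma bounded_partial_sums_periodic:
  fixes c :: "nat \<Rightarrow> complex"
  assumes q: "q > 0" and per: "\<And>n. c (n + q) = c n" and mean: "(\<Sum>n<q. c n) = 0"
  shows "norm (\<Sum>k<n. c (Suc k)) \<le> (\<Sum>k<q. norm (c (Suc k)))"
proof -
  have "(\<Sum>k<q. c (Suc k)) = (\<Sum>k<Suc q. c k) - c 0" by (subst sum.lessThan_Suc_shift) simp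
  also have "\<dots> = 0" using mean per[of 0] by simp
  finally have mean': "(\<Sum>k<q. c (Suc k)) = 0" .
  have "(\<Sum>k<q + n. c (Suc k)) = (\<Sum>k<n. c (Suc k))" for n
    by (induction n) (use mean' per[of "Suc _"] in \<open>auto simp: add.commute\<close>)
  hence "(\<Sum>k<j * q + n. c (Suc k)) = (\<Sum>k<n. c (Suc k))" for j n
    by (induction j) (auto simp: add.assoc)
  from this[of "n div q" "n mod q"] have "(\<Sum>k<n. c (Suc k)) = (\<Sum>k<n mod q. c (Suc k))" by simp
  also have "norm \<dots> \<le> (\<Sum>k<n mod q. norm (c (Suc k)))" by (rule norm_sum)
  also have "\<dots> \<le> (\<Sum>k<q. norm (c (Suc k)))"
    using q by (intro sum_mono2) (auto intro: less_trans[OF _ mod_less_divisor])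
  finally show ?thesis .
qed

section \<open>The logarithm of an Euler product\<close>

text \<open>
  Among the integers without prime factors in \<open>P\<close>, the multiples of a further prime \<open>p\<close> are
  exactly \<open>p\<close> times these integers, so by multiplicativity they contribute the fraction \<open>t p\<close>
  of the sum.
\<close>
lemma Euler_sieve:
  fixes t :: "nat \<Rightarrow> complex"
  assumes mult: "\<And>m n. t (m * n) = t m * t n" and summ: "(\<lambda>n. norm (t n)) summable_on {1..}"
    and P: "finite P" "\<And>p. p \<in> P \<Longrightarrow> prime p"
  shows "(\<Prod>p\<in>P. 1 - t p) * (\<Sum>\<^sub>\<infinity>n\<in>{1..}. t n) = (\<Sum>\<^sub>\<infinity>n\<in>{n. n \<ge> 1 \<and> (\<forall>p\<in>P. \<not> p dvd n)}. t n)"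
  using P
proof (induction P rule: finite_induct)
  case empty
  show ?case by (simp add: atLeast_def)
next
  case (insert p P)
  define A where "A = {n. n \<ge> 1 \<and> (\<forall>p\<in>P. \<not> p dvd n)}"
  define B where "B = {n. n \<ge> 1 \<and> (\<forall>p\<in>insert p P. \<not> p dvd n)}"
  have p: "prime p" using insert.prems by simp
  have AB: "A = B \<union> (\<lambda>n. p * n) ` A"
  proof (intro equalityI subsetI)
    fix n assume n: "n \<in> A"
    show "n \<in> B \<union> (\<lambda>n. p * n) ` A"
    proof (cases "p dvd n")
      case True
      then obtain m where m: "n = p * m" by blast
      hence "m \<in> A" using n by (auto simp: A_def Suc_le_eq)
      thus ?thesis using m by blast
    qed (use n in \<open>auto simp: A_def B_def\<close>)
  next
    fix n assume "n \<in> B \<union> (\<lambda>n. p * n) ` A"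
    moreover have "p * m \<in> A" if m: "m \<in> A" for m
    proof -
      have "\<not> r dvd p * m" if r: "r \<in> P" for r
      proof
        assume "r dvd p * m"
        moreover have "prime r" using r insert.prems by simp
        ultimately have "r dvd p" using m r by (auto simp: A_def prime_dvd_mult_iff)
        hence "r = p" using p \<open>prime r\<close> by (simp add: primes_dvd_imp_eq)
        thus False using r insert.hyps by simp
      qed
      moreover have "p * m \<ge> 1" using m p prime_gt_0_nat[of p] by (simp add: A_def Suc_le_eq)
      ultimately show ?thesis by (simp add: A_def)
    qed
    ultimately show "n \<in> A" by (auto simp: A_def B_def)
  qed
  have sub: "t summable_on S" if "S \<subseteq> {1..}" for S
    by (rule summable_on_subset_banach[OF abs_summable_summable[OF summ] that])
  have inj: "inj_on (\<lambda>n. p * n) A" using p prime_gt_0_nat[of p] by (auto intro: inj_onI)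
  have "infsum t (B \<union> (\<lambda>n. p * n) ` A) = infsum t B + infsum t ((\<lambda>n. p * n) ` A)"
  proof (rule infsum_Un_disjoint)
    show "t summable_on B" by (rule sub) (auto simp: B_def)
    have "(\<lambda>n. p * n) ` A \<subseteq> {1..}" using prime_gt_0_nat[OF p] by (auto simp: A_def Suc_le_eq)
    thus "t summable_on (\<lambda>n. p * n) ` A" by (rule sub)
  qed (auto simp: B_def)
  hence "infsum t A = infsum t B + infsum t ((\<lambda>n. p * n) ` A)" by (simp only: AB[symmetric])
  also have "infsum t ((\<lambda>n. p * n) ` A) = t p * infsum t A"
    by (subst infsum_reindex[OF inj]) (simp only: o_def mult infsum_cmult_right')
  finally have "infsum t B = infsum t A - t p * infsum t A" by (metis add_diff_cancel_right')
  hence "infsum t B = (1 - t p) * infsum t A" by (simp only: left_diff_distrib mult_1)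
  moreover have "(\<Prod>p\<in>P. 1 - t p) * (\<Sum>\<^sub>\<infinity>n\<in>{1..}. t n) = infsum t A"
    unfolding A_def using insert.prems by (intro insert.IH) auto
  ultimately show ?case using insert.hyps by (simp add: B_def mult.assoc)
qed

definition prime_powers :: "(nat \<times> nat) set" where
  "prime_powers = {(p, k). prime p \<and> k \<ge> 1}"

lemma prime_powers_altdef: "prime_powers = Sigma {p. prime p} (\<lambda>_. {1..})"
  by (auto simp: prime_powers_def)

lemma inj_on_prime_powers: "inj_on (\<lambda>(p, k). p ^ k) prime_powers"
  by (auto simp: inj_on_def prime_powers_def prime_power_inj'')

text \<open>
  Prime powers determine their base and exponent, so this is a subseries.
\<close>
lemma prime_powers_summable:
  fixes f :: "nat \<Rightarrow> real"
  assumes "f summable_on {1..}"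
  shows "(\<lambda>(p, k). f (p ^ k)) summable_on prime_powers"
proof -
  have "f summable_on ((\<lambda>(p, k). p ^ k) ` prime_powers)"
    by (rule summable_on_subset_banach[OF assms]) (auto simp: prime_powers_def Suc_le_eq prime_gt_0_nat)
  thus ?thesis
    by (subst (asm) summable_on_reindex[OF inj_on_prime_powers]) (simp add: o_def case_prod_unfold)
qed

lemma has_sum_Ln_series:
  fixes z :: complex
  assumes z: "norm z < 1"
  shows "((\<lambda>k::nat. z ^ k / of_nat k) has_sum - Ln (1 - z)) {1..}"
proof -
  have "(\<lambda>k. - ((- (- z)) ^ k) / of_nat k) sums Ln (1 + - z)"
    using Ln_series'[of "-z"] assms by simp
  hence s: "(\<lambda>k. z ^ k / of_nat k) sums - Ln (1 - z)" using sums_minus by fastforce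
  have "summable (\<lambda>k. norm (z ^ k / of_nat k))"
  proof (rule summable_comparison_test'[where N = 0])
    show "summable (\<lambda>k. norm z ^ k)" using z by (simp add: summable_geometric)
    fix k :: nat
    have "norm z ^ k / real k \<le> norm z ^ k"
      using mult_left_mono[of 1 "real k" "norm z ^ k"] by (cases "k = 0") (auto simp: divide_le_eq)
    thus "norm (norm (z ^ k / of_nat k)) \<le> norm z ^ k" by (simp add: norm_divide norm_power)
  qed
  hence "((\<lambda>k::nat. z ^ k / of_nat k) has_sum - Ln (1 - z)) UNIV"
    using s by (intro norm_summable_imp_has_sum) 
  thus ?thesis
    by (rule has_sum_cong_neutral[THEN iffD1, rotated -1]) auto
qed

text \<open>
  Sieving by all primes up to \<open>N\<close> leaves, in the limit, only the term \<open>n = 1\<close>.  The sieve factor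
  \<open>\<Prod> (1 - t p)\<close> is the exponential of the negative of a partial sum of the double series.
\<close>
theorem exp_log_Euler_product:
  fixes t :: "nat \<Rightarrow> complex"
  assumes mult: "\<And>m n. t (m * n) = t m * t n" and t1: "t 1 = 1"
    and summ: "(\<lambda>n. norm (t n)) summable_on {1..}"
    and less: "\<And>p. prime p \<Longrightarrow> norm (t p) < 1"
  shows "exp (\<Sum>\<^sub>\<infinity>(p, k)\<in>prime_powers. t (p ^ k) / of_nat k) = (\<Sum>\<^sub>\<infinity>n\<in>{1..}. t n)"
proof -
  have pow: "t (n ^ k) = t n ^ k" for n k by (induction k) (use t1 mult in auto)
  have "(\<lambda>(p, k). norm (t (p ^ k))) summable_on prime_powers"
    by (rule prime_powers_summable[OF summ])
  hence s: "(\<lambda>(p, k). t (p ^ k) / of_nat k) summable_on prime_powers"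
    by (rule abs_summable_summable[OF Infinite_Sum.abs_summable_on_comparison_test'])
       (auto simp: prime_powers_def norm_divide divide_le_eq mult_le_cancel_left1)
  define l where "l = (\<lambda>p. - Ln (1 - t p))"
  have "((\<lambda>p. \<Sum>\<^sub>\<infinity>k\<in>{1..}. t (p ^ k) / of_nat k) has_sum
          (\<Sum>\<^sub>\<infinity>(p, k)\<in>prime_powers. t (p ^ k) / of_nat k)) {p. prime p}"
    unfolding prime_powers_altdef
    using has_sum_SigmaD[OF has_sum_infsum[OF s[unfolded prime_powers_altdef]]]
      summable_on_SigmaD1[OF s[unfolded prime_powers_altdef]] by simp
  moreover have "(\<Sum>\<^sub>\<infinity>k\<in>{1..}. t (p ^ k) / of_nat k) = l p" if "prime p" for p
    using infsumI[OF has_sum_Ln_series[OF less[OF that]]] by (simp add: l_def pow)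
  ultimately have hs: "(l has_sum (\<Sum>\<^sub>\<infinity>(p, k)\<in>prime_powers. t (p ^ k) / of_nat k)) {p. prime p}"
    by (subst (asm) has_sum_cong[where g = l]) auto
  define E where "E = (\<Sum>\<^sub>\<infinity>(p, k)\<in>prime_powers. t (p ^ k) / of_nat k)"
  \<comment> \<open>The unordered sum over primes is in particular the limit over the primes up to \<open>N\<close>.\<close>
  have fl: "filterlim (\<lambda>N. {p. prime p \<and> p \<le> N}) (finite_subsets_at_top {p. prime p}) sequentially"
  proof (rule filterlim_finite_subsets_at_top[THEN iffD2], intro allI impI)
    fix X :: "nat set" assume X: "finite X \<and> X \<subseteq> {p. prime p}"
    show "eventually (\<lambda>N. finite {p. prime p \<and> p \<le> N} \<and> X \<subseteq> {p. prime p \<and> p \<le> N} \<and>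
             {p. prime p \<and> p \<le> N} \<subseteq> {p. prime p}) sequentially"
      using eventually_ge_at_top[of "Max X"] by eventually_elim (use X in \<open>auto intro: order_trans[OF Max_ge]\<close>)
  qed
  have "(\<lambda>N. \<Sum>p | prime p \<and> p \<le> N. l p) \<longlonglongrightarrow> E"
    using filterlim_compose[OF hs[unfolded has_sum_def] fl] by (simp add: E_def)
  hence "(\<lambda>N. exp (- (\<Sum>p | prime p \<and> p \<le> N. l p))) \<longlonglongrightarrow> exp (- E)"
    by (intro tendsto_intros)
  moreover have "exp (- (\<Sum>p | prime p \<and> p \<le> N. l p)) = (\<Prod>p | prime p \<and> p \<le> N. 1 - t p)" for N
  proof -
    have "exp (- (\<Sum>p | prime p \<and> p \<le> N. l p)) = (\<Prod>p | prime p \<and> p \<le> N. exp (Ln (1 - t p)))"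
      by (simp add: l_def sum_negf exp_sum)
    also have "\<dots> = (\<Prod>p | prime p \<and> p \<le> N. 1 - t p)"
    proof (intro prod.cong refl)
      fix p assume "p \<in> {p. prime p \<and> p \<le> N}"
      hence "t p \<noteq> 1" using less[of p] by auto
      thus "exp (Ln (1 - t p)) = 1 - t p" by simp
    qed
    finally show ?thesis .
  qed
  ultimately have prod: "(\<lambda>N. \<Prod>p | prime p \<and> p \<le> N. 1 - t p) \<longlonglongrightarrow> exp (- E)" by simp
  define S where "S = (\<Sum>\<^sub>\<infinity>n\<in>{1..}. t n)"
  have "(\<lambda>N. \<Sum>\<^sub>\<infinity>n\<in>{1..}. if \<forall>p\<in>{p. prime p \<and> p \<le> N}. \<not> p dvd n then t n else 0)
           \<longlonglongrightarrow> (\<Sum>\<^sub>\<infinity>n\<in>{1..}. if n = 1 then t n else 0)"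
  proof (rule infsum_dominated_convergence[OF _ _ _ summ])
    fix n :: nat assume n: "n \<in> {1..}"
    show "(\<lambda>N. if \<forall>p\<in>{p. prime p \<and> p \<le> N}. \<not> p dvd n then t n else 0) \<longlonglongrightarrow> (if n = 1 then t n else 0)"
    proof (cases "n = 1")
      case True
      have *: "\<forall>p\<in>{p. prime p \<and> p \<le> N}. \<not> p dvd n" for N using True by (auto dest: prime_gt_1_nat)
      show ?thesis unfolding if_P[OF *] using True by simp
    next
      case False
      then obtain p where p: "prime p" "p dvd n" using prime_factor_nat by blast
      have "eventually (\<lambda>N. (if \<forall>p\<in>{p. prime p \<and> p \<le> N}. \<not> p dvd n then t n else 0) = 0) sequentially"
        using eventually_ge_at_top[of p] by eventually_elim (use p in auto)
      from tendsto_eventually[OF this] False show ?thesis by simp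
    qed
  qed (auto intro!: always_eventually)
  also have "(\<Sum>\<^sub>\<infinity>n\<in>{1..}. if n = 1 then t n else 0) = 1"
  proof -
    have "(\<Sum>\<^sub>\<infinity>n\<in>{1..}. if n = 1 then t n else 0) = infsum t {1}"
      by (rule infsum_cong_neutral) auto
    thus ?thesis using t1 by simp
  qed
  also have "(\<lambda>N. \<Sum>\<^sub>\<infinity>n\<in>{1..}. if \<forall>p\<in>{p. prime p \<and> p \<le> N}. \<not> p dvd n then t n else 0)
               = (\<lambda>N. (\<Prod>p | prime p \<and> p \<le> N. 1 - t p) * S)"
  proof
    fix N
    have "(\<Sum>\<^sub>\<infinity>n\<in>{1..}. if \<forall>p\<in>{p. prime p \<and> p \<le> N}. \<not> p dvd n then t n else 0) =
            (\<Sum>\<^sub>\<infinity>n\<in>{n. n \<ge> 1 \<and> (\<forall>p\<in>{p. prime p \<and> p \<le> N}. \<not> p dvd n)}. t n)"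
      by (rule infsum_cong_neutral) auto
    also have "\<dots> = (\<Prod>p | prime p \<and> p \<le> N. 1 - t p) * S"
      unfolding S_def by (rule Euler_sieve[OF mult summ, symmetric]) auto
    finally show "(\<Sum>\<^sub>\<infinity>n\<in>{1..}. if \<forall>p\<in>{p. prime p \<and> p \<le> N}. \<not> p dvd n then t n else 0) =
                    (\<Prod>p | prime p \<and> p \<le> N. 1 - t p) * S" .
  qed
  finally have "(\<lambda>N. (\<Prod>p | prime p \<and> p \<le> N. 1 - t p) * S) \<longlonglongrightarrow> 1" .
  moreover have "(\<lambda>N. (\<Prod>p | prime p \<and> p \<le> N. 1 - t p) * S) \<longlonglongrightarrow> exp (- E) * S"
    by (intro tendsto_intros prod)
  ultimately have "exp (- E) * S = 1" using LIMSEQ_unique by blast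
  thus ?thesis unfolding E_def S_def by (simp add: exp_minus field_simps)
qed

lemma summable_on_powr_minus:
  assumes "s > 1"
  shows "(\<lambda>n::nat. real n powr - s) summable_on {1..}"
proof -
  have "summable (\<lambda>n. norm (real n powr - s))" using assms by (simp add: summable_real_powr_iff)
  hence "(\<lambda>n. real n powr - s) summable_on UNIV" by (rule norm_summable_imp_summable_on)
  thus ?thesis by (rule summable_on_subset_banach) simp
qed

text \<open>
  The logarithm of the L-series, as a function on the half-line \<open>s > 1\<close>, given by the series
  that fixes the branch.
\<close>
definition log_Euler_product :: "real \<Rightarrow> (nat \<Rightarrow> complex) \<Rightarrow> complex" where
  "log_Euler_product s \<psi> =
     (\<Sum>\<^sub>\<infinity>(p, k)\<in>prime_powers. \<psi> (p ^ k) * of_real (real (p ^ k) powr - s) / of_nat k)"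

lemma prime_power_term_bound:
  assumes d: "dirichlet_character q \<psi>" "q > 0" and pk: "pk \<in> prime_powers" and s: "s0 \<le> s"
  shows "norm (case pk of (p, k) \<Rightarrow> \<psi> (p ^ k) * of_real (real (p ^ k) powr - s) / of_nat k)
           \<le> (case pk of (p, k) \<Rightarrow> real (p ^ k) powr - s0)"
proof -
  obtain p k where pk': "pk = (p, k)" by force
  have p: "prime p" "k \<ge> 1" using pk by (auto simp: pk' prime_powers_def)
  define n where "n = p ^ k"
  have n: "n \<ge> 1" using p prime_gt_0_nat[of p] by (simp add: n_def Suc_le_eq)
  have "norm (\<psi> n * of_real (real n powr - s) / of_nat k) = norm (\<psi> n) * (real n powr - s / real k)"
    by (simp add: norm_mult norm_divide)
  also have "\<dots> \<le> 1 * (real n powr - s / 1)"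
    using p by (intro mult_mono norm_dirichlet_character_le_1[OF d] divide_left_mono) auto
  also have "\<dots> \<le> real n powr - s0" using n s by (simp add: powr_mono)
  finally show ?thesis by (simp add: pk' n_def)
qed

lemma log_Euler_product_summable:
  assumes "dirichlet_character q \<psi>" "q > 0" "s > 1"
  shows "(\<lambda>(p, k). \<psi> (p ^ k) * of_real (real (p ^ k) powr - s) / of_nat k) summable_on prime_powers"
  by (rule abs_summable_summable[OF Infinite_Sum.abs_summable_on_comparison_test'[OF
        prime_powers_summable[OF summable_on_powr_minus[OF assms(3)]]]])
     (rule prime_power_term_bound[OF assms(1,2)], auto)

lemma log_Euler_product_tendsto:
  assumes d: "dirichlet_character q \<psi>" "q > 0" and F: "F \<noteq> bot" and s0: "s0 > 1"
    and ev: "eventually (\<lambda>s. s \<ge> s0) F"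
    and lim: "\<And>p k. (p, k) \<in> prime_powers \<Longrightarrow> ((\<lambda>s. real (p ^ k) powr - s) \<longlongrightarrow> l (p ^ k)) F"
  shows "((\<lambda>s. log_Euler_product s \<psi>) \<longlongrightarrow> (\<Sum>\<^sub>\<infinity>(p, k)\<in>prime_powers. \<psi> (p ^ k) * of_real (l (p ^ k)) / of_nat k)) F"
  unfolding log_Euler_product_def
proof (rule infsum_dominated_convergence[OF F _ _ prime_powers_summable[OF summable_on_powr_minus[OF s0]]])
  fix pk assume "pk \<in> prime_powers"
  thus "((\<lambda>s. case pk of (p, k) \<Rightarrow> \<psi> (p ^ k) * of_real (real (p ^ k) powr - s) / of_nat k) \<longlongrightarrow>
           (case pk of (p, k) \<Rightarrow> \<psi> (p ^ k) * of_real (l (p ^ k)) / of_nat k)) F"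
    by (cases pk) (auto simp: prime_powers_def simp del: of_nat_power intro!: tendsto_intros lim)
next
  show "eventually (\<lambda>s. \<forall>pk\<in>prime_powers. norm (case pk of (p, k) \<Rightarrow> \<psi> (p ^ k) * of_real (real (p ^ k) powr - s) / of_nat k)
           \<le> (case pk of (p, k) \<Rightarrow> real (p ^ k) powr - s0)) F"
    using ev by eventually_elim (intro ballI prime_power_term_bound[OF d])
qed

lemma continuous_on_log_Euler_product:
  assumes d: "dirichlet_character q \<psi>" "q > 0"
  shows "continuous_on {1<..} (\<lambda>s. log_Euler_product s \<psi>)"
proof (rule continuous_at_imp_continuous_on, rule ballI)
  fix s :: real assume "s \<in> {1<..}"
  hence s: "s > 1" by simp
  define s0 where "s0 = (1 + s) / 2"
  have "((\<lambda>s. log_Euler_product s \<psi>) \<longlongrightarrow>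
          (\<Sum>\<^sub>\<infinity>(p, k)\<in>prime_powers. \<psi> (p ^ k) * of_real (real (p ^ k) powr - s) / of_nat k)) (at s)"
  proof (rule log_Euler_product_tendsto[OF d])
    show "s0 > 1" using s by (simp add: s0_def)
    have "eventually (\<lambda>x. x > s0) (at s)"
      by (rule order_tendstoD(1)[OF tendsto_ident_at]) (use s in \<open>simp add: s0_def\<close>)
    thus "eventually (\<lambda>x. x \<ge> s0) (at s)" by eventually_elim simp
    fix p k assume "(p, k) \<in> prime_powers"
    hence "real (p ^ k) \<noteq> 0" by (auto simp: prime_powers_def prime_gt_0_nat)
    thus "((\<lambda>s. real (p ^ k) powr - s) \<longlongrightarrow> real (p ^ k) powr - s) (at s)"
      by (intro tendsto_powr tendsto_const tendsto_minus tendsto_ident_at)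
  qed simp
  thus "isCont (\<lambda>s. log_Euler_product s \<psi>) s" by (simp add: isCont_def log_Euler_product_def)
qed

lemma log_Euler_product_tendsto_0:
  assumes d: "dirichlet_character q \<psi>" "q > 0"
  shows "((\<lambda>s. log_Euler_product s \<psi>) \<longlongrightarrow> 0) at_top"
proof -
  have "((\<lambda>s. log_Euler_product s \<psi>) \<longlongrightarrow>
          (\<Sum>\<^sub>\<infinity>(p, k)\<in>prime_powers. \<psi> (p ^ k) * of_real 0 / of_nat k)) at_top"
  proof (rule log_Euler_product_tendsto[OF d, where ?s0.0 = 2])
    fix p k assume "(p, k) \<in> prime_powers"
    hence "1 < p" "0 < k" using prime_gt_1_nat[of p] by (auto simp: prime_powers_def)
    hence "1 < p ^ k" by (rule one_less_power)
    hence "1 < real (p ^ k)" by linarith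
    moreover have "((\<lambda>s. c powr - s) \<longlongrightarrow> 0) at_top" if "c > 1" for c :: real
      using that by real_asymp
    ultimately show "((\<lambda>s. real (p ^ k) powr - s) \<longlongrightarrow> 0) at_top" by blast
  qed (auto simp: eventually_ge_at_top)
  thus ?thesis by (simp add: case_prod_unfold)
qed

lemma dirichlet_L_eq_infsum:
  assumes d: "dirichlet_character q \<psi>" "q > 0" and s: "s > 1"
  shows "dirichlet_L (of_real s) \<psi> = (\<Sum>\<^sub>\<infinity>n\<in>{1..}. \<psi> n * of_real (real n powr - s))"
    and "(\<lambda>n. norm (\<psi> n * of_real (real n powr - s))) summable_on {1..}"
proof -
  define t where "t = (\<lambda>n. \<psi> n * of_real (real n powr - s))"
  show *: "(\<lambda>n. norm (\<psi> n * of_real (real n powr - s))) summable_on {1..}"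
  proof (rule Infinite_Sum.abs_summable_on_comparison_test'[OF summable_on_powr_minus[OF s]])
    fix n :: nat
    show "norm (\<psi> n * of_real (real n powr - s)) \<le> real n powr - s"
      using mult_right_mono[OF norm_dirichlet_character_le_1[OF d, of n], of "real n powr - s"] by (simp add: norm_mult)
  qed
  have bij: "bij_betw Suc UNIV {1..}" by (auto simp: bij_betw_def image_iff Suc_le_eq gr0_conv_Suc)
  have "(t has_sum infsum t {1..}) {1..}"
    using abs_summable_summable[OF *] by (simp add: t_def)
  hence "((\<lambda>n. t (Suc n)) has_sum infsum t {1..}) UNIV"
    by (subst has_sum_reindex_bij_betw[OF bij])
  hence "(\<lambda>n. t (Suc n)) sums infsum t {1..}" by (rule has_sum_imp_sums)
  moreover have "t (Suc n) = \<psi> (Suc n) / of_nat (Suc n) powr of_real s" for n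
  proof -
    have "of_nat (Suc n) powr of_real s = (of_real (real (Suc n) powr s) :: complex)"
      using powr_of_real[of "real (Suc n)" s] by simp
    thus ?thesis unfolding t_def by (simp only: powr_minus of_real_inverse divide_inverse)
  qed
  ultimately have "(\<lambda>n. \<psi> (Suc n) / of_nat (Suc n) powr of_real s) sums infsum t {1..}" by simp
  thus "dirichlet_L (of_real s) \<psi> = (\<Sum>\<^sub>\<infinity>n\<in>{1..}. \<psi> n * of_real (real n powr - s))"
    unfolding dirichlet_L_def t_def by (rule sums_unique[symmetric])
qed

lemma exp_log_Euler_product_dirichlet:
  assumes d: "dirichlet_character q \<psi>" "q > 0" and s: "s > 1"
  shows "exp (log_Euler_product s \<psi>) = dirichlet_L (of_real s) \<psi>"
  unfolding log_Euler_product_def dirichlet_L_eq_infsum(1)[OF assms]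
proof (rule exp_log_Euler_product)
  show "(\<lambda>n. norm (\<psi> n * of_real (real n powr - s))) summable_on {1..}"
    by (rule dirichlet_L_eq_infsum(2)[OF assms])
  show "\<psi> (m * n) * of_real (real (m * n) powr - s) =
          \<psi> m * of_real (real m powr - s) * (\<psi> n * of_real (real n powr - s))" for m n
    by (simp add: dirichlet_character_mult[OF d(1)] powr_mult)
  show "\<psi> 1 * of_real (real 1 powr - s) = 1" using dirichlet_character_1[OF d(1)] by simp
  fix p :: nat assume "prime p"
  hence "real p > 1" using prime_gt_1_nat by force
  hence "real p powr - s < 1" using s by (simp add: powr_less_one)
  moreover have "norm (\<psi> p * of_real (real p powr - s)) \<le> real p powr - s"
    using mult_right_mono[OF norm_dirichlet_character_le_1[OF d, of p], of "real p powr - s"] by (simp add: norm_mult)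
  ultimately show "norm (\<psi> p * of_real (real p powr - s)) < 1" by linarith
qed

lemma sum_characters_log_Euler_product:
  assumes q: "q > 0" and a: "coprime a q" and s: "s > 1"
  shows "(\<Sum>\<psi> | dirichlet_character q \<psi>. cnj (\<psi> a) * log_Euler_product s \<psi>) =
           of_real (real (totient q) *
             (\<Sum>\<^sub>\<infinity>(p, k)\<in>{(p, k). (p, k) \<in> prime_powers \<and> [p ^ k = a] (mod q)}. real (p ^ k) powr - s / real k))"
proof -
  define D where "D = {\<psi>. dirichlet_character q \<psi>}"
  have "((\<lambda>pk. \<Sum>\<psi>\<in>D. cnj (\<psi> a) * (case pk of (p, k) \<Rightarrow> \<psi> (p ^ k) * of_real (real (p ^ k) powr - s) / of_nat k))
           has_sum (\<Sum>\<psi>\<in>D. cnj (\<psi> a) * log_Euler_product s \<psi>)) prime_powers"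
    unfolding log_Euler_product_def
    by (intro has_sum_finite_sum has_sum_cmult_right has_sum_infsum log_Euler_product_summable[OF _ q s])
       (simp add: D_def)
  also have "(\<lambda>pk. \<Sum>\<psi>\<in>D. cnj (\<psi> a) * (case pk of (p, k) \<Rightarrow> \<psi> (p ^ k) * of_real (real (p ^ k) powr - s) / of_nat k)) =
     (\<lambda>(p, k). of_real (if [p ^ k = a] (mod q) then real (totient q) * (real (p ^ k) powr - s / real k) else 0))"
  proof (rule ext, clarify)
    fix p k :: nat
    have "(\<Sum>\<psi>\<in>D. cnj (\<psi> a) * (\<psi> (p ^ k) * of_real (real (p ^ k) powr - s) / of_nat k)) =
            (\<Sum>\<psi>\<in>D. cnj (\<psi> a) * \<psi> (p ^ k)) * (of_real (real (p ^ k) powr - s) / of_nat k)"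
      unfolding sum_distrib_right by (intro sum.cong refl) (simp add: mult_ac)
    also have "(\<Sum>\<psi>\<in>D. cnj (\<psi> a) * \<psi> (p ^ k)) = (if [p ^ k = a] (mod q) then of_nat (totient q) else 0)"
      unfolding D_def by (rule dirichlet_character_orthogonality[OF q a])
    finally show "(\<Sum>\<psi>\<in>D. cnj (\<psi> a) * (\<psi> (p ^ k) * of_real (real (p ^ k) powr - s) / of_nat k)) =
       of_real (if [p ^ k = a] (mod q) then real (totient q) * (real (p ^ k) powr - s / real k) else 0)"
      by simp
  qed
  finally have "(\<Sum>\<psi>\<in>D. cnj (\<psi> a) * log_Euler_product s \<psi>) = of_real (\<Sum>\<^sub>\<infinity>(p, k)\<in>prime_powers.
      (if [p ^ k = a] (mod q) then real (totient q) * (real (p ^ k) powr - s / real k) else 0))"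
    unfolding case_prod_unfold by (rule has_sum_of_real_eq)
  also have "(\<Sum>\<^sub>\<infinity>(p, k)\<in>prime_powers.
      (if [p ^ k = a] (mod q) then real (totient q) * (real (p ^ k) powr - s / real k) else 0)) =
      (\<Sum>\<^sub>\<infinity>(p, k)\<in>{(p, k). (p, k) \<in> prime_powers \<and> [p ^ k = a] (mod q)}. real (totient q) * (real (p ^ k) powr - s / real k))"
    by (rule infsum_cong_neutral) (auto split: if_splits)
  also have "\<dots> = real (totient q) * (\<Sum>\<^sub>\<infinity>(p, k)\<in>{(p, k). (p, k) \<in> prime_powers \<and> [p ^ k = a] (mod q)}. real (p ^ k) powr - s / real k)"
    unfolding case_prod_unfold by (rule infsum_cmult_right')
  finally show ?thesis unfolding D_def .
qed

section \<open>Lambert series and real characters\<close>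

text \<open>
  The divisors of \<open>p\<^sup>k m\<close> are the products of a power of \<open>p\<close> and a divisor of \<open>m\<close>, in a unique way.
\<close>
lemma sum_divisors_prime_power_mult:
  fixes h :: "nat \<Rightarrow> real"
  assumes mult: "\<And>m n. h (m * n) = h m * h n" and h1: "h 1 = 1"
    and p: "prime p" and m: "m > 0" "\<not> p dvd m"
  shows "(\<Sum>d | d dvd p ^ k * m. h d) = (\<Sum>j\<le>k. h p ^ j) * (\<Sum>d | d dvd m. h d)"
proof -
  have p0: "p > 0" using p prime_gt_0_nat by simp
  have pow: "h (p ^ j) = h p ^ j" for j by (induction j) (use h1 mult in auto)
  have "bij_betw (\<lambda>(j, d). p ^ j * d) ({..k} \<times> {d. d dvd m}) {d. d dvd p ^ k * m}"
    unfolding bij_betw_def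
  proof
    show "inj_on (\<lambda>(j, d). p ^ j * d) ({..k} \<times> {d. d dvd m})"
    proof (rule inj_onI, clarify)
      fix i d j e assume *: "d dvd m" "e dvd m" "p ^ i * d = p ^ j * e"
      have nd: "\<not> p dvd d" "\<not> p dvd e" using * m by (auto dest: dvd_trans)
      have "d \<noteq> 0" "e \<noteq> 0" using * m by (auto intro!: Nat.gr0I)
      hence "multiplicity p (p ^ i * d) = i" "multiplicity p (p ^ j * e) = j"
        using nd p p0 by (simp_all add: prime_elem_multiplicity_mult_distrib not_dvd_imp_multiplicity_0)
      thus "i = j \<and> d = e" using * p0 by simp
    qed
    show "(\<lambda>(j, d). p ^ j * d) ` ({..k} \<times> {d. d dvd m}) = {d. d dvd p ^ k * m}"
    proof (intro equalityI subsetI)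
      fix e assume "e \<in> {d. d dvd p ^ k * m}"
      then obtain b c where bc: "e = b * c" "b dvd p ^ k" "c dvd m"
        using division_decomp by blast
      then obtain j where "j \<le> k" "b = p ^ j" using divides_primepow_nat[OF p] by blast
      thus "e \<in> (\<lambda>(j, d). p ^ j * d) ` ({..k} \<times> {d. d dvd m})" using bc by force
    qed (auto intro!: mult_dvd_mono le_imp_power_dvd)
  qed
  from sum.reindex_bij_betw[OF this, of h]
  have "(\<Sum>d | d dvd p ^ k * m. h d) = (\<Sum>x\<in>{..k} \<times> {d. d dvd m}. h (case x of (j, d) \<Rightarrow> p ^ j * d))"
    by simp
  also have "\<dots> = (\<Sum>j\<le>k. \<Sum>d | d dvd m. h p ^ j * h d)"
    unfolding sum.cartesian_product by (intro sum.cong refl) (auto simp: mult pow)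
  finally show ?thesis by (simp add: sum_product)
qed

lemma sum_powers_quadratic_value:
  fixes e :: real
  assumes "e = 0 \<or> e = 1 \<or> e = -1"
  shows "(\<Sum>j\<le>k. e ^ j) \<ge> 0" "(\<Sum>j\<le>2 * k. e ^ j) \<ge> 1"
proof -
  have alt: "(\<Sum>j\<le>k. (-1) ^ j) = (if even k then 1 else 0 :: real)" for k
    by (induction k) auto
  have zero: "(\<Sum>j\<le>k. 0 ^ j) = (1 :: real)" for k by (induction k) auto
  show "(\<Sum>j\<le>k. e ^ j) \<ge> 0" "(\<Sum>j\<le>2 * k. e ^ j) \<ge> 1" using assms by (auto simp: alt zero)
qed

text \<open>
  Both divisor sums are products over the primes dividing \<open>m\<close>.  The factor of \<open>p\<close> is a sum of
  consecutive powers of \<open>h p\<close>, which is one of 0, 1 and -1; an odd number of such powers,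
  beginning with the zeroth, adds up to at least 1.
\<close>
lemma divisor_sum_quadratic_character:
  fixes h :: "nat \<Rightarrow> real"
  assumes mult: "\<And>m n. h (m * n) = h m * h n" and h1: "h 1 = 1"
    and val: "\<And>n. h n = 0 \<or> h n = 1 \<or> h n = -1" and m: "m > 0"
  shows "(\<Sum>d | d dvd m. h d) \<ge> 0 \<and> (\<Sum>d | d dvd m ^ 2. h d) \<ge> 1"
  using m
proof (induction m rule: less_induct)
  case (less m)
  show ?case
  proof (cases "m = 1")
    case True
    thus ?thesis using h1 by simp
  next
    case False
    then obtain p where p: "prime p" "p dvd m" using prime_factor_nat by blast
    define k where "k = multiplicity p m"
    obtain m' where m': "m = p ^ k * m'" "\<not> p dvd m'"
      using multiplicity_decompose'[of m p] less.prems p unfolding k_def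
      by (metis not_prime_unit not_gr0)
    have k: "k > 0" unfolding k_def using p less.prems by (simp add: prime_multiplicity_gt_zero_iff)
    have m'0: "m' > 0" using m' less.prems by (intro Nat.gr0I) auto
    have "1 < p ^ k" by (rule one_less_power[OF prime_gt_1_nat[OF p(1)] k])
    hence "m' < m" using m' m'0 by simp
    from less.IH[OF this m'0] have IH: "(\<Sum>d | d dvd m'. h d) \<ge> 0" "(\<Sum>d | d dvd m' ^ 2. h d) \<ge> 1" by auto
    have "\<not> p dvd m' ^ 2" using m' p by (simp add: prime_dvd_power_iff)
    moreover have "m ^ 2 = p ^ (2 * k) * m' ^ 2" using m' by (simp add: power_mult_distrib power_mult mult.commute)
    ultimately have "(\<Sum>d | d dvd m ^ 2. h d) = (\<Sum>j\<le>2 * k. h p ^ j) * (\<Sum>d | d dvd m' ^ 2. h d)"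
      using sum_divisors_prime_power_mult[OF mult h1 p(1), of "m' ^ 2" "2 * k"] m'0 by simp
    moreover have "(\<Sum>d | d dvd m. h d) = (\<Sum>j\<le>k. h p ^ j) * (\<Sum>d | d dvd m'. h d)"
      using sum_divisors_prime_power_mult[OF mult h1 p(1), of m' k] m'0 m' by simp
    ultimately show ?thesis
      using IH sum_powers_quadratic_value[OF val[of p]] mult_mono[of 1 "\<Sum>j\<le>2 * k. h p ^ j" 1 "\<Sum>d | d dvd m' ^ 2. h d"]
      by simp
  qed
qed

text \<open>
  The terms with exponents \<open>j\<close> and \<open>n - 1 - j\<close> add up to at least twice their geometric mean.
\<close>
lemma geometric_sum_lower_bound:
  fixes x :: real
  assumes "0 \<le> x"
  shows "real n * sqrt x ^ (n - 1) \<le> (\<Sum>j<n. x ^ j)"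
proof -
  define r where "r = sqrt x"
  have r: "x = r ^ 2" using assms by (simp add: r_def)
  have "(\<Sum>j<n. x ^ j) = (\<Sum>j<n. x ^ (n - 1 - j))"
    using sum.nat_diff_reindex[of "\<lambda>j. x ^ j" n] by simp
  hence "2 * (\<Sum>j<n. x ^ j) = (\<Sum>j<n. x ^ j + x ^ (n - 1 - j))"
    by (simp add: sum.distrib)
  also have "\<dots> \<ge> (\<Sum>j<n. 2 * r ^ (n - 1))"
  proof (rule sum_mono)
    fix j assume "j \<in> {..<n}"
    hence "r ^ (n - 1) = r ^ j * r ^ (n - 1 - j)" by (simp flip: power_add)
    moreover have "(r ^ j - r ^ (n - 1 - j)) ^ 2 \<ge> 0" by simp
    moreover have "x ^ j = (r ^ j) ^ 2" "x ^ (n - 1 - j) = (r ^ (n - 1 - j)) ^ 2"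
      by (simp_all add: r mult.commute flip: power_mult)
    ultimately show "2 * r ^ (n - 1) \<le> x ^ j + x ^ (n - 1 - j)"
      by (simp add: power2_diff)
  qed
  finally show ?thesis by (simp add: r_def)
qed

text \<open>
  Apart from the factor \<open>1/(1 - x)\<close>, the number \<open>b n\<close> is \<open>1/n - x\<^sup>n/A\<^sub>n\<close> with
  \<open>A\<^sub>n = 1 + x + \<dots> + x\<^sup>n\<^sup>-\<^sup>1\<close>.  It decreases because
  \<open>x\<^sup>n/A\<^sub>n - x\<^sup>n\<^sup>+\<^sup>1/A\<^sub>n\<^sub>+\<^sub>1 = x\<^sup>n/(A\<^sub>n A\<^sub>n\<^sub>+\<^sub>1)\<close> is at most \<open>1/(n (n + 1))\<close>, by the preceding lower bound
  for geometric sums.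
\<close>
lemma Lambert_coefficient_decreasing:
  fixes x :: real
  assumes x: "0 < x" "x < 1"
  defines "b \<equiv> \<lambda>n. 1 / (real n * (1 - x)) - x ^ n / (1 - x ^ n)"
  shows "n > 0 \<Longrightarrow> b n \<ge> 0" "n > 0 \<Longrightarrow> b (Suc n) \<le> b n" "b 1 = 1"
proof -
  define A where "A = (\<lambda>n. \<Sum>j<n. x ^ j)"
  have A: "1 - x ^ n = (1 - x) * A n" for n using x by (simp add: A_def one_diff_power_eq)
  have b: "b n = (1 / real n - x ^ n / A n) / (1 - x)" for n
    unfolding b_def A using x by (simp add: diff_divide_distrib)
  have Apos: "A n > 0" if "n > 0" for n
    unfolding A_def using that x by (intro sum_pos) auto
  show "b 1 = 1" using x by (simp add: b_def divide_simps)
  show "b n \<ge> 0" if n: "n > 0"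
  proof -
    have "real n * x ^ n = (\<Sum>j<n. x ^ n)" by simp
    also have "\<dots> \<le> A n" unfolding A_def using x by (intro sum_mono power_decreasing) auto
    finally have "x ^ n / A n \<le> 1 / real n" using Apos[OF n] n by (simp add: field_simps)
    thus ?thesis unfolding b using x by simp
  qed
  show "b (Suc n) \<le> b n" if n: "n > 0"
  proof -
    define r where "r = sqrt x"
    have r: "0 < r" "r < 1" "r ^ 2 = x" using x by (auto simp: r_def)
    have "(real n * r ^ (n - 1)) * (real (Suc n) * r ^ n) \<le> A n * A (Suc n)"
      using geometric_sum_lower_bound[of x n] geometric_sum_lower_bound[of x "Suc n"] x Apos[OF n] r
      unfolding A_def r_def by (intro mult_mono) auto
    moreover have "x ^ n \<le> r ^ (n - 1) * r ^ n"
    proof -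
      have "x ^ n = r ^ (2 * n)" using r by (simp add: power_mult)
      also have "\<dots> \<le> r ^ (n - 1 + n)" using r by (intro power_decreasing) auto
      finally show ?thesis by (simp add: power_add)
    qed
    ultimately have "real n * real (Suc n) * x ^ n \<le> A n * A (Suc n)"
      using mult_left_mono[of "x ^ n" "r ^ (n - 1) * r ^ n" "real n * real (Suc n)"] by (simp add: mult_ac)
    hence "x ^ n / (A n * A (Suc n)) \<le> 1 / (real n * real (Suc n))"
    proof -
      have "y / P \<le> 1 / Q" if "P > 0" "Q > 0" "Q * y \<le> P" for P Q y :: real
        using that by (simp add: field_simps)
      thus ?thesis using \<open>real n * real (Suc n) * x ^ n \<le> A n * A (Suc n)\<close> Apos[OF n] Apos[of "Suc n"] n by simp
    qed
    moreover have "x ^ n / A n - x ^ Suc n / A (Suc n) = x ^ n / (A n * A (Suc n))"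
    proof -
      have "A (Suc n) - x * A n = 1"
      proof -
        have "A (Suc n) = 1 + (\<Sum>j<n. x ^ Suc j)" unfolding A_def by (subst sum.lessThan_Suc_shift) simp
        thus ?thesis by (simp add: A_def sum_distrib_left)
      qed
      hence "A (Suc n) = 1 + x * A n" by simp
      moreover have "x ^ n / A n - x ^ Suc n / A (Suc n) = x ^ n * (A (Suc n) - x * A n) / (A n * A (Suc n))"
        using Apos[OF n] Apos[of "Suc n"] by (simp add: field_simps)
      ultimately show ?thesis by simp
    qed
    moreover have "1 / real n - 1 / real (Suc n) = 1 / (real n * real (Suc n))" using n by (simp add: field_simps)
    ultimately have "1 / real (Suc n) - x ^ Suc n / A (Suc n) \<le> 1 / real n - x ^ n / A n" by linarith
    thus ?thesis unfolding b using x by (intro divide_right_mono) auto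
  qed
qed

lemma Abel_bound_decreasing:
  fixes h b :: "nat \<Rightarrow> real"
  assumes B: "\<And>n. \<bar>\<Sum>k<n. h k\<bar> \<le> B" and b: "\<And>n. b n \<ge> 0" "\<And>n. b (Suc n) \<le> b n"
  shows "\<bar>\<Sum>n<N. h n * b n\<bar> \<le> B * b 0"
proof -
  define D where "D = (\<lambda>n. \<Sum>k<n. h k)"
  have "(\<Sum>n<N. h n * b n) = (\<Sum>n<N. D (Suc n) * (b n - b (Suc n))) + D N * b N"
    by (induction N) (auto simp: D_def algebra_simps)
  also have "\<bar>\<dots>\<bar> \<le> (\<Sum>n<N. \<bar>D (Suc n) * (b n - b (Suc n))\<bar>) + \<bar>D N * b N\<bar>"
    by (intro order_trans[OF abs_triangle_ineq] add_right_mono sum_abs)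
  also have "\<dots> \<le> (\<Sum>n<N. B * (b n - b (Suc n))) + B * b N"
    unfolding abs_mult D_def using b B
    by (intro add_mono sum_mono mult_mono) (auto simp del: sum.lessThan_Suc intro: order_trans[OF abs_ge_zero])
  also have "(\<Sum>n<N. B * (b n - b (Suc n))) = B * (b 0 - b N)"
    by (simp add: sum_lessThan_telescope' flip: sum_distrib_left)
  finally show ?thesis by (simp add: algebra_simps)
qed

text \<open>
  Expanding \<open>x\<^sup>n/(1 - x\<^sup>n)\<close> and collecting the powers of \<open>x\<close> gives a power series whose
  coefficient at \<open>m\<close> is the divisor sum of \<open>h\<close>.  The squares alone account for the lower bound.
\<close>
lemma Lambert_series_lower_bound:
  fixes h :: "nat \<Rightarrow> real" and x :: real
  assumes mult: "\<And>m n. h (m * n) = h m * h n" and h1: "h 1 = 1"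
    and val: "\<And>n. h n = 0 \<or> h n = 1 \<or> h n = -1" and x: "0 < x" "x < 1"
  shows "(\<lambda>n. h n * (x ^ n / (1 - x ^ n))) summable_on {1..}"
    and "(\<Sum>j=1..K. x ^ (j ^ 2)) \<le> (\<Sum>\<^sub>\<infinity>n\<in>{1..}. h n * (x ^ n / (1 - x ^ n)))"
proof -
  have geo: "((\<lambda>k::nat. x ^ (n * k)) has_sum x ^ n / (1 - x ^ n)) {1..}" if "n \<ge> 1" for n
    using has_sum_geometric_from_1[of "x ^ n"] x that by (simp add: power_mult power_less_one_iff)
  have hle: "\<bar>h n\<bar> \<le> 1" for n using val[of n] by auto
  have "(\<lambda>n. x ^ n / (1 - x ^ n)) summable_on {1..}"
  proof (rule summable_on_comparison_test)
    show "(\<lambda>n. x ^ n * (1 / (1 - x))) summable_on {1..}"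
      using has_sum_geometric_from_1[of x] x by (intro summable_on_cmult_left) (auto simp: summable_on_def)
    fix n :: nat assume n: "n \<in> {1..}"
    have "x ^ n \<le> x ^ 1" using n x by (intro power_decreasing) auto
    thus "x ^ n / (1 - x ^ n) \<le> x ^ n * (1 / (1 - x))" "0 \<le> x ^ n / (1 - x ^ n)"
      using x by (auto intro!: divide_left_mono mult_pos_pos)
  qed
  hence "(\<lambda>(n, k). x ^ (n * k)) summable_on (SIGMA n:{1::nat..}. {1::nat..})"
    by (intro summable_on_SigmaI[where g = "\<lambda>n. x ^ n / (1 - x ^ n)"]) (use geo x in auto)
  hence s2: "(\<lambda>(n, k). h n * x ^ (n * k)) summable_on (SIGMA n:{1::nat..}. {1::nat..})"
    by (rule abs_summable_summable[OF Infinite_Sum.abs_summable_on_comparison_test'])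
       (use hle x in \<open>auto simp: abs_mult mult_left_le_one_le\<close>)
  define f where "f = (\<Sum>\<^sub>\<infinity>(n, k)\<in>(SIGMA n:{1::nat..}. {1::nat..}). h n * x ^ (n * k))"
  have inner: "((\<lambda>k. h n * x ^ (n * k)) has_sum h n * (x ^ n / (1 - x ^ n))) {1..}" if "n \<in> {1..}" for n
    using that by (intro has_sum_cmult_right geo) auto
  have outer: "((\<lambda>n. h n * (x ^ n / (1 - x ^ n))) has_sum f) {1..}"
    by (rule has_sum_SigmaD[OF has_sum_infsum[OF s2, folded f_def]]) (use inner in auto)
  thus "(\<lambda>n. h n * (x ^ n / (1 - x ^ n))) summable_on {1..}" by (auto simp: summable_on_def)
  have bij: "bij_betw (\<lambda>(n, k). (n * k, n)) (SIGMA n:{1::nat..}. {1::nat..}) (SIGMA m:{1::nat..}. {d. d dvd m})"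
    by (rule bij_betwI[where g = "\<lambda>(m, d). (d, m div d)"]) (auto simp: Suc_le_eq elim!: dvdE)
  have "((\<lambda>(m, d). h d * x ^ m) has_sum f) (SIGMA m:{1::nat..}. {d. d dvd m})"
    using has_sum_infsum[OF s2, folded f_def]
    by (subst has_sum_reindex_bij_betw[OF bij, symmetric]) (simp add: case_prod_unfold)
  hence "((\<lambda>m. (\<Sum>d | d dvd m. h d) * x ^ m) has_sum f) {1..}"
    by (rule has_sum_SigmaD) (auto intro!: has_sum_finiteI simp: sum_distrib_right)
  hence "(\<Sum>m\<in>(\<lambda>j. j ^ 2) ` {1..K}. (\<Sum>d | d dvd m. h d) * x ^ m) \<le> f"
    by (rule finite_sum_le_has_sum)
       (use divisor_sum_quadratic_character[OF mult h1 val] x in \<open>auto simp: Suc_le_eq\<close>)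
  also have "(\<Sum>m\<in>(\<lambda>j. j ^ 2) ` {1..K}. (\<Sum>d | d dvd m. h d) * x ^ m) = (\<Sum>j=1..K. (\<Sum>d | d dvd j ^ 2. h d) * x ^ (j ^ 2))"
    by (subst sum.reindex) (auto simp: inj_on_def)
  finally have "(\<Sum>j=1..K. (\<Sum>d | d dvd j ^ 2. h d) * x ^ (j ^ 2)) \<le> f" .
  moreover have "(\<Sum>j=1..K. 1 * x ^ (j ^ 2)) \<le> (\<Sum>j=1..K. (\<Sum>d | d dvd j ^ 2. h d) * x ^ (j ^ 2))"
    by (intro sum_mono mult_right_mono)
       (use divisor_sum_quadratic_character[OF mult h1 val] x in auto)
  ultimately show "(\<Sum>j=1..K. x ^ (j ^ 2)) \<le> (\<Sum>\<^sub>\<infinity>n\<in>{1..}. h n * (x ^ n / (1 - x ^ n)))"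
    using infsumI[OF outer] by simp
qed

text \<open>
  If the series had sum 0, then minus the Lambert series of \<open>h\<close> would equal \<open>\<Sum> h(n) b(n)\<close> with
  the decreasing coefficients \<open>b(n) = 1/(n (1 - x)) - x\<^sup>n/(1 - x\<^sup>n)\<close> and \<open>b(1) = 1\<close>.  Then it would
  be bounded by \<open>B\<close> for all \<open>x < 1\<close>; but it is at least the sum of \<open>x ^ (j ^ 2)\<close> over any number
  of positive \<open>j\<close>, and each of these terms tends to 1 with \<open>x\<close>.
\<close>
theorem quadratic_series_nonzero:
  fixes h :: "nat \<Rightarrow> real"
  assumes mult: "\<And>m n. h (m * n) = h m * h n" and h1: "h 1 = 1"
    and val: "\<And>n. h n = 0 \<or> h n = 1 \<or> h n = -1"
    and B: "\<And>n. \<bar>\<Sum>k<n. h (Suc k)\<bar> \<le> B"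
  shows "\<not> (\<lambda>n. h (Suc n) / real (Suc n)) sums 0"
proof
  assume L: "(\<lambda>n. h (Suc n) / real (Suc n)) sums 0"
  have bound: "(\<Sum>j=1..K. x ^ (j ^ 2)) \<le> B" if x: "0 < x" "x < 1" for x :: real and K
  proof -
    define b where "b = (\<lambda>n. 1 / (real n * (1 - x)) - x ^ n / (1 - x ^ n))"
    define f where "f = (\<Sum>\<^sub>\<infinity>n\<in>{1..}. h n * (x ^ n / (1 - x ^ n)))"
    have b: "b (Suc n) \<ge> 0" "b (Suc (Suc n)) \<le> b (Suc n)" "b (Suc 0) = 1" for n
      using Lambert_coefficient_decreasing[OF x] unfolding b_def One_nat_def by blast+
    have "((\<lambda>n. h n * (x ^ n / (1 - x ^ n))) has_sum f) {1..}"
      unfolding f_def by (intro has_sum_infsum Lambert_series_lower_bound mult h1 val x)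
    moreover have "bij_betw Suc UNIV {1..}" by (auto simp: bij_betw_def image_iff Suc_le_eq gr0_conv_Suc)
    ultimately have "((\<lambda>n. h (Suc n) * (x ^ Suc n / (1 - x ^ Suc n))) has_sum f) UNIV"
      by (subst has_sum_reindex_bij_betw[of Suc]) 
    hence "(\<lambda>n. h (Suc n) * (x ^ Suc n / (1 - x ^ Suc n))) sums f" by (rule has_sum_imp_sums)
    from sums_diff[OF sums_mult2[OF L, of "1 / (1 - x)"] this]
    have "(\<lambda>n. h (Suc n) * b (Suc n)) sums (- f)"
      using x by (simp add: b_def algebra_simps)
    hence "(\<lambda>N. \<Sum>n<N. h (Suc n) * b (Suc n)) \<longlonglongrightarrow> - f" by (simp add: sums_def)
    hence "(\<lambda>N. \<bar>\<Sum>n<N. h (Suc n) * b (Suc n)\<bar>) \<longlonglongrightarrow> \<bar>- f\<bar>" by (rule tendsto_rabs)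
    moreover have "\<bar>\<Sum>n<N. h (Suc n) * b (Suc n)\<bar> \<le> B" for N
      using Abel_bound_decreasing[of "\<lambda>n. h (Suc n)" B "\<lambda>n. b (Suc n)" N, OF B b(1,2)] b(3) by simp
    ultimately have "\<bar>- f\<bar> \<le> B" by (intro LIMSEQ_le_const2) auto
    thus ?thesis
      using Lambert_series_lower_bound(2)[OF mult h1 val x, of K] unfolding f_def by linarith
  qed
  \<comment> \<open>Letting \<open>x \<rightarrow> 1\<close> in the bound with more than \<open>B\<close> terms gives a contradiction.\<close>
  define K where "K = nat \<lceil>B\<rceil> + 1"
  have "((\<lambda>x::real. \<Sum>j=1..K. x ^ (j ^ 2)) \<longlongrightarrow> (\<Sum>j=1..K. 1 ^ (j ^ 2))) (at_left 1)"
    by (intro tendsto_intros)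
  hence "(\<Sum>j=1..K. 1 ^ (j ^ 2)) \<le> B"
  proof (rule tendsto_upperbound)
    show "eventually (\<lambda>x::real. (\<Sum>j=1..K. x ^ (j ^ 2)) \<le> B) (at_left 1)"
      by (rule eventually_at_leftI[of 0]) (use bound in auto)
  qed simp
  hence "real K \<le> B" by simp
  thus False unfolding K_def by linarith
qed

section \<open>Behaviour of the L-series at 1\<close>

text \<open>
  Comparison of each term with the integral of \<open>u\<^sup>-\<^sup>s\<close> over a unit interval, in the form of
  the mean value theorem for the antiderivative.
\<close>
lemma zeta_series_bounds:
  fixes s :: real
  assumes s: "s > 1"
  defines "Z \<equiv> (\<Sum>n. real (Suc n) powr - s)"
  shows "(\<lambda>n. real (Suc n) powr - s) sums Z" "1 / (s - 1) \<le> Z" "Z \<le> 1 + 1 / (s - 1)"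
proof -
  have "summable (\<lambda>n. real n powr - s)" using s by (simp add: summable_real_powr_iff)
  hence summ: "summable (\<lambda>n. real (Suc n) powr - s)" by (subst summable_Suc_iff)
  thus sums: "(\<lambda>n. real (Suc n) powr - s) sums Z" unfolding Z_def by (rule summable_sums)
  define f where "f = (\<lambda>n. real (Suc n) powr (1 - s) / (s - 1))"
  have step: "real (Suc (Suc n)) powr - s \<le> f n - f (Suc n)" "f n - f (Suc n) \<le> real (Suc n) powr - s" for n
  proof -
    have "\<exists>u. real (Suc n) < u \<and> u < real (Suc (Suc n)) \<and>
        - (real (Suc (Suc n)) powr (1 - s) / (s - 1)) - - (real (Suc n) powr (1 - s) / (s - 1)) = (real (Suc (Suc n)) - real (Suc n)) * (u powr - s)"
    proof (rule MVT2)
      fix u assume "real (Suc n) \<le> u"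
      hence "u > 0" by linarith
      thus "((\<lambda>u. - (u powr (1 - s) / (s - 1))) has_real_derivative u powr - s) (at u)"
        by (rule DERIV_cong[OF DERIV_minus[OF DERIV_cdivide[OF has_real_derivative_powr]]])
           (use s in \<open>simp add: field_simps\<close>)
    qed simp
    then obtain u where u: "real (Suc n) < u" "u < real (Suc (Suc n))" "f n - f (Suc n) = u powr - s"
      by (auto simp: f_def)
    show "real (Suc (Suc n)) powr - s \<le> f n - f (Suc n)" "f n - f (Suc n) \<le> real (Suc n) powr - s"
      unfolding u(3) using u s by (auto intro!: powr_mono2')
  qed
  have "(\<lambda>n. real n powr (1 - s) / (s - 1)) \<longlonglongrightarrow> 0" using s by real_asymp
  hence "f \<longlonglongrightarrow> 0" unfolding f_def by (rule LIMSEQ_Suc)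
  hence tel: "(\<lambda>n. f n - f (Suc n)) sums (1 / (s - 1))"
    using telescope_sums'[of f 0] by (simp add: f_def)
  show "1 / (s - 1) \<le> Z" by (rule sums_le[OF step(2) tel sums])
  have "(\<lambda>n. real (Suc (Suc n)) powr - s) sums (Z - 1)"
    using sums_Suc_iff[of "\<lambda>n. real (Suc n) powr - s" "Z - 1"] sums by simp
  from sums_le[OF step(1) this tel] show "Z \<le> 1 + 1 / (s - 1)" by simp
qed

lemma zeta_series_residue:
  "((\<lambda>s. (s - 1) * (\<Sum>n. real (Suc n) powr - s)) \<longlongrightarrow> 1) (at_right 1)"
proof (rule tendsto_sandwich)
  show "eventually (\<lambda>s. 1 \<le> (s - 1) * (\<Sum>n. real (Suc n) powr - s)) (at_right 1)"
    by (rule eventually_at_rightI[of 1 2]) (use zeta_series_bounds(2) in \<open>auto simp: field_simps\<close>)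
  show "eventually (\<lambda>s. (s - 1) * (\<Sum>n. real (Suc n) powr - s) \<le> s) (at_right 1)"
  proof (rule eventually_at_rightI[of 1 2])
    fix s :: real assume s: "s \<in> {1<..<2}"
    have "(s - 1) * (\<Sum>n. real (Suc n) powr - s) \<le> (s - 1) * (1 + 1 / (s - 1))"
      using s zeta_series_bounds(3)[of s] by (intro mult_left_mono) auto
    also have "\<dots> = s" using s by (simp add: field_simps)
    finally show "(s - 1) * (\<Sum>n. real (Suc n) powr - s) \<le> s" .
  qed auto
qed (auto intro!: tendsto_eq_intros)

lemma nonprincipal_L:
  assumes q: "q > 0" and \<psi>: "\<psi> \<in> nonprincipal_characters q"
  shows nonprincipal_L_sums: "\<And>s. Re s > 0 \<Longrightarrow> (\<lambda>n. \<psi> (Suc n) / of_nat (Suc n) powr s) sums dirichlet_L s \<psi>"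
    and nonprincipal_L_holomorphic: "(\<lambda>s. dirichlet_L s \<psi>) holomorphic_on {s. Re s > 0}"
    and nonprincipal_bounded_partial_sums: "\<And>n. norm (\<Sum>k<n. \<psi> (Suc k)) \<le> (\<Sum>k<q. norm (\<psi> (Suc k)))"
proof -
  have d: "dirichlet_character q \<psi>" "\<psi> \<noteq> principal_character q"
    using \<psi> by (auto simp: nonprincipal_characters_def)
  have *: "norm (\<Sum>k<n. \<psi> (Suc k)) \<le> (\<Sum>k<q. norm (\<psi> (Suc k)))" for n
    by (rule bounded_partial_sums_periodic[OF q _ sum_dirichlet_character[OF q d]])
       (use d in \<open>simp add: dirichlet_character_def\<close>)
  show "\<And>s. Re s > 0 \<Longrightarrow> (\<lambda>n. \<psi> (Suc n) / of_nat (Suc n) powr s) sums dirichlet_L s \<psi>"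
    by (rule dirichlet_L_sums[OF *])
  show "(\<lambda>s. dirichlet_L s \<psi>) holomorphic_on {s. Re s > 0}"
    by (rule dirichlet_L_holomorphic[OF *])
  show "\<And>n. norm (\<Sum>k<n. \<psi> (Suc k)) \<le> (\<Sum>k<q. norm (\<psi> (Suc k)))" by (rule *)
qed

lemma tendsto_of_real_at_right_1:
  fixes f :: "complex \<Rightarrow> complex"
  assumes "f holomorphic_on {s. Re s > 0}"
  shows "((\<lambda>s. f (of_real s)) \<longlongrightarrow> f 1) (at_right 1)"
proof -
  have "isCont f 1"
    using holomorphic_on_imp_continuous_on[OF assms] open_halfspace_Re_gt[of 0]
    by (simp add: continuous_on_eq_continuous_at)
  moreover have "((\<lambda>s::real. of_real s) \<longlongrightarrow> (of_real 1 :: complex)) (at_right 1)"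
    by (intro tendsto_intros)
  ultimately show ?thesis by (simp add: isCont_tendsto_compose)
qed

text \<open>
  The principal character minus its mean value \<open>\<phi>(q)/q\<close> has bounded partial sums, so its
  Dirichlet series stays bounded at 1; the singularity is that of \<open>\<phi>(q)/q\<close> times the zeta
  series.
\<close>
lemma principal_L_residue:
  assumes q: "q > 0"
  shows "((\<lambda>s. of_real (s - 1) * dirichlet_L (of_real s) (principal_character q)) \<longlongrightarrow>
            of_nat (totient q) / of_nat q) (at_right (1::real))"
proof -
  define r :: complex where "r = of_nat (totient q) / of_nat q"
  define c where "c = (\<lambda>n. principal_character q n - r)"
  have per: "c (n + q) = c n" for n
    using dirichlet_character_principal[of q] by (simp add: c_def dirichlet_character_def)
  have "(\<Sum>n<q. principal_character q n) = of_nat (totient q)"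
    using card_coprime_residues[OF q]
    by (simp add: principal_character_def sum.If_cases lessThan_def Collect_conj_eq[symmetric])
  hence mean: "(\<Sum>n<q. c n) = 0" using q by (simp add: c_def sum_subtractf r_def)
  note bd = bounded_partial_sums_periodic[OF q per mean]
  have eq: "dirichlet_L (of_real s) (principal_character q) =
              dirichlet_L (of_real s) c + r * of_real (\<Sum>n. real (Suc n) powr - s)" if s: "s > 1" for s
  proof -
    have "(\<lambda>n. c (Suc n) / of_nat (Suc n) powr of_real s) sums dirichlet_L (of_real s) c"
      using s by (intro dirichlet_L_sums[OF bd]) auto
    moreover have "(\<lambda>n. r * of_real (real (Suc n) powr - s)) sums (r * of_real (\<Sum>n. real (Suc n) powr - s))"
      by (intro sums_mult sums_of_real zeta_series_bounds(1) s)
    moreover have "of_real (real (Suc n) powr - s) = 1 / (of_nat (Suc n) powr of_real s :: complex)" for n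
    proof -
      have "of_nat (Suc n) powr of_real s = (of_real (real (Suc n) powr s) :: complex)"
        using powr_of_real[of "real (Suc n)" s] by simp
      thus ?thesis by (simp only: powr_minus of_real_inverse inverse_eq_divide of_real_divide of_real_1)
    qed
    ultimately have "(\<lambda>n. c (Suc n) / of_nat (Suc n) powr of_real s + r * (1 / of_nat (Suc n) powr of_real s))
       sums (dirichlet_L (of_real s) c + r * of_real (\<Sum>n. real (Suc n) powr - s))"
      by (intro sums_add) (simp_all only:)
    hence "(\<lambda>n. principal_character q (Suc n) / of_nat (Suc n) powr of_real s)
       sums (dirichlet_L (of_real s) c + r * of_real (\<Sum>n. real (Suc n) powr - s))"
      by (simp add: c_def diff_divide_distrib)
    thus ?thesis unfolding dirichlet_L_def[of _ "principal_character q"] by (simp add: sums_iff)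
  qed
  have 1: "((\<lambda>s. of_real (s - 1) * dirichlet_L (of_real s) c +
           r * of_real ((s - 1) * (\<Sum>n. real (Suc n) powr - s))) \<longlongrightarrow> of_real (1 - 1) * dirichlet_L 1 c + r * of_real 1) (at_right (1::real))"
    by (intro tendsto_intros zeta_series_residue tendsto_of_real_at_right_1[OF dirichlet_L_holomorphic[OF bd]])
  have "eventually (\<lambda>s. of_real (s - 1) * dirichlet_L (of_real s) c +
           r * of_real ((s - 1) * (\<Sum>n. real (Suc n) powr - s)) =
           of_real (s - 1) * dirichlet_L (of_real s) (principal_character q)) (at_right 1)"
    by (rule eventually_at_rightI[of 1 2]) (auto simp: eq algebra_simps)
  from Lim_transform_eventually[OF 1 this] show ?thesis by (simp add: r_def)
qed

text \<open>
  By orthogonality with \<open>a = 1\<close>, the logarithm of the product is \<open>\<phi>(q)\<close> times a sum of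
  nonnegative terms.
\<close>
lemma prod_norm_L_ge_1:
  assumes q: "q > 0" and s: "s > 1"
  shows "(\<Prod>\<psi> | dirichlet_character q \<psi>. norm (dirichlet_L (of_real s) \<psi>)) \<ge> 1"
proof -
  define D where "D = {\<psi>. dirichlet_character q \<psi>}"
  have fin: "finite D" unfolding D_def by (rule finite_dirichlet_characters[OF q])
  have "(\<Sum>\<psi>\<in>D. log_Euler_product s \<psi>) = (\<Sum>\<psi>\<in>D. cnj (\<psi> 1) * log_Euler_product s \<psi>)"
    by (intro sum.cong refl) (auto simp: D_def dirichlet_character_1)
  also have "\<dots> = of_real (real (totient q) *
       (\<Sum>\<^sub>\<infinity>(p, k)\<in>{(p, k). (p, k) \<in> prime_powers \<and> [p ^ k = 1] (mod q)}. real (p ^ k) powr - s / real k))"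
    unfolding D_def by (rule sum_characters_log_Euler_product[OF q _ s]) simp
  finally have Re: "Re (\<Sum>\<psi>\<in>D. log_Euler_product s \<psi>) \<ge> 0"
    by (auto intro!: mult_nonneg_nonneg infsum_nonneg)
  have "(\<Prod>\<psi>\<in>D. norm (dirichlet_L (of_real s) \<psi>)) = (\<Prod>\<psi>\<in>D. norm (exp (log_Euler_product s \<psi>)))"
    by (intro prod.cong refl) (use exp_log_Euler_product_dirichlet[OF _ q s] in \<open>auto simp: D_def\<close>)
  also have "\<dots> = exp (\<Sum>\<psi>\<in>D. Re (log_Euler_product s \<psi>))"
    by (simp add: norm_exp_eq_Re exp_sum[OF fin])
  also have "\<dots> \<ge> 1" using Re by simp
  finally show ?thesis by (simp add: D_def)
qed

text \<open>
  For nonreal \<open>\<psi>\<close>, a zero at 1 is shared by the conjugate character.  The two zeros outweigh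
  the pole of the principal character, so the product over all characters would tend to 0,
  although it is at least 1.  Real \<open>\<psi>\<close> are covered by \<open>quadratic_series_nonzero\<close>.
\<close>
theorem dirichlet_L_1_nonzero:
  assumes q: "q > 0" and \<psi>: "\<psi> \<in> nonprincipal_characters q"
  shows "dirichlet_L 1 \<psi> \<noteq> 0"
proof
  assume zero: "dirichlet_L 1 \<psi> = 0"
  have d: "dirichlet_character q \<psi>" "\<psi> \<noteq> principal_character q"
    using \<psi> by (auto simp: nonprincipal_characters_def)
  have sums: "(\<lambda>n. \<psi> (Suc n) / of_nat (Suc n)) sums 0"
    using nonprincipal_L_sums[OF q \<psi>, of 1] zero by simp
  define \<psi>' where "\<psi>' = (\<lambda>n. cnj (\<psi> n))"
  show False
  proof (cases "\<psi>' = \<psi>")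
    case True
    define h where "h = (\<lambda>n. Re (\<psi> n))"
    have h: "\<psi> n = of_real (h n)" for n
      using fun_cong[OF True, of n] by (simp add: h_def \<psi>'_def complex_eq_iff)
    have "\<not> (\<lambda>n. h (Suc n) / real (Suc n)) sums 0"
    proof (rule quadratic_series_nonzero)
      show "h (m * n) = h m * h n" for m n
        using dirichlet_character_mult[OF d(1), of m n] by (simp add: h flip: of_real_mult)
      show "h 1 = 1" using dirichlet_character_1[OF d(1)] by (simp add: h)
      show "h n = 0 \<or> h n = 1 \<or> h n = -1" for n
        using norm_dirichlet_character[OF d(1) q, of n] by (auto simp: h split: if_splits)
      show "\<bar>\<Sum>k<n. h (Suc k)\<bar> \<le> (\<Sum>k<q. norm (\<psi> (Suc k)))" for n
        using nonprincipal_bounded_partial_sums[OF q \<psi>, of n] by (simp add: h flip: of_real_sum)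
    qed
    moreover have "(\<lambda>n. h (Suc n) / real (Suc n)) sums 0"
      using sums_Re[OF sums] by (simp add: h_def Re_divide_of_nat del: of_nat_Suc)
    ultimately show False by contradiction
  next
    case False
    have d': "dirichlet_character q \<psi>'" unfolding \<psi>'_def by (rule dirichlet_character_cnj[OF d(1)])
    have "\<psi>' \<noteq> principal_character q"
    proof
      assume "\<psi>' = principal_character q"
      hence "cnj (\<psi>' n) = cnj (principal_character q n)" for n by simp
      hence "\<psi> = principal_character q" by (auto simp: \<psi>'_def principal_character_def fun_eq_iff)
      thus False using d by simp
    qed
    hence \<psi>': "\<psi>' \<in> nonprincipal_characters q" using d' by (simp add: nonprincipal_characters_def)
    have "(\<lambda>n. \<psi>' (Suc n) / of_nat (Suc n)) sums 0"
      using sums_cnj[THEN iffD2, OF sums] by (simp add: \<psi>'_def del: of_nat_Suc)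
    moreover have "(\<lambda>n. \<psi>' (Suc n) / of_nat (Suc n)) sums dirichlet_L 1 \<psi>'"
      using nonprincipal_L_sums[OF q \<psi>', of 1] by simp
    ultimately have zero': "dirichlet_L 1 \<psi>' = 0" using sums_unique2 by blast
    have quot: "\<exists>l. ((\<lambda>s. dirichlet_L (of_real s) \<eta> / of_real (s - 1)) \<longlongrightarrow> l) (at_right (1::real))"
      if \<eta>: "\<eta> \<in> nonprincipal_characters q" and z: "dirichlet_L 1 \<eta> = 0" for \<eta>
    proof -
      have "(\<lambda>s. dirichlet_L s \<eta>) field_differentiable at 1"
        by (rule holomorphic_on_imp_differentiable_at[OF nonprincipal_L_holomorphic[OF q \<eta>]])
           (auto intro: open_halfspace_Re_gt)
      then obtain l where "((\<lambda>s. dirichlet_L s \<eta>) has_field_derivative l) (at 1)"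
        by (auto simp: field_differentiable_def)
      hence *: "((\<lambda>s. dirichlet_L s \<eta> / (s - 1)) \<longlongrightarrow> l) (at 1)"
        using z by (simp add: has_field_derivative_iff)
      have "filterlim (\<lambda>s::real. of_real s :: complex) (at 1) (at_right 1)"
        by (rule filterlim_atI) (auto intro!: tendsto_eq_intros eventually_at_rightI[of 1 2])
      from filterlim_compose[OF * this] show ?thesis by auto
    qed
    obtain l l' where l: "((\<lambda>s. dirichlet_L (of_real s) \<psi> / of_real (s - 1)) \<longlongrightarrow> l) (at_right (1::real))"
      "((\<lambda>s. dirichlet_L (of_real s) \<psi>' / of_real (s - 1)) \<longlongrightarrow> l') (at_right (1::real))"
      using quot[OF \<psi> zero] quot[OF \<psi>' zero'] by blast
    define D where "D = {\<psi>. dirichlet_character q \<psi>}"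
    define R where "R = D - {principal_character q} - {\<psi>} - {\<psi>'}"
    have fin: "finite D" unfolding D_def by (rule finite_dirichlet_characters[OF q])
    have prod: "(\<Prod>\<eta>\<in>D. f \<eta>) = f (principal_character q) * (f \<psi> * (f \<psi>' * (\<Prod>\<eta>\<in>R. f \<eta>)))" for f :: "_ \<Rightarrow> complex"
      unfolding R_def using fin d d' \<psi>' False dirichlet_character_principal[of q]
      by (subst prod.remove[of D "principal_character q"], simp, simp add: D_def,
          subst prod.remove[of "D - {principal_character q}" "\<psi>"], simp, simp add: D_def,
          subst prod.remove[of "D - {principal_character q} - {\<psi>}" "\<psi>'"])
         (auto simp: D_def nonprincipal_characters_def)
    \<comment> \<open>One factor \<open>s - 1\<close> cancels the pole and two factors \<open>1/(s - 1)\<close> the zeros; one \<open>s - 1\<close> is left over.\<close>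
    have "((\<lambda>s. of_real (s - 1) * ((of_real (s - 1) * dirichlet_L (of_real s) (principal_character q)) *
             ((dirichlet_L (of_real s) \<psi> / of_real (s - 1)) * ((dirichlet_L (of_real s) \<psi>' / of_real (s - 1)) *
               (\<Prod>\<eta>\<in>R. dirichlet_L (of_real s) \<eta>))))) \<longlongrightarrow>
            of_real (1 - 1) * ((of_nat (totient q) / of_nat q) * (l * (l' * (\<Prod>\<eta>\<in>R. dirichlet_L 1 \<eta>))))) (at_right (1::real))"
      by (intro tendsto_intros principal_L_residue q l
            tendsto_of_real_at_right_1[OF nonprincipal_L_holomorphic[OF q]])
         (auto simp: R_def D_def nonprincipal_characters_def)
    moreover have "eventually (\<lambda>s. of_real (s - 1) * ((of_real (s - 1) * dirichlet_L (of_real s) (principal_character q)) *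
             ((dirichlet_L (of_real s) \<psi> / of_real (s - 1)) * ((dirichlet_L (of_real s) \<psi>' / of_real (s - 1)) *
               (\<Prod>\<eta>\<in>R. dirichlet_L (of_real s) \<eta>)))) = (\<Prod>\<eta>\<in>D. dirichlet_L (of_real s) \<eta>)) (at_right (1::real))"
    proof (rule eventually_at_rightI[of 1 2])
      fix s :: real assume s: "s \<in> {1<..<2}"
      have *: "y * ((y * u) * ((v / y) * ((w / y) * r))) = u * (v * (w * r))" if "y \<noteq> 0" for y u v w r :: complex
        using that by (simp add: field_simps)
      show "of_real (s - 1) * ((of_real (s - 1) * dirichlet_L (of_real s) (principal_character q)) *
             ((dirichlet_L (of_real s) \<psi> / of_real (s - 1)) * ((dirichlet_L (of_real s) \<psi>' / of_real (s - 1)) *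
               (\<Prod>\<eta>\<in>R. dirichlet_L (of_real s) \<eta>)))) = (\<Prod>\<eta>\<in>D. dirichlet_L (of_real s) \<eta>)"
        unfolding prod by (rule *) (use s in \<open>simp del: of_real_diff\<close>)
    qed auto
    ultimately have "((\<lambda>s. \<Prod>\<eta>\<in>D. dirichlet_L (of_real s) \<eta>) \<longlongrightarrow> 0) (at_right (1::real))"
      by (auto dest: Lim_transform_eventually)
    hence "((\<lambda>s. norm (\<Prod>\<eta>\<in>D. dirichlet_L (of_real s) \<eta>)) \<longlongrightarrow> 0) (at_right (1::real))"
      by (rule tendsto_norm_zero)
    moreover have "eventually (\<lambda>s. norm (\<Prod>\<eta>\<in>D. dirichlet_L (of_real s) \<eta>) \<ge> 1) (at_right (1::real))"
      by (rule eventually_at_rightI[of 1 2]) (use prod_norm_L_ge_1[OF q] in \<open>auto simp: D_def prod_norm\<close>)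
    ultimately have "(1::real) \<le> 0" by (rule tendsto_lowerbound) simp
    thus False by simp
  qed
qed

section \<open>The branch of the logarithm\<close>

text \<open>
  The difference is continuous with values in the discrete set \<open>2 \<pi> i \<int>\<close>.
\<close>
lemma continuous_logarithms_differ_by_constant:
  fixes u v :: "real \<Rightarrow> complex"
  assumes S: "connected S" and u: "continuous_on S u" and v: "continuous_on S v"
    and eq: "\<And>x. x \<in> S \<Longrightarrow> exp (u x) = exp (v x)"
  obtains c where "\<And>x. x \<in> S \<Longrightarrow> u x = v x + c"
proof -
  have "(\<lambda>x. u x - v x) constant_on S"
  proof (rule continuous_discrete_range_constant[OF S])
    show "continuous_on S (\<lambda>x. u x - v x)" by (intro continuous_intros u v)
    fix x assume x: "x \<in> S"
    show "\<exists>e>0. \<forall>y. y \<in> S \<and> u y - v y \<noteq> u x - v x \<longrightarrow> e \<le> norm (u y - v y - (u x - v x))"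
    proof (intro exI[of _ "2 * pi"] conjI allI impI)
      fix y assume y: "y \<in> S \<and> u y - v y \<noteq> u x - v x"
      define w where "w = u y - v y - (u x - v x)"
      have "exp w = 1" using eq[OF x] eq[of y] y by (simp add: w_def exp_diff)
      then obtain n :: int where n: "Re w = 0" "Im w = of_int (2 * n) * pi"
        unfolding exp_eq_1 by blast
      have "w \<noteq> 0" using y by (simp add: w_def)
      hence "n \<noteq> 0" using n by (auto simp: complex_eq_iff)
      hence "1 \<le> \<bar>real_of_int n\<bar>" by linarith
      hence "2 * pi \<le> \<bar>Im w\<bar>" using n by (simp add: abs_mult)
      thus "2 * pi \<le> norm (u y - v y - (u x - v x))"
        using abs_Im_le_cmod[of w] unfolding w_def by linarith
    qed simp
  qed
  then obtain c where "\<And>x. x \<in> S \<Longrightarrow> u x - v x = c" unfolding constant_on_def by blast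
  thus thesis using that[of c] by (metis add.commute diff_add_cancel)
qed

text \<open>
  A constant difference of two branches vanishes because both tend to 0 at infinity.
\<close>
lemma log_L_branch_unique:
  assumes f: "log_L_branch \<psi> f" and h: "log_L_branch \<psi> h" and s: "s \<ge> 1"
  shows "f s = h s"
proof -
  obtain c where c: "\<And>x. x \<in> {1..} \<Longrightarrow> f x = h x + c"
    by (rule continuous_logarithms_differ_by_constant[of "{1..}" f h])
       (use f h in \<open>auto simp: log_L_branch_def\<close>)
  have "((\<lambda>x. f x - h x) \<longlongrightarrow> 0 - 0) at_top"
    using f h unfolding log_L_branch_def by (intro tendsto_diff) auto
  moreover have "eventually (\<lambda>x. f x - h x = c) at_top"
    using eventually_ge_at_top[of 1] by eventually_elim (use c in auto)
  ultimately have "((\<lambda>_::real. c) \<longlongrightarrow> 0 - 0) at_top" by (rule Lim_transform_eventually)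
  hence "c = 0" by (simp add: tendsto_const_iff)
  thus ?thesis using c s by simp
qed

text \<open>
  The nonvanishing of \<open>L\<close> on \<open>[1, \<infinity>)\<close> provides a continuous logarithm there.  On \<open>(1, \<infinity>)\<close> it
  differs from the logarithm of the Euler product by a constant, and removing this constant
  yields a branch normalised at infinity.  It is the only one, so its value at 1 is the one
  that enters \<open>log_L\<close>.
\<close>
lemma log_Euler_product_tendsto_log_L:
  assumes q: "q > 0" and \<psi>: "\<psi> \<in> nonprincipal_characters q"
  shows "((\<lambda>s. log_Euler_product s \<psi>) \<longlongrightarrow> log_L 1 \<psi>) (at_right 1)"
proof -
  have d: "dirichlet_character q \<psi>" using \<psi> by (simp add: nonprincipal_characters_def)
  define L where "L = (\<lambda>s::real. dirichlet_L (of_real s) \<psi>)"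
  have "continuous_on {s. Re s > 0} (\<lambda>s. dirichlet_L s \<psi>)"
    by (rule holomorphic_on_imp_continuous_on[OF nonprincipal_L_holomorphic[OF q \<psi>]])
  hence "continuous_on ((of_real :: real \<Rightarrow> complex) ` {1..}) (\<lambda>s. dirichlet_L s \<psi>)"
    by (rule continuous_on_subset) auto
  hence contL: "continuous_on {1..} L"
    unfolding L_def by (rule continuous_on_compose2[OF _ continuous_on_of_real[OF continuous_on_id]]) auto
  have nz: "L s \<noteq> 0" if "s \<in> {1..}" for s
  proof (cases "s = 1")
    case True
    thus ?thesis using dirichlet_L_1_nonzero[OF q \<psi>] by (simp add: L_def)
  next
    case False
    hence "exp (log_Euler_product s \<psi>) = L s"
      unfolding L_def using that by (intro exp_log_Euler_product_dirichlet[OF d q]) auto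
    thus ?thesis by (metis exp_not_eq_zero)
  qed
  have contr: "contractible {1::real..}" by (intro convex_imp_contractible convex_real_interval)
  obtain f where f: "continuous_on {1..} f" "\<And>s. s \<in> {1..} \<Longrightarrow> L s = exp (f s)"
    by (rule continuous_logarithm_on_contractible[OF contL contr nz]) (assumption, rule that)
  obtain c where c: "\<And>s. s \<in> {1<..} \<Longrightarrow> f s = log_Euler_product s \<psi> + c"
  proof (rule continuous_logarithms_differ_by_constant[of "{1<..}" f "\<lambda>s. log_Euler_product s \<psi>"])
    show "continuous_on {1<..} f" by (rule continuous_on_subset[OF f(1)]) auto
    show "continuous_on {1<..} (\<lambda>s. log_Euler_product s \<psi>)" by (rule continuous_on_log_Euler_product[OF d q])
    fix s :: real assume "s \<in> {1<..}"
    thus "exp (f s) = exp (log_Euler_product s \<psi>)"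
      using f(2)[of s] exp_log_Euler_product_dirichlet[OF d q, of s] by (simp add: L_def)
  qed auto
  have expc: "exp c = 1"
  proof -
    have "exp (f 2) = exp (log_Euler_product 2 \<psi>) * exp c" using c[of 2] by (simp add: exp_add)
    moreover have "exp (f 2) = exp (log_Euler_product 2 \<psi>)"
      using f(2)[of 2] exp_log_Euler_product_dirichlet[OF d q, of 2] by (simp add: L_def)
    ultimately show ?thesis by simp
  qed
  \<comment> \<open>Subtracting \<open>c\<close> normalises the logarithm at infinity, and \<open>exp c = 1\<close> keeps it a logarithm of \<open>L\<close>.\<close>
  define h where "h = (\<lambda>s. f s - c)"
  have branch: "log_L_branch \<psi> h"
    unfolding log_L_branch_def
  proof (intro conjI allI impI)
    show "continuous_on {1..} h" unfolding h_def by (intro continuous_intros f)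
    show "exp (h s) = dirichlet_L (of_real s) \<psi>" if "s \<ge> 1" for s
      using f(2)[of s] that expc by (simp add: h_def exp_diff L_def)
    have "eventually (\<lambda>s. log_Euler_product s \<psi> = h s) at_top"
      using eventually_gt_at_top[of 1] by eventually_elim (use c in \<open>auto simp: h_def\<close>)
    from Lim_transform_eventually[OF log_Euler_product_tendsto_0[OF d q] this]
    show "(h \<longlongrightarrow> 0) at_top" .
  qed
  have "log_L 1 \<psi> = h 1"
    unfolding log_L_def
  proof (rule the_equality)
    show "\<exists>f. log_L_branch \<psi> f \<and> f 1 = h 1" using branch by blast
    fix z assume "\<exists>f. log_L_branch \<psi> f \<and> f 1 = z"
    then obtain f where "log_L_branch \<psi> f" "f 1 = z" by blast
    with log_L_branch_unique[OF this(1) branch, of 1] show "z = h 1" by simp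
  qed
  moreover have h1: "(h \<longlongrightarrow> h 1) (at_right 1)"
  proof -
    have "(h \<longlongrightarrow> h 1) (at 1 within {1..})"
      using branch by (auto simp: log_L_branch_def continuous_on_def)
    thus ?thesis by (rule tendsto_within_subset) auto
  qed
  moreover have "eventually (\<lambda>s. h s = log_Euler_product s \<psi>) (at_right 1)"
    by (rule eventually_at_rightI[of 1 2]) (use c in \<open>auto simp: h_def\<close>)
  ultimately show ?thesis using Lim_transform_eventually[OF h1] by simp
qed

text \<open>
  The principal character has real values, so both sides of the residue formula can be compared
  through the real logarithm.
\<close>
lemma log_Euler_product_principal:
  assumes q: "q > 0"
  obtains l :: "real \<Rightarrow> real" where
    "\<And>s. s > 1 \<Longrightarrow> log_Euler_product s (principal_character q) = of_real (l s)"
    "((\<lambda>s. l s + ln (s - 1)) \<longlongrightarrow> ln (real (totient q) / real q)) (at_right 1)"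
proof -
  define l where "l = (\<lambda>s. \<Sum>\<^sub>\<infinity>(p, k)\<in>prime_powers. (if coprime (p ^ k) q then 1 else 0) * real (p ^ k) powr - s / real k)"
  note d = dirichlet_character_principal[of q]
  have l: "log_Euler_product s (principal_character q) = of_real (l s)" if "s > 1" for s
    unfolding l_def case_prod_unfold
    by (rule has_sum_of_real_eq)
       (use has_sum_infsum[OF log_Euler_product_summable[OF d q that]] in
        \<open>simp add: log_Euler_product_def case_prod_unfold principal_character_def if_distrib[of of_real] cong: if_cong\<close>)
  have pos: "real (totient q) / real q > 0" using q by simp
  have "((\<lambda>s. Re (of_real (s - 1) * dirichlet_L (of_real s) (principal_character q))) \<longlongrightarrow>
           Re (of_nat (totient q) / of_nat q)) (at_right (1::real))"
    by (intro tendsto_Re principal_L_residue q)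
  also have "Re (of_nat (totient q) / of_nat q) = real (totient q) / real q" by (simp add: Re_divide_of_nat)
  finally have "((\<lambda>s. ln (Re (of_real (s - 1) * dirichlet_L (of_real s) (principal_character q)))) \<longlongrightarrow>
           ln (real (totient q) / real q)) (at_right (1::real))"
    using pos q by (intro tendsto_ln) auto
  moreover have "eventually (\<lambda>s. ln (Re (of_real (s - 1) * dirichlet_L (of_real s) (principal_character q))) =
           l s + ln (s - 1)) (at_right (1::real))"
  proof (rule eventually_at_rightI[of 1 2])
    fix s :: real assume s: "s \<in> {1<..<2}"
    have "dirichlet_L (of_real s) (principal_character q) = of_real (exp (l s))"
      using exp_log_Euler_product_dirichlet[OF d q, of s] l[of s] s by (simp add: exp_of_real)
    hence "Re (of_real (s - 1) * dirichlet_L (of_real s) (principal_character q)) = (s - 1) * exp (l s)"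
      by (simp flip: of_real_mult of_real_diff)
    thus "ln (Re (of_real (s - 1) * dirichlet_L (of_real s) (principal_character q))) = l s + ln (s - 1)"
      using s by (simp add: ln_mult)
  qed simp
  ultimately have "((\<lambda>s. l s + ln (s - 1)) \<longlongrightarrow> ln (real (totient q) / real q)) (at_right 1)"
    by (rule Lim_transform_eventually)
  thus thesis using l that by blast
qed

text \<open>
  The sum over prime powers is real, hence so is the limit of the part of
  \<open>\<Sum> cnj (\<psi> a) log L(s, \<psi>)\<close> that belongs to the nonprincipal characters.  This is why the
  right-hand side of the equation defining \<open>cal_L\<close> is a positive real number, so that \<open>cal_L\<close> is
  its \<open>\<phi>(q)\<close>-th root.
\<close>
lemma prime_power_sum_tendsto_ln_cal_L:
  assumes q: "q > 0" and a: "coprime a q"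
  shows "((\<lambda>s. (\<Sum>\<^sub>\<infinity>(p, k)\<in>{(p, k). (p, k) \<in> prime_powers \<and> [p ^ k = a] (mod q)}. real (p ^ k) powr - s / real k)
            + ln (s - 1) / real (totient q)) \<longlongrightarrow> ln (cal_L q a)) (at_right 1)"
proof -
  define T where "T = (\<lambda>s. \<Sum>\<^sub>\<infinity>(p, k)\<in>{(p, k). (p, k) \<in> prime_powers \<and> [p ^ k = a] (mod q)}. real (p ^ k) powr - s / real k)"
  define m where "m = totient q"
  have m: "m > 0" using q by (simp add: m_def)
  define N where "N = nonprincipal_characters q"
  obtain l where l: "\<And>s. s > 1 \<Longrightarrow> log_Euler_product s (principal_character q) = of_real (l s)"
    "((\<lambda>s. l s + ln (s - 1)) \<longlongrightarrow> ln (real (totient q) / real q)) (at_right 1)"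
    using log_Euler_product_principal[OF q] by blast
  note l = l[folded m_def]
  define W where "W = (\<Sum>\<psi>\<in>N. cnj (\<psi> a) * log_L 1 \<psi>)"
  have all: "{\<psi>. dirichlet_character q \<psi>} = insert (principal_character q) N"
    using dirichlet_character_principal by (auto simp: N_def nonprincipal_characters_def)
  have finN: "finite N"
    using finite_dirichlet_characters[OF q] by (simp add: all)
  have split: "of_real (real m * T s - l s) = (\<Sum>\<psi>\<in>N. cnj (\<psi> a) * log_Euler_product s \<psi>)" if s: "s > 1" for s
  proof -
    have "of_real (real m * T s) = (\<Sum>\<psi>\<in>insert (principal_character q) N. cnj (\<psi> a) * log_Euler_product s \<psi>)"
      unfolding T_def m_def using sum_characters_log_Euler_product[OF q a s] by (simp only: all)
    also have "\<dots> = cnj (principal_character q a) * log_Euler_product s (principal_character q) + (\<Sum>\<psi>\<in>N. cnj (\<psi> a) * log_Euler_product s \<psi>)"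
      by (rule sum.insert[OF finN]) (simp add: N_def nonprincipal_characters_def)
    also have "cnj (principal_character q a) = 1" using a by (simp add: principal_character_def)
    finally show ?thesis using l(1)[OF s] by simp
  qed
  have "((\<lambda>s. \<Sum>\<psi>\<in>N. cnj (\<psi> a) * log_Euler_product s \<psi>) \<longlongrightarrow> W) (at_right 1)"
    unfolding W_def by (intro tendsto_intros log_Euler_product_tendsto_log_L[OF q]) (simp add: N_def)
  hence lim: "((\<lambda>s. complex_of_real (real m * T s - l s)) \<longlongrightarrow> W) (at_right 1)"
    by (rule Lim_transform_eventually) (rule eventually_at_rightI[of 1 2], simp_all add: split[symmetric] del: of_real_diff of_real_mult)
  have "Im W = 0"
    using tendsto_Im[OF lim] by (simp add: tendsto_const_iff)
  define w where "w = Re W"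
  have w: "W = of_real w" using \<open>Im W = 0\<close> by (simp add: w_def complex_eq_iff)
  have "((\<lambda>s. real m * T s - l s) \<longlongrightarrow> w) (at_right 1)"
    using tendsto_Re[OF lim] w by simp
  hence "((\<lambda>s. ((real m * T s - l s) + (l s + ln (s - 1))) / real m) \<longlongrightarrow> (w + ln (real m / real q)) / real m) (at_right 1)"
    using m by (intro tendsto_intros l(2)) auto
  moreover have "((real m * T s - l s) + (l s + ln (s - 1))) / real m = T s + ln (s - 1) / real m" for s
    using m by (simp add: field_simps)
  ultimately have T: "((\<lambda>s. T s + ln (s - 1) / real m) \<longlongrightarrow> (w + ln (real m / real q)) / real m) (at_right 1)"
    by simp
  define r where "r = exp ((w + ln (real m / real q)) / real m)"
  have prod: "(\<Prod>\<psi>\<in>N. L_power 1 \<psi> (cnj (\<psi> a))) = of_real (exp w)"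
    unfolding L_power_def using w by (simp add: W_def exp_sum[OF finN, symmetric] exp_of_real)
  have rm: "r ^ m = real m / real q * exp w"
  proof -
    have "r ^ m = exp (real m * ((w + ln (real m / real q)) / real m))"
      unfolding r_def by (rule exp_of_nat_mult[symmetric])
    also have "real m * ((w + ln (real m / real q)) / real m) = w + ln (real m / real q)" using m by simp
    finally show ?thesis using m q by (simp add: exp_add)
  qed
  have "cal_L q a = r"
    unfolding cal_L_def
  proof (rule the_equality)
    show "r > 0 \<and> complex_of_real (r ^ totient q) = of_nat (totient q) / of_nat q *
             (\<Prod>\<psi>\<in>nonprincipal_characters q. L_power 1 \<psi> (cnj (\<psi> a)))"
      using rm prod by (simp add: r_def N_def m_def)
    fix r' assume r': "r' > 0 \<and> complex_of_real (r' ^ totient q) = of_nat (totient q) / of_nat q *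
             (\<Prod>\<psi>\<in>nonprincipal_characters q. L_power 1 \<psi> (cnj (\<psi> a)))"
    hence "complex_of_real (r' ^ m) = of_real (r ^ m)"
      unfolding rm using prod by (simp add: N_def m_def)
    hence "r' ^ m = r ^ m" by (simp only: of_real_eq_iff)
    thus "r' = r" using r' m by (intro power_eq_imp_eq_base[of r' m r]) (auto simp: r_def)
  qed
  thus ?thesis using T unfolding T_def m_def r_def by simp
qed

section \<open>Mertens theorem in arithmetic progressions\<close>

lemma powr_minus_one_plus:
  fixes x d :: real
  assumes "x > 0"
  shows "x powr - (1 + d) = 1 / x * exp (- d * ln x)"
proof -
  have "x powr - (1 + d) = exp (- ln x + - d * ln x)"
    using assms by (simp add: powr_def algebra_simps)
  also have "\<dots> = 1 / x * exp (- d * ln x)"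
    unfolding exp_add using assms by (simp add: exp_minus inverse_eq_divide)
  finally show ?thesis .
qed

lemma higher_prime_powers_summable:
  "(\<lambda>(p::nat, k::nat). 1 / real p ^ k) summable_on {(p, k). prime p \<and> k \<ge> 2}"
proof -
  have "(\<lambda>(p::nat, k::nat). 1 / real p ^ k) summable_on (SIGMA p:{2..}. {2..})"
  proof (rule summable_on_SigmaI[where g = "\<lambda>p. (1 / real p) ^ 2 / (1 - 1 / real p)"])
    fix p :: nat assume p: "p \<in> {2..}"
    define z where "z = 1 / real p"
    have z: "0 < z" "z < 1" using p by (auto simp: z_def)
    have "(\<lambda>n. z ^ 2 * z ^ n) sums (z ^ 2 * (1 / (1 - z)))"
      by (intro sums_mult geometric_sums) (use z in auto)
    hence "(\<lambda>n. z ^ (n + 2)) sums (z ^ 2 / (1 - z))" by (simp add: power_add mult.commute del: add_2_eq_Suc')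
    hence "((\<lambda>n. z ^ (n + 2)) has_sum (z ^ 2 / (1 - z))) UNIV"
      using z by (intro sums_nonneg_imp_has_sum) auto
    moreover have "bij_betw (\<lambda>n::nat. n + 2) UNIV {2..}"
      by (rule bij_betwI[where g = "\<lambda>n. n - 2"]) auto
    ultimately have "((\<lambda>k. z ^ k) has_sum (z ^ 2 / (1 - z))) {2..}"
      by (subst has_sum_reindex_bij_betw[of "\<lambda>n. n + 2" UNIV, symmetric]) auto
    thus "((\<lambda>y. case (p, y) of (p, k) \<Rightarrow> 1 / real p ^ k) has_sum (1 / real p) ^ 2 / (1 - 1 / real p)) {2..}"
      by (simp add: z_def power_one_over)
  next
    show "(\<lambda>p. (1 / real p) ^ 2 / (1 - 1 / real p)) summable_on {2..}"
    proof (rule summable_on_comparison_test)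
      have "(\<lambda>p::nat. 2 * real p powr - 2) summable_on {2..}"
        by (intro summable_on_cmult_right summable_on_subset_banach[OF summable_on_powr_minus]) auto
      thus "(\<lambda>p::nat. 2 * real p powr - 2) summable_on {2..}" .
      fix p :: nat assume p: "p \<in> {2..}"
      define z where "z = 1 / real p"
      have z: "0 < z" "z \<le> 1 / 2" using p by (auto simp: z_def field_simps)
      have "z ^ 2 / (1 - z) \<le> z ^ 2 / (1 / 2)" using z by (intro divide_left_mono) auto
      also have "\<dots> = 2 * real p powr - 2"
        using p by (simp add: z_def powr_minus power_one_over inverse_eq_divide)
      finally show "(1 / real p) ^ 2 / (1 - 1 / real p) \<le> 2 * real p powr - 2" unfolding z_def .
      show "0 \<le> (1 / real p) ^ 2 / (1 - 1 / real p)" using z by (simp add: z_def)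
    qed
  qed auto
  thus ?thesis
    by (rule summable_on_subset_banach) (auto simp: prime_ge_2_nat)
qed

text \<open>
  The powers \<open>p\<^sup>\<nu>\<close> with \<open>\<nu> \<ge> 2\<close> form a series that converges uniformly up to \<open>s = 1\<close>, so they can
  be split off in the limit; moreover \<open>log(s - 1)\<close> and \<open>log(1 - e\<^sup>1\<^sup>-\<^sup>s)\<close> differ by \<open>o(1)\<close>.
\<close>
theorem Mertens_arithmetic_progression_Abel:
  assumes q: "q > 0" and a: "coprime a q"
  shows "((\<lambda>d. (\<Sum>\<^sub>\<infinity>p\<in>{p. prime p \<and> [p = a] (mod q)}. 1 / real p * exp (- d * ln (real p)))
            + 1 / real (totient q) * ln (1 - exp (- d))) \<longlongrightarrow>
          ln (cal_L q a) - (\<Sum>\<^sub>\<infinity>(p, \<nu>)\<in>{(p :: nat, \<nu> :: nat). prime p \<and> \<nu> \<ge> 2 \<and> [p ^ \<nu> = a] (mod q)}.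
        1 / (real \<nu> * real p ^ \<nu>))) (at_right 0)"
proof -
  define H where "H = {(p :: nat, \<nu> :: nat). prime p \<and> \<nu> \<ge> 2 \<and> [p ^ \<nu> = a] (mod q)}"
  define T where "T = (\<lambda>s. \<Sum>\<^sub>\<infinity>(p, k)\<in>{(p, k). (p, k) \<in> prime_powers \<and> [p ^ k = a] (mod q)}. real (p ^ k) powr - s / real k)"
  define P where "P = {p. prime p \<and> [p = a] (mod q)}"
  define R where "R = (\<lambda>s. \<Sum>\<^sub>\<infinity>(p, k)\<in>H. real (p ^ k) powr - s / real k)"
  define m where "m = real (totient q)"
  have split: "T (1 + d) = (\<Sum>\<^sub>\<infinity>p\<in>P. 1 / real p * exp (- d * ln (real p))) + R (1 + d)" if d: "d > 0" for d :: real
  proof -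
    have "(\<lambda>(p, k). real (p ^ k) powr - (1 + d)) summable_on prime_powers"
      using d by (intro prime_powers_summable summable_on_powr_minus) auto
    hence s: "(\<lambda>(p, k). real (p ^ k) powr - (1 + d) / real k) summable_on prime_powers"
    proof (rule summable_on_norm_comparison)
      fix x assume "x \<in> prime_powers"
      then obtain p k where x: "x = (p, k)" "k \<ge> 1" by (auto simp: prime_powers_def)
      show "norm (case x of (p, k) \<Rightarrow> real (p ^ k) powr - (1 + d) / real k) \<le> (case x of (p, k) \<Rightarrow> real (p ^ k) powr - (1 + d))"
        using x divide_left_mono[of 1 "real k" "real (p ^ k) powr - (1 + d)"] by (simp del: of_nat_power)
    qed
    have eq: "{(p, k). (p, k) \<in> prime_powers \<and> [p ^ k = a] (mod q)} = (\<lambda>p. (p, 1)) ` P \<union> H"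
      by (auto simp: prime_powers_def P_def H_def image_iff) (metis Suc_leI le_neq_implies_less numeral_2_eq_2 power_one_right One_nat_def)
    have "T (1 + d) = infsum (\<lambda>(p, k). real (p ^ k) powr - (1 + d) / real k) ((\<lambda>p. (p, 1)) ` P) + R (1 + d)"
      unfolding T_def R_def eq
      by (rule infsum_Un_disjoint; (rule summable_on_subset_banach[OF s])?)
         (auto simp: prime_powers_def P_def H_def)
    also have "infsum (\<lambda>(p, k). real (p ^ k) powr - (1 + d) / real k) ((\<lambda>p. (p, 1)) ` P) = (\<Sum>\<^sub>\<infinity>p\<in>P. 1 / real p * exp (- d * ln (real p)))"
    proof (subst infsum_reindex)
      show "inj_on (\<lambda>p. (p, 1::nat)) P" by (auto simp: inj_on_def)
      show "infsum ((\<lambda>(p, k). real (p ^ k) powr - (1 + d) / real k) \<circ> (\<lambda>p. (p, 1))) P = (\<Sum>\<^sub>\<infinity>p\<in>P. 1 / real p * exp (- d * ln (real p)))"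
      proof (rule infsum_cong)
        fix p assume "p \<in> P"
        hence p: "real p > 0" by (auto simp: P_def prime_gt_0_nat)
        show "((\<lambda>(p, k). real (p ^ k) powr - (1 + d) / real k) \<circ> (\<lambda>p. (p, 1))) p = 1 / real p * exp (- d * ln (real p))"
          using powr_minus_one_plus[OF p, of d] by simp
      qed
    qed
    finally show ?thesis .
  qed
  have fl: "filterlim (\<lambda>d::real. 1 + d) (at_right 1) (at_right 0)" by real_asymp
  have R: "(R \<longlongrightarrow> (\<Sum>\<^sub>\<infinity>(p, k)\<in>H. 1 / (real k * real p ^ k))) (at_right 1)"
    unfolding R_def
  proof (rule infsum_dominated_convergence)
    show "(\<lambda>(p::nat, k::nat). 1 / real p ^ k) summable_on H"
      by (rule summable_on_subset_banach[OF higher_prime_powers_summable]) (auto simp: H_def)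
    have H: "real (p ^ k) \<ge> 1" "k \<ge> 1" "p > 0" if "(p, k) \<in> H" for p k
      using that prime_gt_0_nat[of p] by (auto simp: H_def Suc_le_eq)
    fix x assume "x \<in> H"
    then obtain p k where x: "x = (p, k)" "(p, k) \<in> H" by (cases x) auto
    have "((\<lambda>s. real (p ^ k) powr - s / real k) \<longlongrightarrow> real (p ^ k) powr - 1 / real k) (at_right 1)"
      using H[OF x(2)] by (intro tendsto_divide tendsto_powr tendsto_const tendsto_minus tendsto_ident_at) auto
    also have "real (p ^ k) powr - 1 / real k = 1 / (real k * real p ^ k)"
      using H[OF x(2)] by (simp add: powr_minus divide_simps)
    finally show "((\<lambda>s. case x of (p, k) \<Rightarrow> real (p ^ k) powr - s / real k) \<longlongrightarrow> (case x of (p, k) \<Rightarrow> 1 / (real k * real p ^ k))) (at_right 1)"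
      by (simp add: x)
  next
    show "eventually (\<lambda>s. \<forall>x\<in>H. norm (case x of (p, k) \<Rightarrow> real (p ^ k) powr - s / real k) \<le> (case x of (p, k) \<Rightarrow> 1 / real p ^ k)) (at_right 1)"
    proof (rule eventually_at_rightI[of 1 2], intro ballI)
      fix s :: real and x assume s: "s \<in> {1<..<2}" and "x \<in> H"
      then obtain p k where x: "x = (p, k)" "prime p" "k \<ge> 1" by (auto simp: H_def)
      have n: "real (p ^ k) \<ge> 1" using x prime_gt_0_nat[of p] by (simp add: Suc_le_eq)
      have "real (p ^ k) powr - s / real k \<le> real (p ^ k) powr - s / 1"
        using x by (intro divide_left_mono) auto
      also have "real (p ^ k) powr - s / 1 \<le> real (p ^ k) powr - 1"
        unfolding div_by_1 by (rule powr_mono) (use n s in auto)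
      also have "\<dots> = 1 / real p ^ k" using n by (simp add: powr_minus inverse_eq_divide)
      finally show "norm (case x of (p, k) \<Rightarrow> real (p ^ k) powr - s / real k) \<le> (case x of (p, k) \<Rightarrow> 1 / real p ^ k)"
        by (simp add: x)
    qed simp
  qed simp
  have lim: "((\<lambda>d. (T (1 + d) + ln ((1 + d) - 1) / m) - R (1 + d) + 1 / m * ln ((1 - exp (-d)) / d)) \<longlongrightarrow>
           ln (cal_L q a) - (\<Sum>\<^sub>\<infinity>(p, k)\<in>H. 1 / (real k * real p ^ k)) + 1 / m * 0) (at_right 0)"
  proof (intro tendsto_intros)
    show "((\<lambda>d. T (1 + d) + ln ((1 + d) - 1) / m) \<longlongrightarrow> ln (cal_L q a)) (at_right 0)"
      using filterlim_compose[OF prime_power_sum_tendsto_ln_cal_L[OF q a] fl] unfolding T_def m_def by simp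
    show "((\<lambda>d. R (1 + d)) \<longlongrightarrow> (\<Sum>\<^sub>\<infinity>(p, k)\<in>H. 1 / (real k * real p ^ k))) (at_right 0)"
      by (rule filterlim_compose[OF R fl])
    show "((\<lambda>d::real. ln ((1 - exp (-d)) / d)) \<longlongrightarrow> 0) (at_right 0)" by real_asymp
  qed
  have "eventually (\<lambda>d. (T (1 + d) + ln ((1 + d) - 1) / m) - R (1 + d) + 1 / m * ln ((1 - exp (-d)) / d) =
      (\<Sum>\<^sub>\<infinity>p\<in>P. 1 / real p * exp (- d * ln (real p))) + 1 / m * ln (1 - exp (- d))) (at_right 0)"
  proof (rule eventually_at_rightI[of 0 1])
    fix d :: real assume "d \<in> {0<..<1}"
    hence d: "d > 0" by simp
    have L: "ln ((1 - exp (-d)) / d) = ln (1 - exp (-d)) - ln d" using d by (simp add: ln_div)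
    show "(T (1 + d) + ln ((1 + d) - 1) / m) - R (1 + d) + 1 / m * ln ((1 - exp (-d)) / d) =
      (\<Sum>\<^sub>\<infinity>p\<in>P. 1 / real p * exp (- d * ln (real p))) + 1 / m * ln (1 - exp (- d))"
      unfolding split[OF d] L by (simp add: right_diff_distrib)
  qed simp
  from Lim_transform_eventually[OF lim this] show ?thesis
    unfolding P_def H_def m_def by simp
qed

lemma finite_primes_le: "finite {p. prime p \<and> real p \<le> x \<and> [p = a] (mod q)}"
  by (rule finite_subset[of _ "{..nat \<lfloor>x\<rfloor>}"]) (auto simp: le_nat_floor)

text \<open>
  The Tauberian theorem is applied with the weights \<open>1/p\<close> at \<open>ln p\<close>.  It gives the asymptotics
  of the prime sum in terms of the harmonic number at \<open>\<lfloor>ln x\<rfloor>\<close>, which is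
  \<open>ln (ln x) + \<gamma> + o(1)\<close>.
\<close>
theorem Mertens_arithmetic_progression:
  assumes q: "q > 0" and a: "coprime a q"
  shows "((\<lambda>x. (\<Sum>p | prime p \<and> real p \<le> x \<and> [p = a] (mod q). 1 / real p) - ln (ln x) / real (totient q))
            \<longlongrightarrow> g q a) at_top"
proof -
  define P where "P = {p. prime p \<and> [p = a] (mod q)}"
  define m where "m = real (totient q)"
  define S where "S = (\<lambda>x::real. \<Sum>p | prime p \<and> real p \<le> x \<and> [p = a] (mod q). 1 / real p)"
  define l where "l = ln (cal_L q a) - (\<Sum>\<^sub>\<infinity>(p, \<nu>)\<in>{(p :: nat, \<nu> :: nat). prime p \<and> \<nu> \<ge> 2 \<and> [p ^ \<nu> = a] (mod q)}.
        1 / (real \<nu> * real p ^ \<nu>))"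
  have "((\<lambda>y. (\<Sum>\<^sub>\<infinity>p\<in>{p\<in>P. ln (real p) \<le> y}. 1 / real p) - 1 / m * harm (nat \<lfloor>y\<rfloor>)) \<longlongrightarrow> l) at_top"
  proof (rule Karamata_Tauberian_harmonic)
    show "ln (real p) > 0" if "p \<in> P" for p
      using that prime_gt_1_nat[of p] by (simp add: P_def)
    fix d :: real assume d: "d > 0"
    have "(\<lambda>n::nat. real n powr - (1 + d)) summable_on P"
      by (rule summable_on_subset_banach[OF summable_on_powr_minus]) (use d in \<open>auto simp: P_def Suc_le_eq prime_gt_0_nat\<close>)
    also have "?this \<longleftrightarrow> (\<lambda>p. 1 / real p * exp (- d * ln (real p))) summable_on P"
    proof (rule summable_on_cong)
      fix p assume "p \<in> P"
      hence p: "real p > 0" by (auto simp: P_def prime_gt_0_nat)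
      thus "real p powr - (1 + d) = 1 / real p * exp (- d * ln (real p))" by (rule powr_minus_one_plus)
    qed
    finally show "(\<lambda>p. 1 / real p * exp (- d * ln (real p))) summable_on P" .
  next
    show "((\<lambda>d. (\<Sum>\<^sub>\<infinity>p\<in>P. 1 / real p * exp (- d * ln (real p))) + 1 / m * ln (1 - exp (- d))) \<longlongrightarrow> l) (at_right 0)"
      using Mertens_arithmetic_progression_Abel[OF q a] unfolding P_def m_def l_def .
  qed (auto simp: m_def)
  from filterlim_compose[OF this ln_at_top]
  have 1: "((\<lambda>x. (\<Sum>\<^sub>\<infinity>p\<in>{p\<in>P. ln (real p) \<le> ln x}. 1 / real p) - 1 / m * harm (nat \<lfloor>ln x\<rfloor>)) \<longlongrightarrow> l) at_top" .
  have 0: "((\<lambda>x::real. (harm (nat \<lfloor>x\<rfloor>) - ln (real (nat \<lfloor>x\<rfloor>))) + (ln (of_int \<lfloor>x\<rfloor>) - ln x)) \<longlongrightarrow> euler_mascheroni + 0) at_top"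
  proof (intro tendsto_add)
    have "filterlim (\<lambda>x::real. nat \<lfloor>x\<rfloor>) at_top at_top"
      by (intro filterlim_compose[OF filterlim_nat_sequentially filterlim_floor_sequentially])
    from filterlim_compose[OF euler_mascheroni_LIMSEQ this]
    show "((\<lambda>x::real. harm (nat \<lfloor>x\<rfloor>) - ln (real (nat \<lfloor>x\<rfloor>))) \<longlongrightarrow> (euler_mascheroni :: real)) at_top" .
    show "((\<lambda>x::real. ln (of_int \<lfloor>x\<rfloor>) - ln x) \<longlongrightarrow> 0) at_top" by real_asymp
  qed
  have "eventually (\<lambda>x::real. (harm (nat \<lfloor>x\<rfloor>) - ln (real (nat \<lfloor>x\<rfloor>))) + (ln (of_int \<lfloor>x\<rfloor>) - ln x) = harm (nat \<lfloor>x\<rfloor>) - ln x) at_top"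
    using eventually_gt_at_top[of 1] by eventually_elim simp
  from Lim_transform_eventually[OF 0 this]
  have "((\<lambda>x::real. harm (nat \<lfloor>x\<rfloor>) - ln x) \<longlongrightarrow> euler_mascheroni) at_top" by simp
  from filterlim_compose[OF this ln_at_top]
  have 2: "((\<lambda>x::real. harm (nat \<lfloor>ln x\<rfloor>) - ln (ln x)) \<longlongrightarrow> euler_mascheroni) at_top" .
  have 3: "((\<lambda>x. ((\<Sum>\<^sub>\<infinity>p\<in>{p\<in>P. ln (real p) \<le> ln x}. 1 / real p) - 1 / m * harm (nat \<lfloor>ln x\<rfloor>)) +
          1 / m * (harm (nat \<lfloor>ln x\<rfloor>) - ln (ln x))) \<longlongrightarrow> l + 1 / m * euler_mascheroni) at_top"
    by (intro tendsto_intros 1 2)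
  have "eventually (\<lambda>x. ((\<Sum>\<^sub>\<infinity>p\<in>{p\<in>P. ln (real p) \<le> ln x}. 1 / real p) - 1 / m * harm (nat \<lfloor>ln x\<rfloor>)) +
          1 / m * (harm (nat \<lfloor>ln x\<rfloor>) - ln (ln x)) = S x - ln (ln x) / m) at_top"
    using eventually_gt_at_top[of 0]
  proof eventually_elim
    case (elim x)
    have "{p\<in>P. ln (real p) \<le> ln x} = {p. prime p \<and> real p \<le> x \<and> [p = a] (mod q)}"
      using elim by (auto simp: P_def prime_gt_0_nat)
    hence "(\<Sum>\<^sub>\<infinity>p\<in>{p\<in>P. ln (real p) \<le> ln x}. 1 / real p) = S x"
      using finite_primes_le by (simp add: S_def)
    thus ?case by (simp add: algebra_simps)
  qed
  from Lim_transform_eventually[OF 3 this]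
  show ?thesis unfolding S_def l_def m_def g_def by (simp add: algebra_simps)
qed

section \<open>Partial summation and the error term\<close>

text \<open>
  The gauge integral over an unbounded set is defined as a limit over large boxes, so a
  conditionally convergent improper integral exists.
\<close>
lemma has_integral_improper_at_top:
  fixes f F :: "real \<Rightarrow> real"
  assumes F: "\<And>y. y \<ge> a \<Longrightarrow> (f has_integral F y) {a..y}" and lim: "(F \<longlongrightarrow> l) at_top"
  shows "(f has_integral l) {a..}"
  unfolding has_integral_alt'[of f l "{a..}"]
proof (intro conjI allI impI)
  have Int: "{a..} \<inter> cbox c d = {max a c..d}" for c d :: real by auto
  fix c d :: real
  have "f integrable_on {a..max a d}" using F[of "max a d"] by (auto simp: integrable_on_def)
  hence "f integrable_on {max a c..d}"
    by (rule integrable_on_subinterval) auto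
  thus "(\<lambda>x. if x \<in> {a..} then f x else 0) integrable_on cbox c d"
    by (subst integrable_restrict_Int) (simp add: Int)
next
  fix e :: real assume "e > 0"
  with tendstoD[OF lim] obtain Y where Y: "\<And>y. y \<ge> Y \<Longrightarrow> dist (F y) l < e"
    by (auto simp: eventually_at_top_linorder)
  define K where "K = max \<bar>Y\<bar> \<bar>a\<bar>"
  have K: "K \<ge> 0" "K \<ge> Y" "K \<ge> a" "K \<ge> - a" by (auto simp: K_def)
  show "\<exists>B>0. \<forall>c d. ball 0 B \<subseteq> cbox c d \<longrightarrow>
          norm (integral (cbox c d) (\<lambda>x. if x \<in> {a..} then f x else 0) - l) < e"
  proof (intro exI[of _ "K + 1"] conjI allI impI)
    fix c d :: real assume sub: "ball 0 (K + 1) \<subseteq> cbox c d"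
    have "K \<in> ball 0 (K + 1)" "- K \<in> ball 0 (K + 1)" using K by auto
    hence "K \<in> cbox c d" "- K \<in> cbox c d" using sub by blast+
    hence cd: "c \<le> a" "d \<ge> Y" "d \<ge> a" using K by auto
    have "integral (cbox c d) (\<lambda>x. if x \<in> {a..} then f x else 0) = integral ({a..} \<inter> cbox c d) f"
      by (rule integral_restrict_Int)
    also have "{a..} \<inter> cbox c d = {a..d}" using cd by auto
    also have "integral {a..d} f = F d" by (rule integral_unique[OF F[OF cd(3)]])
    finally show "norm (integral (cbox c d) (\<lambda>x. if x \<in> {a..} then f x else 0) - l) < e"
      using Y[OF cd(2)] by (simp add: dist_norm)
  qed (use K in auto)
qed

text \<open>
  The counting function is a sum of indicators of \<open>[p, \<infinity>)\<close>, and the integral of \<open>1/t\<^sup>2\<close>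
  over \<open>[p, x]\<close> is \<open>1/p - 1/x\<close>.
\<close>
lemma primes_pi_has_integral:
  assumes x: "x \<ge> 2"
  shows "((\<lambda>t. real (primes_pi t q a) / t ^ 2) has_integral
            (\<Sum>p | prime p \<and> real p \<le> x \<and> [p = a] (mod q). 1 / real p) - real (primes_pi x q a) / x) {2..x}"
proof -
  define A where "A = {p. prime p \<and> real p \<le> x \<and> [p = a] (mod q)}"
  have fin: "finite A" unfolding A_def by (rule finite_primes_le)
  have each: "((\<lambda>t. if t \<in> {real p..x} then 1 / t ^ 2 else 0) has_integral (1 / real p - 1 / x)) {2..x}"
    if p: "p \<in> A" for p
  proof -
    have p': "real p \<ge> 2" "real p \<le> x" using p prime_ge_2_nat[of p] by (auto simp: A_def)
    have "((\<lambda>t. 1 / t ^ 2) has_integral (- (1 / x) - - (1 / real p))) {real p..x}"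
    proof (rule fundamental_theorem_of_calculus)
      fix t assume "t \<in> {real p..x}"
      hence "t > 0" using p' by simp
      hence "((\<lambda>t. - (1 / t)) has_real_derivative 1 / t ^ 2) (at t within {real p..x})"
        by (auto intro!: derivative_eq_intros simp: power2_eq_square)
      thus "((\<lambda>t. - (1 / t)) has_vector_derivative 1 / t ^ 2) (at t within {real p..x})"
        by (simp add: has_real_derivative_iff_has_vector_derivative)
    qed (use p' in auto)
    hence "((\<lambda>t. 1 / t ^ 2) has_integral (1 / real p - 1 / x)) {real p..x}" by simp
    moreover have "{real p..x} \<subseteq> {2..x}" using p' by auto
    ultimately show ?thesis by (simp only: Henstock_Kurzweil_Integration.has_integral_restrict)
  qed
  have int: "((\<lambda>t. \<Sum>p\<in>A. if t \<in> {real p..x} then 1 / t ^ 2 else 0) has_integral (\<Sum>p\<in>A. 1 / real p - 1 / x)) {2..x}"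
    by (intro has_integral_sum fin each)
  have val: "(\<Sum>p\<in>A. 1 / real p - 1 / x) = (\<Sum>p\<in>A. 1 / real p) - real (primes_pi x q a) / x"
    by (simp add: sum_subtractf primes_pi_def A_def)
  have "(\<Sum>p\<in>A. if t \<in> {real p..x} then 1 / t ^ 2 else 0) = real (primes_pi t q a) / t ^ 2"
    if t: "t \<in> {2..x}" for t
  proof -
    have "A \<inter> {p. t \<in> {real p..x}} = {p. prime p \<and> real p \<le> t \<and> [p = a] (mod q)}"
      using t by (auto simp: A_def)
    thus ?thesis using fin by (simp add: sum.If_cases primes_pi_def)
  qed
  from has_integral_eq[OF this int] show ?thesis unfolding A_def[symmetric] val .
qed

lemma li_has_real_derivative:
  assumes "t \<in> {2..x}"
  shows "(li has_real_derivative 1 / ln t) (at t within {2..x})"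
  unfolding li_def using assms
  by (intro integral_has_real_derivative continuous_intros) auto

text \<open>
  Integration by parts: \<open>ln (ln t) - li t / t\<close> is an antiderivative.
\<close>
lemma li_has_integral:
  assumes x: "x \<ge> 2"
  shows "((\<lambda>t. li t / t ^ 2) has_integral (ln (ln x) - ln (ln 2) - li x / x)) {2..x}"
proof -
  have "((\<lambda>t. li t / t ^ 2) has_integral ((ln (ln x) - li x / x) - (ln (ln 2) - li 2 / 2))) {2..x}"
  proof (rule fundamental_theorem_of_calculus[OF x])
    fix t assume t: "t \<in> {2..x}"
    hence t0: "t > 0" "ln t > 0" by auto
    have "((\<lambda>t. ln (ln t) - li t / t) has_real_derivative
            1 / ln t * (1 / t) - ((1 / ln t) * t - li t * 1) / (t * t)) (at t within {2..x})"
      by (intro DERIV_diff DERIV_chain2[OF DERIV_ln_divide] DERIV_divide li_has_real_derivative t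
            has_field_derivative_at_within[OF DERIV_ln_divide] DERIV_ident) (use t0 in auto)
    moreover have "1 / ln t * (1 / t) - ((1 / ln t) * t - li t * 1) / (t * t) = li t / t ^ 2"
      using t0 by (simp add: field_simps power2_eq_square)
    ultimately have "((\<lambda>t. ln (ln t) - li t / t) has_real_derivative li t / t ^ 2) (at t within {2..x})" by simp
    thus "((\<lambda>t. ln (ln t) - li t / t) has_vector_derivative li t / t ^ 2) (at t within {2..x})"
      by (simp add: has_real_derivative_iff_has_vector_derivative)
  qed
  moreover have "li 2 = 0" by (simp add: li_def)
  ultimately show ?thesis by (simp add: algebra_simps)
qed

lemma prime_error_has_integral:
  assumes "x \<ge> 2"
  shows "((\<lambda>t. prime_error t q a / t ^ 2) has_integral
            ((\<Sum>p | prime p \<and> real p \<le> x \<and> [p = a] (mod q). 1 / real p) - ln (ln x) / real (totient q)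
              - prime_error x q a / x + ln (ln 2) / real (totient q))) {2..x}"
proof -
  have "((\<lambda>t. real (primes_pi t q a) / t ^ 2 - (1 / real (totient q)) * (li t / t ^ 2)) has_integral
     ((\<Sum>p | prime p \<and> real p \<le> x \<and> [p = a] (mod q). 1 / real p) - real (primes_pi x q a) / x -
       (1 / real (totient q)) * (ln (ln x) - ln (ln 2) - li x / x))) {2..x}"
    by (intro has_integral_diff has_integral_mult_right primes_pi_has_integral li_has_integral assms)
  also have "(\<lambda>t. real (primes_pi t q a) / t ^ 2 - (1 / real (totient q)) * (li t / t ^ 2)) = (\<lambda>t. prime_error t q a / t ^ 2)"
    by (simp add: prime_error_def diff_divide_distrib)
  also have "(\<Sum>p | prime p \<and> real p \<le> x \<and> [p = a] (mod q). 1 / real p) - real (primes_pi x q a) / x -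
       (1 / real (totient q)) * (ln (ln x) - ln (ln 2) - li x / x) =
     (\<Sum>p | prime p \<and> real p \<le> x \<and> [p = a] (mod q). 1 / real p) - ln (ln x) / real (totient q)
              - prime_error x q a / x + ln (ln 2) / real (totient q)"
  proof -
    have "A - P / x - 1 / m * (b - c - L / x) = A - b / m - (P - L / m) / x + c / m" for A P b c L m :: real
      by (simp add: diff_divide_distrib right_diff_distrib)
    thus ?thesis unfolding prime_error_def by blast
  qed
  finally show ?thesis .
qed

lemma li_over_x_tendsto_0: "((\<lambda>x. li x / x) \<longlongrightarrow> 0) at_top"
proof (rule lhospital_at_top_at_top[where f' = "\<lambda>x. 1 / ln x" and g' = "\<lambda>_. 1"])
  show "eventually (\<lambda>x. (li has_real_derivative 1 / ln x) (at x)) at_top"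
    using eventually_gt_at_top[of 2]
  proof eventually_elim
    case (elim x)
    have "(li has_real_derivative 1 / ln x) (at x within {2..x + 1})"
      by (rule li_has_real_derivative) (use elim in auto)
    moreover have "at x within {2..x + 1} = at x"
      by (rule at_within_interior) (use elim in \<open>simp add: interior_atLeastAtMost_real\<close>)
    ultimately show ?case by (simp only:)
  qed
  show "((\<lambda>x::real. 1 / ln x / 1) \<longlongrightarrow> 0) at_top" by real_asymp
qed (auto intro!: derivative_eq_intros filterlim_ident)

text \<open>
  Each prime counted in \<open>(x/2, x]\<close> contributes at least \<open>1/x\<close> to the prime sum \<open>S\<close>, and
  \<open>S(x) - S(x/2) \<rightarrow> 0\<close> by Mertens' theorem.  So the density \<open>r\<close> satisfies
  \<open>r(x) \<le> r(x/2)/2 + o(1)\<close>, and iterating this inequality forces \<open>r \<rightarrow> 0\<close>.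
\<close>
lemma primes_pi_over_x_tendsto_0:
  assumes q: "q > 0" and a: "coprime a q"
  shows "((\<lambda>x. real (primes_pi x q a) / x) \<longlongrightarrow> 0) at_top"
proof -
  define S where "S = (\<lambda>x::real. \<Sum>p | prime p \<and> real p \<le> x \<and> [p = a] (mod q). 1 / real p)"
  define r where "r = (\<lambda>x. real (primes_pi x q a) / x)"
  define A where "A = (\<lambda>x::real. {p. prime p \<and> real p \<le> x \<and> [p = a] (mod q)})"
  have fin: "finite (A x)" for x unfolding A_def by (rule finite_primes_le)
  have r0: "r x \<ge> 0" if "x > 0" for x using that by (simp add: r_def)
  have r1: "r x \<le> 1" if x: "x > 0" for x
  proof -
    have "card (A x) \<le> card {1..nat \<lfloor>x\<rfloor>}"
      by (rule card_mono) (auto simp: A_def le_nat_floor Suc_le_eq prime_gt_0_nat)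
    also have "\<dots> = nat \<lfloor>x\<rfloor>" by simp
    finally have "real (card (A x)) \<le> x" using x by linarith
    thus ?thesis using x by (simp add: r_def primes_pi_def A_def)
  qed
  have step: "r x \<le> r (x / 2) / 2 + (S x - S (x / 2))" if x: "x > 0" for x
  proof -
    have sub: "A (x / 2) \<subseteq> A x" using x by (auto simp: A_def)
    have "real (card (A x - A (x / 2))) * (1 / x) = (\<Sum>p\<in>A x - A (x / 2). 1 / x)" by simp
    also have "\<dots> \<le> (\<Sum>p\<in>A x - A (x / 2). 1 / real p)"
      by (intro sum_mono divide_left_mono) (auto simp: A_def prime_gt_0_nat x)
    also have "\<dots> = S x - S (x / 2)"
      using sum_diff[OF fin sub, of "\<lambda>p. 1 / real p"] by (simp add: S_def A_def)
    finally have "real (card (A x - A (x / 2))) / x \<le> S x - S (x / 2)" by simp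
    moreover have "real (card (A x - A (x / 2))) = real (card (A x)) - real (card (A (x / 2)))"
      using sub fin by (simp add: card_Diff_subset card_mono of_nat_diff)
    ultimately show ?thesis by (simp add: r_def primes_pi_def A_def diff_divide_distrib)
  qed
  define m where "m = real (totient q)"
  have M: "((\<lambda>x. S x - ln (ln x) / m) \<longlongrightarrow> g q a) at_top"
    using Mertens_arithmetic_progression[OF q a] by (simp add: S_def m_def)
  have half: "filterlim (\<lambda>x::real. x / 2) at_top at_top" by real_asymp
  have "((\<lambda>x. (S x - ln (ln x) / m) - (S (x / 2) - ln (ln (x / 2)) / m) + (1 / m) * (ln (ln x) - ln (ln (x / 2))))
          \<longlongrightarrow> g q a - g q a + 1 / m * 0) at_top"
  proof (intro tendsto_intros M filterlim_compose[OF M half])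
    show "((\<lambda>x::real. ln (ln x) - ln (ln (x / 2))) \<longlongrightarrow> 0) at_top" by real_asymp
  qed
  hence u: "((\<lambda>x. S x - S (x / 2)) \<longlongrightarrow> 0) at_top" by (simp add: algebra_simps diff_divide_distrib)
  \<comment> \<open>Here \<open>2 e\<close> is the fixed point of the map \<open>t \<mapsto> t/2 + e\<close> that one halving step applies to the bound.\<close>
  have main: "eventually (\<lambda>x. r x \<le> (1 / 2) ^ k + 2 * e) at_top" if e: "e > 0" for e k
  proof (induction k)
    case 0
    show ?case using eventually_gt_at_top[of 0] by eventually_elim (use r1 e in \<open>smt (verit) power_0\<close>)
  next
    case (Suc k)
    have "eventually (\<lambda>x. r (x / 2) \<le> (1 / 2) ^ k + 2 * e) at_top"
      by (rule eventually_compose_filterlim[OF Suc.IH half])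
    moreover have "eventually (\<lambda>x. S x - S (x / 2) < e) at_top"
      using order_tendstoD(2)[OF u e] .
    ultimately show ?case using eventually_gt_at_top[of 0]
    proof eventually_elim
      case (elim x)
      show ?case using step[OF elim(3)] elim(1,2) by simp
    qed
  qed
  show ?thesis
  proof (rule tendstoI)
    fix e :: real assume e: "e > 0"
    obtain k where k: "(1 / 2 :: real) ^ k < e / 2" using real_arch_pow_inv[of "e/2" "1/2"] e by auto
    have "eventually (\<lambda>x. r x \<le> (1 / 2) ^ k + 2 * (e / 4)) at_top" using e by (intro main) simp
    thus "eventually (\<lambda>x. dist (real (primes_pi x q a) / x) 0 < e) at_top"
      using eventually_gt_at_top[of 0]
    proof eventually_elim
      case (elim x)
      thus ?case using k r0[of x] by (simp add: r_def)
    qed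
  qed
qed

theorem proposition3p1:
  fixes x :: real and q a :: nat
  assumes "x \<ge> 2" and "q > 0" and "a > 0" and "coprime q a"
  shows "((\<lambda>t. prime_error t q a / t ^ 2) has_integral
            (g q a + ln (ln 2) / real (totient q))) {2..} \<and>
         (\<Sum>p | prime p \<and> real p \<le> x \<and> [p = a] (mod q). 1 / real p) =
            ln (ln x) / real (totient q) + g q a + prime_error x q a / x
              - integral {x..} (\<lambda>t. prime_error t q a / t ^ 2)"
proof -
  have q: "q > 0" and a: "coprime a q" using assms by (auto simp: coprime_commute)
  define f where "f = (\<lambda>t. prime_error t q a / t ^ 2)"
  define m where "m = real (totient q)"
  define S where "S = (\<lambda>x::real. \<Sum>p | prime p \<and> real p \<le> x \<and> [p = a] (mod q). 1 / real p)"
  define F where "F = (\<lambda>x. S x - ln (ln x) / m - prime_error x q a / x + ln (ln 2) / m)"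
  have F: "(f has_integral F y) {2..y}" if "y \<ge> 2" for y
    using prime_error_has_integral[OF that] unfolding f_def F_def S_def m_def .
  have "((\<lambda>x. real (primes_pi x q a) / x - 1 / m * (li x / x)) \<longlongrightarrow> 0 - 1 / m * 0) at_top"
    by (intro tendsto_intros primes_pi_over_x_tendsto_0[OF q a] li_over_x_tendsto_0)
  hence "((\<lambda>x. prime_error x q a / x) \<longlongrightarrow> 0) at_top"
    by (simp add: prime_error_def m_def diff_divide_distrib)
  hence "(F \<longlongrightarrow> g q a - 0 + ln (ln 2) / m) at_top"
    unfolding F_def S_def m_def by (intro tendsto_intros Mertens_arithmetic_progression[OF q a])
  hence lim: "(F \<longlongrightarrow> g q a + ln (ln 2) / m) at_top" by simp
  have "(f has_integral (g q a + ln (ln 2) / m)) {2..}"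
    using F lim by (rule has_integral_improper_at_top)
  moreover have "(f has_integral (g q a + ln (ln 2) / m - F x)) {x..}"
  proof (rule has_integral_improper_at_top)
    fix y assume y: "y \<ge> x"
    have fy: "(f has_integral F y) {2..y}" by (rule F) (use assms y in simp)
    have "f integrable_on {x..y}"
      by (rule integrable_on_subinterval[OF has_integral_integrable[OF fy]]) (use assms in auto)
    hence xy: "(f has_integral integral {x..y} f) {x..y}" by (rule integrable_integral)
    have "(f has_integral (F x + integral {x..y} f)) {2..y}"
      by (rule has_integral_combine[OF _ _ F xy]) (use assms y in auto)
    hence "F x + integral {x..y} f = F y" using fy has_integral_unique by blast
    hence "integral {x..y} f = F y - F x" by linarith
    thus "(f has_integral (F y - F x)) {x..y}" using xy by (simp only:)
  next
    show "((\<lambda>y. F y - F x) \<longlongrightarrow> g q a + ln (ln 2) / m - F x) at_top"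
      by (intro tendsto_intros lim)
  qed
  hence "integral {x..} f = g q a + ln (ln 2) / m - F x" by (rule integral_unique)
  ultimately show ?thesis unfolding f_def F_def S_def m_def by simp
qed

end
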